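(* Let $n\ge1$, let $\gamma\in[-\frac1n,0)$ and let $s=\frac{\gamma}{1+\gamma n}$. For every pair of convex functions $V,\phi:\mathbb{R}^n\to\mathbb{R}_+$ such that $\lim_{|z|\to+\infty}V(z)/|z|=+\infty$ (and for which the quantities below are well defined), one has $$\mathrm{Var}_\mu(G)\le-\frac{\gamma}{1-\gamma}\int\frac{\left\langle(\mathrm{Hess}\,\phi)^{-1}\nabla(G\phi),\nabla(G\phi)\right\rangle}{\phi}\,d\mu+\frac{\gamma-s}{1-\gamma}\left(\int G\,d\mu\right)^2,$$ where $d\mu(z)=\dfrac{\phi(z)^{\frac1\gamma}}{\int\phi^{\frac1\gamma}}\,dz$ and $G=\dfrac{V(\nabla\phi)}{\phi}$.
   Context: $\nabla$ and $\mathrm{Hess}$ denote the gradient and Hessian on $\mathbb{R}^n$, $G\phi$ is the pointwise product of $G$ and $\phi$ (that is, $V(\nabla\phi)$), and $\mathrm{Var}_\mu(G)=\int G^2\,d\mu-(\int G\,d\mu)^2$. For $\gamma=-\frac1n$, $s$ is understood as $-\infty$. *)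

theory Defs
  imports "HOL-Analysis.Analysis"
begin

definition gradient :: "('a::real_inner \<Rightarrow> real) \<Rightarrow> 'a \<Rightarrow> 'a" where
  "gradient f z = (THE D. GDERIV f z :> D)"

definition Hess :: "(real ^ 'n \<Rightarrow> real) \<Rightarrow> real ^ 'n \<Rightarrow> real ^ 'n ^ 'n" where
  "Hess f z = jacobian (gradient f) (at z)"

definition variance_wrt :: "'a measure \<Rightarrow> ('a \<Rightarrow> real) \<Rightarrow> real" where
  "variance_wrt M g = (\<integral>z. (g z)\<^sup>2 \<partial>M) - (\<integral>z. g z \<partial>M)\<^sup>2"

definition mu :: "real \<Rightarrow> ('a::euclidean_space \<Rightarrow> real) \<Rightarrow> 'a measure" where
  "mu \<gamma> \<phi> = density lborel
     (\<lambda>z. ennreal (\<phi> z powr (1 / \<gamma>) / (\<integral>y. \<phi> y powr (1 / \<gamma>) \<partial>lborel)))"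

definition s_exponent :: "nat \<Rightarrow> real \<Rightarrow> ereal" where
  "s_exponent n \<gamma> =
     (if \<gamma> = - 1 / real n then - \<infinity> else ereal (\<gamma> / (1 + \<gamma> * real n)))"

definition G_fun :: "('a::real_inner \<Rightarrow> real) \<Rightarrow> ('a \<Rightarrow> real) \<Rightarrow> 'a \<Rightarrow> real" where
  "G_fun V \<phi> z = V (gradient \<phi> z) / \<phi> z"

definition G_phi :: "('a::real_inner \<Rightarrow> real) \<Rightarrow> ('a \<Rightarrow> real) \<Rightarrow> 'a \<Rightarrow> real" where
  "G_phi V \<phi> z = G_fun V \<phi> z * \<phi> z"

text \<open>The integral is taken in \<open>[0, \<infinity>]\<close>, so it has a value without any integrability
  assumption. No negative part is cut off by \<open>ennreal\<close>: for convex \<open>\<phi> > 0\<close> the integrand is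
  nonnegative wherever the Hessian is invertible.\<close>

definition energy :: "real \<Rightarrow> (real ^ 'n \<Rightarrow> real) \<Rightarrow> (real ^ 'n \<Rightarrow> real) \<Rightarrow> ennreal" where
  "energy \<gamma> V \<phi> =
     (\<integral>\<^sup>+z. ennreal (((matrix_inv (Hess \<phi> z) *v gradient (G_phi V \<phi>) z)
                      \<bullet> gradient (G_phi V \<phi>) z) / \<phi> z) \<partial>mu \<gamma> \<phi>)"

text \<open>What it means for the quantities in the inequality to be well defined. \<open>\<phi>\<close> has to be twice
  differentiable at every point: a convex function always is almost everywhere, but a Hessian that
  misses a singular part of the second derivative is not the intended object. The integrand of
  \<open>energy\<close>, in contrast, is only needed almost everywhere, which admits nonsmooth \<open>V\<close> and a Hessian
  degenerating on a null set.\<close>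

definition well_defined :: "real \<Rightarrow> (real ^ 'n \<Rightarrow> real) \<Rightarrow> (real ^ 'n \<Rightarrow> real) \<Rightarrow> bool" where
  "well_defined \<gamma> V \<phi> \<longleftrightarrow>
     (\<forall>z. \<phi> z \<noteq> 0) \<and>
     (\<forall>z. \<phi> differentiable (at z)) \<and>
     (\<forall>z. gradient \<phi> differentiable (at z)) \<and>
     (AE z in lborel. invertible (Hess \<phi> z)) \<and>
     (AE z in lborel. G_phi V \<phi> differentiable (at z)) \<and>
     integrable lborel (\<lambda>z. \<phi> z powr (1 / \<gamma>)) \<and>
     integrable (mu \<gamma> \<phi>) (G_fun V \<phi>) \<and>
     integrable (mu \<gamma> \<phi>) (\<lambda>z. (G_fun V \<phi> z)\<^sup>2)"

end

theory Submission
  imports Defs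
begin

text \<open>Write \<open>\<beta> = -1/\<gamma>\<close> and \<open>n\<close> for the dimension. For \<open>\<beta> = n\<close> the right-hand side is infinite unless \<open>G\<close>
  vanishes almost everywhere, so let \<open>\<beta> > n\<close>. The inequality is the second variation of the
  Borell-Brascamp-Lieb inequality: perturbing \<open>\<phi>\<close> by \<open>\<plusminus> t V(\<nabla>\<phi>)\<close> through supremal and infimal convolution
  with the conjugate of \<open>V\<close> gives convex functions whose midpoint combination lies above \<open>\<phi>\<close>, hence
  \<open>I\<^sup>s \<le> (I\<^sub>+\<^sup>s + I\<^sub>-\<^sup>s)/2\<close> for the integrals of the powers \<open>-\<beta>\<close>, and the terms of order \<open>t\<^sup>2\<close> yield the claim.
  Everything is first integrated over a ball, where the convex functions carry no boundary terms; the
  radius then tends to infinity. The \<open>t\<^sup>2\<close> terms converge in \<open>L\<^sup>1\<close> of the ball because \<open>\<phi>\<close> is twice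
  differentiable at every point, so that its Hessian recovers the gradient along every line.

  The Borell-Brascamp-Lieb inequality itself comes from the Brunn-Minkowski inequality for the sublevel
  sets and a one-dimensional transport of the levels.\<close>

section \<open>The Brunn-Minkowski inequality\<close>

text \<open>Because \<open>s\<close> and \<open>- \<beta>\<close> are negative, the midpoint
  inequality only asks for lower bounds of the two perturbed integrals, hence for upper bounds of
  the perturbed functions. Every affine minorant of \<open>V\<close> gives one for the infimal
  convolution. In the supremal one, slopes away from \<open>q\<close>, the gradient of
  \<open>V\<close> at \<open>\<nabla>\<phi>\<close>, lose a term of order \<open>t\<close> that
  outweighs their gain of order \<open>t\<^sup>2\<close>. The surviving coefficient is half the
  Hessian form of \<open>\<phi>\<close> at \<open>q\<close>; this is half the energy density up to
  its weight, since the inverse Hessian undoes the chain rule for \<open>V(\<nabla>\<phi>)\<close>.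
  The obstacle is that the remainders depend on a continuum of slopes and have no evident integrable
  majorant independent of \<open>t\<close>. Convexity in the slope reduces them to finitely many
  directions, whose scaled remainders converge in \<open>L\<^sup>1\<close> and serve as moving
  majorants. The factor \<open>1 - s\<close> comes from the second derivative of
  \<open>x powr s\<close>, and \<open>\<beta> * (\<beta> + 1) / 2\<close> from that of
  \<open>x powr - \<beta>\<close>.\<close>

definition box_family :: "'a::euclidean_space set set \<Rightarrow> bool" where
  "box_family F \<longleftrightarrow> finite F \<and> (\<forall>S\<in>F. S \<noteq> {} \<and> (\<exists>a b. S = box a b)) \<and> pairwise disjnt F"

lemma box_Int_halfspace:
  fixes a b :: "'a::euclidean_space"
  assumes "k \<in> Basis"
  shows "box a b \<inter> {x. x \<bullet> k < c} = box a (\<Sum>i\<in>Basis. (if i = k then min (b \<bullet> k) c else b \<bullet> i) *\<^sub>R i)"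
    and "box a b \<inter> {x. c < x \<bullet> k} = box (\<Sum>i\<in>Basis. (if i = k then max (a \<bullet> k) c else a \<bullet> i) *\<^sub>R i) b"
  using assms by (rule_tac set_eqI; auto simp: mem_box)+

text \<open>Explicit in \<open>c\<close>, so that the volume of a box below a moving hyperplane is
  visibly continuous. The outer \<open>max\<close> covers half-spaces that miss the box.\<close>

lemma measure_box_Int_halfspace:
  fixes a b :: "'a::euclidean_space"
  assumes k: "k \<in> Basis" and ne: "box a b \<noteq> {}"
  shows "measure lborel (box a b \<inter> {x. x \<bullet> k < c})
    = max 0 (min (b \<bullet> k) c - a \<bullet> k) * (\<Prod>i\<in>Basis - {k}. (b - a) \<bullet> i)"
proof -
  let ?b = "\<Sum>i\<in>Basis. (if i = k then min (b \<bullet> k) c else b \<bullet> i) *\<^sub>R i"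
  have lt: "a \<bullet> i < b \<bullet> i" if "i \<in> Basis" for i
    using ne that by (auto simp: box_ne_empty)
  show ?thesis
  proof (cases "a \<bullet> k \<le> min (b \<bullet> k) c")
    case True
    then have "\<forall>i\<in>Basis. a \<bullet> i \<le> ?b \<bullet> i" using lt by (auto intro: less_imp_le)
    then have "measure lborel (box a ?b) = (\<Prod>i\<in>Basis. (?b - a) \<bullet> i)"
      by (simp add: measure_lborel_box_eq)
    also have "\<dots> = (?b - a) \<bullet> k * (\<Prod>i\<in>Basis-{k}. (?b - a) \<bullet> i)"
      by (rule prod.remove) (use k in auto)
    also have "(\<Prod>i\<in>Basis-{k}. (?b - a) \<bullet> i) = (\<Prod>i\<in>Basis-{k}. (b - a) \<bullet> i)"
      by (rule prod.cong) (auto simp: inner_diff_left)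
    finally show ?thesis using True k by (simp add: box_Int_halfspace inner_diff_left)
  next
    case False
    then have "\<not> (\<forall>i\<in>Basis. a \<bullet> i \<le> ?b \<bullet> i)" using k by (auto intro!: bexI[of _ k])
    then have "measure lborel (box a ?b) = 0"
      by (simp only: measure_lborel_box_eq if_False)
    moreover have "max 0 (min (b \<bullet> k) c - a \<bullet> k) = 0" using False by linarith
    ultimately show ?thesis using k by (simp add: box_Int_halfspace)
  qed
qed

lemma box_family_borel: "box_family F \<Longrightarrow> S \<in> F \<Longrightarrow> S \<in> sets borel"
  by (auto simp: box_family_def)

lemma box_family_fmeasurable: "box_family F \<Longrightarrow> S \<in> F \<Longrightarrow> S \<in> fmeasurable lborel"
  by (auto simp: box_family_def)

lemma box_family_Union_fmeasurable: "box_family F \<Longrightarrow> \<Union>F \<in> fmeasurable lborel"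
  using fmeasurable.finite_Union[of F lborel] box_family_fmeasurable
  by (auto simp: box_family_def)

lemma box_family_measure_pos:
  assumes "box_family F" "F \<noteq> {}"
  shows "0 < measure lborel (\<Union>F)"
proof -
  obtain S where S: "S \<in> F" using assms by auto
  then obtain a b where ab: "S = box a b" "box a b \<noteq> {}"
    using assms unfolding box_family_def by metis
  then have "0 < measure lborel S"
    by (auto simp: measure_lborel_box_eq box_ne_empty inner_diff_left intro!: prod_pos less_imp_le)
  also have "\<dots> \<le> measure lborel (\<Union>F)"
    using S assms by (intro measure_mono_fmeasurable box_family_Union_fmeasurable)
      (auto intro: box_family_borel)
  finally show ?thesis .
qed

text \<open>Open half-spaces cut open boxes into open boxes, at the price of the null set on the
  hyperplane. The two bounds on the number of boxes drive the induction for the Brunn-Minkowski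
  inequality: no cut raises it, and a cut that loses a whole box lowers it.\<close>

lemma box_family_split:
  assumes F: "box_family F" and "k \<in> Basis" and H: "H = {x. x \<bullet> k < c} \<or> H = {x. c < x \<bullet> k}"
  shows "box_family ((\<lambda>S. S \<inter> H) ` F - {{}})" "\<Union>((\<lambda>S. S \<inter> H) ` F - {{}}) = \<Union>F \<inter> H"
    "card ((\<lambda>S. S \<inter> H) ` F - {{}}) \<le> card F"
    "S \<in> F \<Longrightarrow> S \<inter> H = {} \<Longrightarrow> card ((\<lambda>S. S \<inter> H) ` F - {{}}) < card F"
proof -
  have fin: "finite F" using F by (simp add: box_family_def)
  have "\<exists>a b. S \<inter> H = box a b" if "S \<in> F" for S
  proof -
    obtain a b where "S = box a b" using F \<open>S \<in> F\<close> unfolding box_family_def by blast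
    then show ?thesis using H
      by (elim disjE) (simp only: box_Int_halfspace[OF \<open>k \<in> Basis\<close>], blast)+
  qed
  moreover have "pairwise disjnt ((\<lambda>S. S \<inter> H) ` F - {{}})"
  proof (rule pairwiseI)
    fix A B assume "A \<in> (\<lambda>S. S \<inter> H) ` F - {{}}" "B \<in> (\<lambda>S. S \<inter> H) ` F - {{}}" "A \<noteq> B"
    then obtain S T where "S \<in> F" "T \<in> F" "S \<noteq> T" "A = S \<inter> H" "B = T \<inter> H" by auto
    moreover have "disjnt S T" using F calculation by (simp add: box_family_def pairwise_def)
    ultimately show "disjnt A B" by (auto simp: disjnt_def)
  qed
  ultimately show "box_family ((\<lambda>S. S \<inter> H) ` F - {{}})"
    using fin unfolding box_family_def by blast
  show "\<Union>((\<lambda>S. S \<inter> H) ` F - {{}}) = \<Union>F \<inter> H" by auto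
  show "card ((\<lambda>S. S \<inter> H) ` F - {{}}) \<le> card F"
    by (rule order_trans[OF card_mono[OF finite_imageI[OF fin] Diff_subset] card_image_le[OF fin]])
  assume S: "S \<in> F" "S \<inter> H = {}"
  have "(\<lambda>S. S \<inter> H) ` F - {{}} \<subseteq> (\<lambda>S. S \<inter> H) ` (F - {S})" using S by auto
  then have "card ((\<lambda>S. S \<inter> H) ` F - {{}}) \<le> card (F - {S})"
    by (intro order_trans[OF card_mono card_image_le]) (use fin in auto)
  also have "\<dots> < card F" using S fin by (intro card_Diff1_less)
  finally show "card ((\<lambda>S. S \<inter> H) ` F - {{}}) < card F" .
qed

lemma hyperplane_null:
  assumes "k \<in> Basis" shows "{x::'a::euclidean_space. x \<bullet> k = c} \<in> null_sets lborel"
proof -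
  have "negligible {x::'a. x \<bullet> k = c}" using assms by (rule negligible_standard_hyperplane)
  moreover have "{x::'a. x \<bullet> k = c} \<in> sets borel" by measurable
  ultimately show ?thesis
    by (simp add: negligible_iff_null_sets null_sets_def)
qed

lemma measure_split_hyperplane:
  assumes A: "A \<in> fmeasurable lborel" and k: "(k::'a::euclidean_space) \<in> Basis"
  shows "measure lborel A = measure lborel (A \<inter> {x. x \<bullet> k < c}) + measure lborel (A \<inter> {x. c < x \<bullet> k})"
proof -
  have [measurable]: "A \<in> sets borel" using A by (auto simp: fmeasurable_def)
  have f: "A \<inter> {x. x \<bullet> k < c} \<in> fmeasurable lborel" "A \<inter> {x. c < x \<bullet> k} \<in> fmeasurable lborel"
    by (rule fmeasurableI2[OF A]; auto)+
  have "measure lborel A = measure lborel (A - {x. x \<bullet> k = c})"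
    by (rule measure_Diff_null_set[symmetric]) (use hyperplane_null[OF k] in auto)
  also have "A - {x. x \<bullet> k = c} = (A \<inter> {x. x \<bullet> k < c}) \<union> (A \<inter> {x. c < x \<bullet> k})" by auto
  also have "measure lborel \<dots> = measure lborel (A \<inter> {x. x \<bullet> k < c}) + measure lborel (A \<inter> {x. c < x \<bullet> k})"
    using f by (intro measure_Union) (auto simp: fmeasurable_def less_top)
  finally show ?thesis .
qed

text \<open>The intermediate value theorem for the volume below the hyperplane, a continuous
  function of its position that runs from zero at \<open>lo\<close> to the full volume at
  \<open>hi\<close>.\<close>

lemma box_family_cut_fraction:
  assumes F: "box_family F" and k: "k \<in> Basis" and l: "0 < l" "l < 1"
  obtains c where "measure lborel (\<Union>F \<inter> {x. x \<bullet> k < c}) = l * measure lborel (\<Union>F)"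
proof (cases "F = {}")
  case True then show ?thesis using that[of 0] by simp
next
  case False
  have fin: "finite F" using F by (simp add: box_family_def)
  define g where "g c = measure lborel (\<Union>F \<inter> {x. x \<bullet> k < c})" for c
  obtain a b where ab: "\<And>S. S \<in> F \<Longrightarrow> S = box (a S) (b S) \<and> box (a S) (b S) \<noteq> {}"
    using F unfolding box_family_def by metis
  have "g c = (\<Sum>S\<in>F. measure lborel (S \<inter> {x. x \<bullet> k < c}))" for c
  proof -
    have "g c = measure lborel (\<Union>S\<in>F. S \<inter> {x. x \<bullet> k < c})" unfolding g_def by simp
    also have "\<dots> = (\<Sum>S\<in>F. measure lborel (S \<inter> {x. x \<bullet> k < c}))"
    proof (rule measure_finite_Union[OF fin])
      have [measurable]: "S \<in> sets borel" if "S \<in> F" for S using box_family_borel[OF F that] .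
      show "(\<lambda>S. S \<inter> {x. x \<bullet> k < c}) ` F \<subseteq> sets lborel" by auto
      show "disjoint_family_on (\<lambda>S. S \<inter> {x. x \<bullet> k < c}) F"
        using F by (fastforce simp: box_family_def disjoint_family_on_def pairwise_def disjnt_def)
      show "emeasure lborel (S \<inter> {x. x \<bullet> k < c}) \<noteq> \<infinity>" if "S \<in> F" for S
        using fmeasurableI2[OF box_family_fmeasurable[OF F that], of "S \<inter> {x. x \<bullet> k < c}"] that
        by (auto simp: fmeasurable_def less_top)
    qed
    finally show ?thesis .
  qed
  then have g: "g c = (\<Sum>S\<in>F. max 0 (min (b S \<bullet> k) c - a S \<bullet> k) * (\<Prod>i\<in>Basis - {k}. (b S - a S) \<bullet> i))" for c
    using ab measure_box_Int_halfspace[OF k] by (metis (no_types, lifting) sum.cong)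
  have cont: "continuous_on UNIV g"
    unfolding g[abs_def] by (intro continuous_intros)
  define lo where "lo = Min ((\<lambda>S. a S \<bullet> k) ` F)"
  define hi where "hi = Max ((\<lambda>S. b S \<bullet> k) ` F)"
  have lo: "lo \<le> a S \<bullet> k" if "S \<in> F" for S using fin that by (auto simp: lo_def)
  have hi: "b S \<bullet> k \<le> hi" if "S \<in> F" for S using fin that by (auto simp: hi_def)
  have inS: "a S \<bullet> k < x \<bullet> k" "x \<bullet> k < b S \<bullet> k" if "S \<in> F" "x \<in> S" for S x
    using ab[OF that(1)] that(2) k by (metis mem_box(1))+
  have "x \<bullet> k \<ge> lo" "x \<bullet> k < hi" if "S \<in> F" "x \<in> S" for S x
    using inS[OF that] lo[OF that(1)] hi[OF that(1)] by linarith+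
  note inF = this
  have "\<Union>F \<inter> {x. x \<bullet> k < lo} = {}"
    using inF(1) by (auto simp: not_less[symmetric])
  then have g0: "g lo = 0" by (simp add: g_def)
  have "\<Union>F \<inter> {x. x \<bullet> k < hi} = \<Union>F"
    using inF(2) by auto
  then have g1: "g hi = measure lborel (\<Union>F)" by (simp add: g_def)
  obtain S where S: "S \<in> F" using False by auto
  obtain x where "x \<in> S" using ab[OF S] by blast
  then have "lo \<le> hi" using inF[OF S] by force
  moreover have "0 < measure lborel (\<Union>F)" using box_family_measure_pos[OF F False] .
  ultimately obtain c where "g c = l * measure lborel (\<Union>F)"
    using IVT'[of g lo "l * measure lborel (\<Union>F)" hi] l g0 g1 cont
    by (metis continuous_on_subset less_imp_le mult_left_le_one_le mult_nonneg_nonneg subset_UNIV)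
  then show ?thesis using that by (simp add: g_def)
qed

text \<open>This is the Brunn-Minkowski inequality for two boxes with side lengths \<open>x\<close>
  and \<open>y\<close>. After division by the right-hand side, the arithmetic-geometric mean
  inequality applies to the ratios \<open>x i / (x i + y i)\<close> and to the ratios
  \<open>y i / (x i + y i)\<close>; the two arithmetic means add up to 1.\<close>

lemma prod_root_superadditive:
  fixes x y :: "'a::euclidean_space \<Rightarrow> real"
  assumes "\<And>i. i \<in> Basis \<Longrightarrow> 0 < x i" "\<And>i. i \<in> Basis \<Longrightarrow> 0 < y i"
  shows "root DIM('a) (\<Prod>i\<in>Basis. x i) + root DIM('a) (\<Prod>i\<in>Basis. y i)
    \<le> root DIM('a) (\<Prod>i\<in>Basis. x i + y i)"
proof -
  let ?n = "DIM('a)"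
  let ?P = "\<Prod>i\<in>Basis. x i + y i"
  have P: "0 < ?P" using assms by (auto intro!: prod_pos add_pos_pos)
  have am: "root ?n (\<Prod>i\<in>Basis. z i) \<le> root ?n ?P * (\<Sum>i\<in>Basis. z i / (x i + y i) / ?n)"
    if z: "\<And>i. i \<in> Basis \<Longrightarrow> 0 < z i" for z
  proof -
    have q: "0 \<le> z i / (x i + y i)" if "i \<in> Basis" for i
      using z[OF that] assms[OF that] by simp
    then have "root ?n (\<Prod>i\<in>Basis. z i / (x i + y i)) = (\<Prod>i\<in>Basis. z i / (x i + y i)) powr (1 / ?n)"
      by (intro root_powr_inverse prod_nonneg) auto
    also have "\<dots> \<le> (\<Sum>i\<in>Basis. z i / (x i + y i) / ?n)"
      using q by (intro arith_geom_mean) auto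
    finally have "root ?n ?P * root ?n (\<Prod>i\<in>Basis. z i / (x i + y i))
      \<le> root ?n ?P * (\<Sum>i\<in>Basis. z i / (x i + y i) / ?n)"
      using P by (intro mult_left_mono) auto
    moreover have "root ?n ?P * root ?n (\<Prod>i\<in>Basis. z i / (x i + y i)) = root ?n (\<Prod>i\<in>Basis. z i)"
    proof -
      have "\<forall>i\<in>Basis. x i + y i \<noteq> 0" using assms by (metis add_pos_pos less_irrefl)
      then show ?thesis using P by (simp add: prod_dividef real_root_divide)
    qed
    ultimately show ?thesis by simp
  qed
  have "(\<Sum>i\<in>Basis. x i / (x i + y i) / ?n) + (\<Sum>i\<in>Basis. y i / (x i + y i) / ?n)
    = (\<Sum>i\<in>(Basis::'a set). 1 / ?n)"
    unfolding sum.distrib[symmetric] using assms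
    by (intro sum.cong refl) (simp add: add_divide_distrib[symmetric], metis add_pos_pos less_irrefl)
  also have "\<dots> = 1" by simp
  finally have *: "(\<Sum>i\<in>Basis. x i / (x i + y i) / ?n) + (\<Sum>i\<in>Basis. y i / (x i + y i) / ?n) = 1" .
  show ?thesis using add_mono[OF am[of x] am[of y]] assms *
    by (simp add: distrib_left[symmetric])
qed

text \<open>Hadwiger-Ohmann: cut the first set by a hyperplane separating two of its boxes and the second
  one by a parallel hyperplane dividing its volume in the same ratio; the two resulting sums lie on
  different sides of a third parallel hyperplane.\<close>

lemma Brunn_Minkowski_boxes:
  fixes F G :: "'a::euclidean_space set set"
  assumes "box_family F" "box_family G" "F \<noteq> {}" "G \<noteq> {}" "C \<in> fmeasurable lborel"
    and "\<And>x y. x \<in> \<Union>F \<Longrightarrow> y \<in> \<Union>G \<Longrightarrow> x + y \<in> C"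
  shows "(root DIM('a) (measure lborel (\<Union>F)) + root DIM('a) (measure lborel (\<Union>G))) ^ DIM('a)
    \<le> measure lborel C"
  using assms
proof (induction "card F + card G" arbitrary: F G C rule: less_induct)
  case less
  let ?n = "DIM('a)"
  \<comment> \<open>Stated for fresh families, with the induction hypothesis as a premise, so that
    it can be used again with the two families interchanged.\<close>
  have step: "(root ?n (measure lborel (\<Union>F)) + root ?n (measure lborel (\<Union>G))) ^ ?n \<le> measure lborel C"
    if FG: "box_family F" "box_family G" "F \<noteq> {}" "G \<noteq> {}"
      and sum: "\<And>x y. x \<in> \<Union>F \<Longrightarrow> y \<in> \<Union>G \<Longrightarrow> x + y \<in> C"
      and c: "card F + card G = card F0 + card G0" and two: "card F > 1"
      and IH: "\<And>(F' :: 'a set set) G' C'. card F' + card G' < card F0 + card G0 \<Longrightarrow> box_family F' \<Longrightarrow> box_family G' \<Longrightarrow> F' \<noteq> {} \<Longrightarrow> G' \<noteq> {}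
         \<Longrightarrow> C' \<in> fmeasurable lborel \<Longrightarrow> (\<And>x y. x \<in> \<Union>F' \<Longrightarrow> y \<in> \<Union>G' \<Longrightarrow> x + y \<in> C') \<Longrightarrow>
         (root ?n (measure lborel (\<Union>F')) + root ?n (measure lborel (\<Union>G'))) ^ ?n \<le> measure lborel C'"
    for F G F0 G0 :: "'a set set"
  proof -
    have finF: "finite F" using FG by (simp add: box_family_def)
    obtain S T where ST: "S \<in> F" "T \<in> F" "S \<noteq> T"
      using two finF by (metis One_nat_def card_le_Suc0_iff_eq not_le)
    obtain a b where S: "S = box a b" "box a b \<noteq> {}" using FG ST unfolding box_family_def by metis
    obtain a' b' where T: "T = box a' b'" "box a' b' \<noteq> {}" using FG ST unfolding box_family_def by metis
    have "box a b \<inter> box a' b' = {}" using FG ST S T by (auto simp: box_family_def pairwise_def disjnt_def)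
    then obtain k where k: "k \<in> Basis" "b \<bullet> k \<le> a' \<bullet> k \<or> b' \<bullet> k \<le> a \<bullet> k"
      using S T unfolding disjoint_interval(4) by (auto simp: box_ne_empty not_le[symmetric])
    obtain S' T' c0 where sep: "S' \<in> F" "T' \<in> F" "S' \<noteq> {}" "T' \<noteq> {}"
      "\<And>x. x \<in> S' \<Longrightarrow> x \<bullet> k < c0" "\<And>x. x \<in> T' \<Longrightarrow> c0 < x \<bullet> k"
    proof (cases "b \<bullet> k \<le> a' \<bullet> k")
      case True
      show ?thesis by (rule that[of S T "b \<bullet> k"]) (use True k(1) ST S T in \<open>auto simp: mem_box intro: order.strict_trans1\<close>)
    next
      case False
      show ?thesis by (rule that[of T S "b' \<bullet> k"]) (use False k ST S T in \<open>auto simp: mem_box intro: order.strict_trans1\<close>)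
    qed
    define L where "L c = {x::'a. x \<bullet> k < c}" for c
    define U where "U c = {x::'a. c < x \<bullet> k}" for c
    define cut where "cut H E = (\<lambda>S. S \<inter> H) ` E - {{}}" for H :: "'a set" and E
    note cuts = box_family_split[OF _ k(1), folded cut_def L_def U_def]
    have UF: "\<Union>(cut (L c) F) = \<Union>F \<inter> L c" "\<Union>(cut (U c) F) = \<Union>F \<inter> U c" for c
      by (auto simp: cut_def)
    have UG: "\<Union>(cut (L c) G) = \<Union>G \<inter> L c" "\<Union>(cut (U c) G) = \<Union>G \<inter> U c" for c
      by (auto simp: cut_def)
    have "S' \<inter> L c0 = S'" "T' \<inter> U c0 = T'" using sep(5,6) by (auto simp: L_def U_def)
    then have "S' \<in> cut (L c0) F" "T' \<in> cut (U c0) F"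
      using sep(1-4) unfolding cut_def by (metis (no_types) Diff_iff image_eqI singletonD)+
    then have F1: "cut (L c0) F \<noteq> {}" "cut (U c0) F \<noteq> {}" by auto
    \<comment> \<open>\<open>T'\<close> is lost below the hyperplane and \<open>S'\<close> above it,
      so either side has fewer boxes than \<open>F\<close>.\<close>
    have disj: "T' \<inter> L c0 = {}" "S' \<inter> U c0 = {}" using sep(5,6) by (auto simp: L_def U_def dest: less_asym)
    let ?f = "measure lborel (\<Union>F)" let ?g = "measure lborel (\<Union>G)"
    let ?f1 = "measure lborel (\<Union>F \<inter> L c0)" let ?f2 = "measure lborel (\<Union>F \<inter> U c0)"
    have f1: "0 < ?f1" using box_family_measure_pos[of "cut (L c0) F"] F1 cuts(1,2)[OF FG(1)] by metis
    have f2: "0 < ?f2" using box_family_measure_pos[of "cut (U c0) F"] F1 cuts(1,2)[OF FG(1)] by metis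
    have f: "?f = ?f1 + ?f2" using measure_split_hyperplane[OF box_family_Union_fmeasurable[OF FG(1)] k(1)]
      by (simp add: L_def U_def)
    define l where "l = ?f1 / ?f"
    have l: "0 < l" "l < 1" "?f1 = l * ?f" "?f2 = (1 - l) * ?f"
      using f1 f2 f by (auto simp: l_def field_simps)
    obtain d where d: "measure lborel (\<Union>G \<inter> L d) = l * ?g"
      using box_family_cut_fraction[OF FG(2) k(1) l(1,2)] unfolding L_def by metis
    have gpos: "0 < ?g" using box_family_measure_pos[OF FG(2,4)] .
    have g2: "measure lborel (\<Union>G \<inter> U d) = (1 - l) * ?g"
      using measure_split_hyperplane[OF box_family_Union_fmeasurable[OF FG(2)] k(1), of d] d
      by (simp add: L_def U_def algebra_simps)
    have G1: "cut (L d) G \<noteq> {}" "cut (U d) G \<noteq> {}"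
      using cuts(2)[OF FG(2), of "L d" d] cuts(2)[OF FG(2), of "U d" d] d g2 l gpos
      by auto
    have CL: "C \<inter> L (c0 + d) \<in> fmeasurable lborel" "C \<inter> U (c0 + d) \<in> fmeasurable lborel"
      using fmeasurableD[OF \<open>C \<in> fmeasurable lborel\<close>]
      by (auto intro!: fmeasurableI2[OF \<open>C \<in> fmeasurable lborel\<close>] simp: L_def U_def)
    \<comment> \<open>Homogeneity is the reason for dividing both volumes in the same ratio: the
      bounds for the two sides become the fractions \<open>l\<close> and \<open>1 - l\<close> of the
      bound for the whole.\<close>
    have root: "(root ?n (m * ?f) + root ?n (m * ?g)) ^ ?n = m * (root ?n ?f + root ?n ?g) ^ ?n" if "0 \<le> m" for m
      using that by (simp add: real_root_mult distrib_left[symmetric] power_mult_distrib)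
    have 1: "l * (root ?n ?f + root ?n ?g) ^ ?n \<le> measure lborel (C \<inter> L (c0 + d))"
    proof -
      have "card (cut (L c0) F) + card (cut (L d) G) < card F0 + card G0"
        using cuts(4)[OF FG(1) _ sep(2) disj(1), of c0] cuts(3)[OF FG(2), of "L d" d] c by simp
      note lt = this
      have sm: "x + y \<in> C \<inter> L (c0 + d)" if "x \<in> \<Union>(cut (L c0) F)" "y \<in> \<Union>(cut (L d) G)" for x y
        using that sum unfolding UF UG by (auto simp: L_def inner_add_left intro: add_strict_mono)
      have "(root ?n (measure lborel (\<Union>(cut (L c0) F))) + root ?n (measure lborel (\<Union>(cut (L d) G)))) ^ ?n
        \<le> measure lborel (C \<inter> L (c0 + d))"
        by (rule IH[OF lt cuts(1)[OF FG(1) disjI1[OF refl]] cuts(1)[OF FG(2) disjI1[OF refl]] F1(1) G1(1) CL(1)]) (rule sm)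
      then show ?thesis using l d root[of l] by (simp add: UF UG)
    qed
    have 2: "(1 - l) * (root ?n ?f + root ?n ?g) ^ ?n \<le> measure lborel (C \<inter> U (c0 + d))"
    proof -
      have "card (cut (U c0) F) + card (cut (U d) G) < card F0 + card G0"
        using cuts(4)[OF FG(1) _ sep(1) disj(2), of c0] cuts(3)[OF FG(2), of "U d" d] c by simp
      note lt = this
      have sm: "x + y \<in> C \<inter> U (c0 + d)" if "x \<in> \<Union>(cut (U c0) F)" "y \<in> \<Union>(cut (U d) G)" for x y
        using that sum unfolding UF UG by (auto simp: U_def inner_add_left intro: add_strict_mono)
      have "(root ?n (measure lborel (\<Union>(cut (U c0) F))) + root ?n (measure lborel (\<Union>(cut (U d) G)))) ^ ?n
        \<le> measure lborel (C \<inter> U (c0 + d))"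
        by (rule IH[OF lt cuts(1)[OF FG(1) disjI2[OF refl]] cuts(1)[OF FG(2) disjI2[OF refl]] F1(2) G1(2) CL(2)]) (rule sm)
      then show ?thesis using l g2 root[of "1 - l"] by (simp add: UF UG)
    qed
    have "(root ?n ?f + root ?n ?g) ^ ?n = l * (root ?n ?f + root ?n ?g) ^ ?n + (1 - l) * (root ?n ?f + root ?n ?g) ^ ?n"
      by (simp add: algebra_simps)
    also have "\<dots> \<le> measure lborel (C \<inter> L (c0 + d)) + measure lborel (C \<inter> U (c0 + d))"
      using 1 2 by linarith
    also have "\<dots> = measure lborel C"
      using measure_split_hyperplane[OF \<open>C \<in> fmeasurable lborel\<close> k(1)] by (simp add: L_def U_def)
    finally show ?thesis .
  qed
  have IH: "(root ?n (measure lborel (\<Union>F')) + root ?n (measure lborel (\<Union>G'))) ^ ?n \<le> measure lborel C'"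
    if "card F' + card G' < card F + card G" "box_family F'" "box_family G'" "F' \<noteq> {}" "G' \<noteq> {}"
         "C' \<in> fmeasurable lborel" "\<And>x y. x \<in> \<Union>F' \<Longrightarrow> y \<in> \<Union>G' \<Longrightarrow> x + y \<in> C'" for F' G' :: "'a set set" and C'
    using less.hyps that by blast
  have cards: "card F \<ge> 1" "card G \<ge> 1"
    using less.prems by (auto simp: box_family_def Suc_le_eq card_gt_0_iff)
  consider "card F > 1" | "card G > 1" | "card F = 1" "card G = 1" using cards by linarith
  then show ?case
  proof cases
    case 1
    then show ?thesis using step[OF less.prems(1-4) less.prems(6), of F G] IH by blast
  next
    case 2
    have "(root ?n (measure lborel (\<Union>G)) + root ?n (measure lborel (\<Union>F))) ^ ?n \<le> measure lborel C"
    proof (rule step[OF less.prems(2,1,4,3)])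
      show "x + y \<in> C" if "x \<in> \<Union>G" "y \<in> \<Union>F" for x y
        using less.prems(6)[OF that(2,1)] by (simp add: add.commute)
    qed (rule add.commute, rule 2, rule IH)
    then show ?thesis by (simp add: add.commute)
  next
    case 3
    then obtain S T where "F = {S}" "G = {T}" by (metis card_1_singletonE)
    then obtain a b a' b' where ST: "F = {box a b}" "G = {box a' b'}" "box a b \<noteq> {}" "box a' b' \<noteq> {}"
      using less.prems(1,2) unfolding box_family_def by auto
    then have lt: "a \<bullet> i < b \<bullet> i" "a' \<bullet> i < b' \<bullet> i" if "i \<in> Basis" for i
      using that by (auto simp: box_ne_empty)
    have sub: "box (a + a') (b + b') \<subseteq> C"
    proof
      fix z assume z: "z \<in> box (a + a') (b + b')"
      \<comment> \<open>The relative position of \<open>z\<close> in the sum box, coordinate by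
        coordinate. The same relative position in either summand decomposes
        \<open>z\<close>.\<close>
      define \<theta> where "\<theta> i = ((z - (a + a')) \<bullet> i) / (((b + b') - (a + a')) \<bullet> i)" for i
      define x where "x = (\<Sum>i\<in>Basis. (a \<bullet> i + \<theta> i * (b \<bullet> i - a \<bullet> i)) *\<^sub>R i)"
      have \<theta>: "0 < \<theta> i" "\<theta> i < 1"
        and e: "z \<bullet> i = (a \<bullet> i + a' \<bullet> i) + \<theta> i * ((b \<bullet> i - a \<bullet> i) + (b' \<bullet> i - a' \<bullet> i))"
        if "i \<in> Basis" for i
      proof -
        have d: "0 < (b \<bullet> i - a \<bullet> i) + (b' \<bullet> i - a' \<bullet> i)" using lt[OF that] by linarith
        have t: "\<theta> i = (z \<bullet> i - (a \<bullet> i + a' \<bullet> i)) / ((b \<bullet> i - a \<bullet> i) + (b' \<bullet> i - a' \<bullet> i))"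
          by (simp add: \<theta>_def inner_simps algebra_simps)
        have zz: "a \<bullet> i + a' \<bullet> i < z \<bullet> i" "z \<bullet> i < b \<bullet> i + b' \<bullet> i"
          using z that by (auto simp: mem_box inner_simps)
        show "0 < \<theta> i" using d zz unfolding t by (intro divide_pos_pos) auto
        show "\<theta> i < 1" using d zz unfolding t by (subst pos_divide_less_eq) auto
        show "z \<bullet> i = (a \<bullet> i + a' \<bullet> i) + \<theta> i * ((b \<bullet> i - a \<bullet> i) + (b' \<bullet> i - a' \<bullet> i))"
          using d unfolding t by simp
      qed
      have xi: "x \<bullet> i = a \<bullet> i + \<theta> i * (b \<bullet> i - a \<bullet> i)" if "i \<in> Basis" for i
        using that by (simp add: x_def)
      have zi: "(z - x) \<bullet> i = a' \<bullet> i + \<theta> i * (b' \<bullet> i - a' \<bullet> i)" if "i \<in> Basis" for i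
        unfolding inner_diff_left xi[OF that] e[OF that] by (simp add: distrib_left)
      have conv: "u < u + \<theta> i * (v - u)" "u + \<theta> i * (v - u) < v" if "i \<in> Basis" "u < v" for i u v
        using \<theta>[OF that(1)] that(2) mult_strict_right_mono[of "\<theta> i" 1 "v - u"] by (simp_all only: mult_1 diff_gt_0_iff_gt less_diff_eq add.commute[of _ u] mult_pos_pos less_add_same_cancel1)
      have "x \<in> box a b" unfolding mem_box using conv lt by (simp add: xi)
      moreover have "z - x \<in> box a' b'" unfolding mem_box using conv lt by (simp add: zi)
      ultimately have "x + (z - x) \<in> C" using less.prems(6) ST by blast
      then show "z \<in> C" by simp
    qed
    have "root ?n (measure lborel (box a b)) + root ?n (measure lborel (box a' b'))
      \<le> root ?n (measure lborel (box (a + a') (b + b')))"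
    proof -
      have le: "\<forall>i\<in>Basis. a \<bullet> i \<le> b \<bullet> i" "\<forall>i\<in>Basis. a' \<bullet> i \<le> b' \<bullet> i"
        "\<forall>i\<in>Basis. (a + a') \<bullet> i \<le> (b + b') \<bullet> i"
        using lt by (simp_all add: inner_add_left add_mono less_imp_le)
      have "(\<Prod>i\<in>Basis. ((b + b') - (a + a')) \<bullet> i) = (\<Prod>i\<in>Basis. (b - a) \<bullet> i + (b' - a') \<bullet> i)"
        by (intro prod.cong) (auto simp: inner_simps)
      then show ?thesis
        using prod_root_superadditive[of "\<lambda>i. (b - a) \<bullet> i" "\<lambda>i. (b' - a') \<bullet> i"] lt
        unfolding measure_lborel_box_eq using le by (simp add: inner_diff_left)
    qed
    then have "(root ?n (measure lborel (box a b)) + root ?n (measure lborel (box a' b'))) ^ ?n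
      \<le> root ?n (measure lborel (box (a + a') (b + b'))) ^ ?n"
      by (intro power_mono) auto
    also have "\<dots> = measure lborel (box (a + a') (b + b'))" by simp
    also have "\<dots> \<le> measure lborel C"
      using sub less.prems(5) by (intro measure_mono_fmeasurable) auto
    finally show ?thesis using ST by simp
  qed
qed


section \<open>From finite unions of boxes to bounded open sets\<close>

lemma open_box_family_approx:
  fixes S :: "'a::euclidean_space set"
  assumes S: "open S" "bounded S" "S \<noteq> {}" and "0 < e"
  obtains F where "box_family F" "F \<noteq> {}" "\<Union>F \<subseteq> S" "measure lborel S - e < measure lborel (\<Union>F)"
proof -
  obtain D where D': "countable D" "D \<subseteq> Pow S" "\<And>X. X \<in> D \<Longrightarrow> \<exists>a b. X = cbox a b" "\<Union>D = S"
    using open_countable_Union_open_cbox[OF S(1)] by blast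
  then have D: "countable D" "\<And>X. X \<in> D \<Longrightarrow> X \<subseteq> S" "\<And>X. X \<in> D \<Longrightarrow> \<exists>a b. X = cbox a b" "\<Union>D = S"
    by auto
  then have "D \<noteq> {}" using S by auto
  define X where "X = from_nat_into D"
  have X: "range X = D" using D \<open>D \<noteq> {}\<close> by (simp add: X_def range_from_nat_into)
  then have XD: "X i \<in> D" for i by auto
  have fin: "emeasure lborel S < \<infinity>" by (rule emeasure_bounded_finite[OF S(2)])
  then have Sf: "S \<in> fmeasurable lborel" using S by (auto simp: fmeasurable_def)
  have Xb: "X i \<in> sets lborel" for i using D(3)[OF XD[of i]] by auto
  have "(\<lambda>n. measure lborel (\<Union>i<n. X i)) \<longlonglongrightarrow> measure lborel (\<Union>n. \<Union>i<n. X i)"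
  proof (rule Lim_measure_incseq)
    show "incseq (\<lambda>n. \<Union>i<n. X i)" unfolding incseq_def by (intro allI impI UN_mono) auto
    have "(\<Union>n. \<Union>i<n. X i) \<subseteq> S" using XD D by blast
    then show "emeasure lborel (\<Union>n. \<Union>i<n. X i) \<noteq> \<infinity>"
      using emeasure_mono[of "\<Union>n. \<Union>i<n. X i" S lborel] fin S(1) by (auto simp: top_unique)
  qed (use Xb in auto)
  moreover have "(\<Union>n. \<Union>i<n. X i) = S" using X D by blast
  ultimately have lim: "(\<lambda>n. measure lborel (\<Union>i<n. X i)) \<longlonglongrightarrow> measure lborel S" by simp
  have Spos: "0 < measure lborel S"
  proof -
    have "\<not> negligible S" by (rule open_not_negligible) (use S in auto)
    then have "emeasure lborel S \<noteq> 0"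
      using S(1) by (auto simp: negligible_iff_null_sets null_sets_def)
    then show ?thesis using Sf by (simp add: emeasure_eq_measure2 measure_nonneg less_le)
  qed
  \<comment> \<open>The maximum with 0 keeps the resulting family from being empty.\<close>
  have "max 0 (measure lborel S - e) < measure lborel S" using \<open>0 < e\<close> Spos by auto
  then have "eventually (\<lambda>n. max 0 (measure lborel S - e) < measure lborel (\<Union>i<n. X i)) sequentially"
    by (rule order_tendstoD(1)[OF lim])
  then obtain n where n: "max 0 (measure lborel S - e) < measure lborel (\<Union>i<n. X i)"
    by (auto simp: eventually_sequentially)
  define U where "U = (\<Union>i<n. X i)"
  \<comment> \<open>The closed boxes may overlap. The members of a division of their union do not,
    and the interiors of these are disjoint open boxes that miss only a null set.\<close>
  obtain p where p: "p division_of (\<Union>(X ` {..<n}))"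
  proof (rule elementary_unions_intervals[of "X ` {..<n}"])
    show "\<exists>a b. s = cbox a b" if "s \<in> X ` {..<n}" for s using that XD D(3) by blast
  qed auto
  have pU: "\<Union>p = U" "finite p" using p by (auto simp: division_of_def U_def)
  have pbox: "\<exists>a b. k = cbox a b" if "k \<in> p" for k using p that by (auto simp: division_of_def)
  define F where "F = interior ` p - {{}}"
  have F: "box_family F"
    unfolding box_family_def
  proof (intro conjI ballI)
    show "finite F" using pU by (simp add: F_def)
    fix T assume "T \<in> F"
    then obtain k where k: "k \<in> p" "T = interior k" and "T \<noteq> {}" by (auto simp: F_def)
    obtain a b where "k = cbox a b" using pbox[OF k(1)] by blast
    then have "T = box a b" using k(2) by simp
    then show "\<exists>a b. T = box a b" by blast
    show "T \<noteq> {}" by fact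
  next
    show "pairwise disjnt F"
    proof (rule pairwiseI)
      fix A B assume "A \<in> F" "B \<in> F" "A \<noteq> B"
      then obtain k l where "k \<in> p" "l \<in> p" "k \<noteq> l" "A = interior k" "B = interior l"
        by (auto simp: F_def)
      then show "disjnt A B" using division_ofD(5)[OF p] by (simp add: disjnt_def)
    qed
  qed
  have FU: "\<Union>F \<subseteq> U" using interior_subset pU by (auto simp: F_def)
  have Um: "U \<in> sets lborel" using Xb by (auto simp: U_def)
  have null: "k - interior k \<in> null_sets lborel" if "k \<in> p" for k
  proof -
    obtain a b where "k = cbox a b" using pbox \<open>k \<in> p\<close> by blast
    moreover have "cbox a b - box a b \<in> sets borel" by auto
    ultimately show ?thesis using negligible_frontier_interval[of a b]
      by (simp add: negligible_iff_null_sets null_sets_def interior_cbox)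
  qed
  have "(\<Union>k\<in>p. k - interior k) \<in> null_sets lborel"
    using null pU by (intro null_sets_UN') (auto intro: countable_finite)
  then have "measure lborel (U - (\<Union>k\<in>p. k - interior k)) = measure lborel U"
    by (intro measure_Diff_null_set Um)
  moreover have "measure lborel (U - (\<Union>k\<in>p. k - interior k)) \<le> measure lborel (\<Union>F)"
  proof (rule measure_mono_fmeasurable)
    show "U - (\<Union>k\<in>p. k - interior k) \<subseteq> \<Union>F" using pU by (auto simp: F_def)
    show "U - (\<Union>k\<in>p. k - interior k) \<in> sets lborel"
      by (intro sets.Diff[OF Um] sets.finite_UN[OF pU(2)] null_setsD2 null)
  qed (rule box_family_Union_fmeasurable[OF F])
  ultimately have big: "max 0 (measure lborel S - e) < measure lborel (\<Union>F)"
    using n by (simp add: U_def)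
  show ?thesis
  proof (rule that[OF F])
    show "F \<noteq> {}" using big by auto
    show "\<Union>F \<subseteq> S" using FU XD D unfolding U_def by blast
    show "measure lborel S - e < measure lborel (\<Union>F)" using big by simp
  qed
qed

lemma open_box_family_seq:
  fixes S :: "'a::euclidean_space set"
  assumes S: "open S" "bounded S" "S \<noteq> {}"
  obtains F where "\<And>m::nat. box_family (F m)" "\<And>m. F m \<noteq> {}" "\<And>m. \<Union>(F m) \<subseteq> S"
    "(\<lambda>m. measure lborel (\<Union>(F m))) \<longlonglongrightarrow> measure lborel S"
proof -
  have "\<exists>F. box_family F \<and> F \<noteq> {} \<and> \<Union>F \<subseteq> S \<and> measure lborel S - 1 / real (Suc m) < measure lborel (\<Union>F)" for m
    using open_box_family_approx[OF S, of "1 / real (Suc m)"] by (metis of_nat_0_less_iff zero_less_Suc zero_less_divide_1_iff)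
  then obtain F where F: "\<And>m. box_family (F m)" "\<And>m. F m \<noteq> {}" "\<And>m. \<Union>(F m) \<subseteq> S"
    "\<And>m. measure lborel S - 1 / real (Suc m) < measure lborel (\<Union>(F m))" by metis
  have Sf: "S \<in> fmeasurable lborel"
    using S emeasure_bounded_finite[OF S(2)] by (auto simp: fmeasurable_def)
  have "(\<lambda>m. measure lborel (\<Union>(F m))) \<longlonglongrightarrow> measure lborel S"
  proof (rule tendsto_sandwich)
    show "(\<lambda>m. measure lborel S - 1 / real (Suc m)) \<longlonglongrightarrow> measure lborel S"
      using tendsto_diff[OF tendsto_const LIMSEQ_Suc[OF lim_1_over_n]] by simp
    show "eventually (\<lambda>m. measure lborel (\<Union>(F m)) \<le> measure lborel S) sequentially"
      using F(3) Sf fmeasurableD[OF box_family_Union_fmeasurable[OF F(1)]]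
      by (intro always_eventually allI measure_mono_fmeasurable)
    show "eventually (\<lambda>m. measure lborel S - 1 / real (Suc m) \<le> measure lborel (\<Union>(F m))) sequentially"
      by (intro always_eventually allI less_imp_le F(4))
  qed auto
  then show ?thesis using that F by blast
qed

lemma Brunn_Minkowski_open:
  fixes S T :: "'a::euclidean_space set"
  assumes S: "open S" "bounded S" "S \<noteq> {}" and T: "open T" "bounded T" "T \<noteq> {}"
    and C: "C \<in> fmeasurable lborel" and sum: "\<And>x y. x \<in> S \<Longrightarrow> y \<in> T \<Longrightarrow> x + y \<in> C"
  shows "root DIM('a) (measure lborel S) + root DIM('a) (measure lborel T) \<le> root DIM('a) (measure lborel C)"
proof -
  let ?n = "DIM('a)"
  obtain F where F: "\<And>m::nat. box_family (F m)" "\<And>m. F m \<noteq> {}" "\<And>m. \<Union>(F m) \<subseteq> S"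
    "(\<lambda>m. measure lborel (\<Union>(F m))) \<longlonglongrightarrow> measure lborel S" using open_box_family_seq[OF S] by blast
  obtain G where G: "\<And>m::nat. box_family (G m)" "\<And>m. G m \<noteq> {}" "\<And>m. \<Union>(G m) \<subseteq> T"
    "(\<lambda>m. measure lborel (\<Union>(G m))) \<longlonglongrightarrow> measure lborel T" using open_box_family_seq[OF T] by blast
  have "(root ?n (measure lborel (\<Union>(F m))) + root ?n (measure lborel (\<Union>(G m)))) ^ ?n \<le> measure lborel C" for m
    using F(3)[of m] G(3)[of m] sum by (intro Brunn_Minkowski_boxes F G C) blast
  moreover have "(\<lambda>m. (root ?n (measure lborel (\<Union>(F m))) + root ?n (measure lborel (\<Union>(G m)))) ^ ?n)
    \<longlonglongrightarrow> (root ?n (measure lborel S) + root ?n (measure lborel T)) ^ ?n"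
    using F(4) G(4) by (intro tendsto_intros)
  ultimately have "(root ?n (measure lborel S) + root ?n (measure lborel T)) ^ ?n \<le> measure lborel C"
    by (rule_tac LIMSEQ_le_const2) auto
  then have "root ?n ((root ?n (measure lborel S) + root ?n (measure lborel T)) ^ ?n) \<le> root ?n (measure lborel C)"
    by simp
  then show ?thesis by (simp add: real_root_power_cancel)
qed

lemma measure_scaleR_image:
  fixes S :: "'a::euclidean_space set"
  assumes "S \<in> sets borel" "0 < c"
  shows "measure lborel ((*\<^sub>R) c ` S) = c ^ DIM('a) * measure lborel S"
proof -
  have im: "(\<lambda>x. c *\<^sub>R x) ` S = (\<lambda>x. (1 / c) *\<^sub>R x) -` S"
    using assms(2) by (auto simp: image_iff intro!: bexI[where x="(1 / c) *\<^sub>R _"])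
  have "(\<lambda>x. (1 / c) *\<^sub>R x) -` S \<inter> space borel \<in> sets borel"
    using assms(1) by (intro measurable_sets[of _ borel borel]) auto
  then have "(*\<^sub>R) c ` S \<in> sets borel" using im by simp
  then have "measure lborel ((*\<^sub>R) c ` S) = measure lebesgue ((*\<^sub>R) c ` S)"
    by simp
  also have "\<dots> = c ^ DIM('a) * measure lebesgue S"
    using assms(2) measure_lebesgue_affine[of c 0 S] by simp
  finally show ?thesis using assms by simp
qed

lemma Brunn_Minkowski_convex_combination:
  fixes S T :: "'a::euclidean_space set"
  assumes S: "open S" "bounded S" "S \<noteq> {}" and T: "open T" "bounded T" "T \<noteq> {}"
    and C: "C \<in> fmeasurable lborel" and l: "0 < l" "0 < m"
    and sum: "\<And>x y. x \<in> S \<Longrightarrow> y \<in> T \<Longrightarrow> l *\<^sub>R x + m *\<^sub>R y \<in> C"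
  shows "l * root DIM('a) (measure lborel S) + m * root DIM('a) (measure lborel T) \<le> root DIM('a) (measure lborel C)"
proof -
  have "root DIM('a) (measure lborel ((*\<^sub>R) l ` S)) + root DIM('a) (measure lborel ((*\<^sub>R) m ` T))
    \<le> root DIM('a) (measure lborel C)"
    by (rule Brunn_Minkowski_open) (use assms in \<open>auto intro: open_scaling bounded_scaling\<close>)
  then show ?thesis
    using S T l by (simp add: measure_scaleR_image real_root_mult real_root_power_cancel)
qed

section \<open>The Borell-Brascamp-Lieb inequality\<close>

text \<open>Weighted arithmetic-geometric mean inequality for the three numbers
  \<open>X powr p / A ^ n\<close>, \<open>A\<close> and 1 with weights 1, \<open>n\<close> and
  \<open>p - 1 - n\<close>, whose weighted geometric mean is \<open>X\<close>. It is carried out as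
  convexity of \<open>exp\<close> at \<open>x = ln X\<close>. The left-hand side is the tangent
  plane at \<open>X = A = 1\<close>.\<close>

lemma powr_over_power_tangent:
  fixes X A p :: real and n :: nat
  assumes "0 < X" "0 < A" "real n + 1 \<le> p"
  shows "1 + p * (X - 1) - n * (A - 1) \<le> X powr p / A ^ n"
proof -
  define x where "x = ln X"
  define a where "a = ln A"
  define z where "z = p * x - n * a"
  have X: "X = exp x" and A: "A = exp a" using assms by (auto simp: x_def a_def)
  have "X powr p / A ^ n = exp z"
    unfolding z_def X A by (simp add: powr_def exp_diff exp_of_nat_mult[symmetric])
  moreover have t: "exp x * (1 + (w - x)) \<le> exp w" for w
    using mult_left_mono[OF exp_ge_add_one_self[of "w - x"], of "exp x"] by (simp add: exp_add[symmetric])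
  have "exp x * (1 + (z - x)) + n * (exp x * (1 + (a - x))) + (p - 1 - n) * (exp x * (1 + (0 - x)))
    \<le> exp z + n * exp a + (p - 1 - n) * exp 0"
    using assms by (intro add_mono mult_left_mono t) auto
  moreover have "exp x * (1 + (z - x)) + n * (exp x * (1 + (a - x))) + (p - 1 - n) * (exp x * (1 + (0 - x))) = p * exp x"
    by (simp add: z_def algebra_simps)
  ultimately show ?thesis by (simp add: X A algebra_simps)
qed

text \<open>The pointwise estimate behind the transport of levels: \<open>x powr - \<kappa>\<close>
  and \<open>y powr - \<kappa>\<close> will be the two total integrals, \<open>a ^ n\<close> and
  \<open>b ^ n\<close> the volumes of the sublevel sets at the levels \<open>r\<close> and
  \<open>R\<close>. The tangent inequality is applied, with weights \<open>x\<close> and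
  \<open>y\<close>, after scaling all quantities by their midpoints \<open>\<sigma>\<close>,
  \<open>c\<close> and \<open>m\<close>; its linear terms then sum to \<open>2 * m\<close>.\<close>

lemma density_midpoint_ineq:
  fixes x y r R a b \<beta> \<kappa> :: real and n :: nat
  assumes pos: "0 < x" "0 < y" "0 < r" "0 < R" "0 < a" "0 < b" and \<kappa>: "\<kappa> = \<beta> - n" "0 < \<kappa>"
  shows "2 * ((x + y) / 2) powr - \<kappa> \<le>
    ((a + b) / 2) ^ n / ((r + R) / 2) powr (\<beta> + 1) *
      (x powr - \<kappa> * (r powr (\<beta> + 1) / a ^ n) + y powr - \<kappa> * (R powr (\<beta> + 1) / b ^ n))"
proof -
  define m where "m = (x + y) / 2"
  define c where "c = (a + b) / 2"
  define \<sigma> where "\<sigma> = (r + R) / 2"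
  have P: "0 < m" "0 < c" "0 < \<sigma>" using pos by (auto simp: m_def c_def \<sigma>_def)
  let ?p = "\<beta> + 1"
  have powr_\<beta>: "q powr \<beta> = q powr \<kappa> * q ^ n" if "0 < q" for q
    using that powr_add[of q \<kappa> "real n"] \<kappa> by (simp add: powr_realpow)
  have tm: "z * ((q * m / (z * \<sigma>)) powr ?p / (d * m / (z * c)) ^ n)
      = (c ^ n / \<sigma> powr ?p) * m powr (\<kappa> + 1) * (z powr - \<kappa> * (q powr ?p / d ^ n))"
    if "0 < z" "0 < q" "0 < d" for z q d
  proof -
    have e: "m powr (\<kappa> + 1) = m * (m powr \<kappa>)" "m powr ?p = m * (m powr \<kappa> * m ^ n)"
      "z powr ?p = z * (z powr \<kappa> * z ^ n)" "z powr - \<kappa> = 1 / z powr \<kappa>"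
      using P that powr_\<beta>[of m] powr_\<beta>[of z] by (simp_all add: powr_add powr_minus_divide)
    have "0 < m powr \<kappa>" "0 < z powr \<kappa>" "0 < \<sigma> powr ?p" using P that by auto
    then show ?thesis using P that
      by (simp add: powr_mult powr_divide power_mult_distrib power_divide e) (simp add: field_simps)
  qed
  have "x * (1 + ?p * (r * m / (x * \<sigma>) - 1) - n * (a * m / (x * c) - 1))
      + y * (1 + ?p * (R * m / (y * \<sigma>) - 1) - n * (b * m / (y * c) - 1))
    \<le> x * ((r * m / (x * \<sigma>)) powr ?p / (a * m / (x * c)) ^ n)
      + y * ((R * m / (y * \<sigma>)) powr ?p / (b * m / (y * c)) ^ n)"
    using pos P \<kappa> by (intro add_mono mult_left_mono powr_over_power_tangent) auto
  also have "\<dots> = (c ^ n / \<sigma> powr ?p) * m powr (\<kappa> + 1) *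
      (x powr - \<kappa> * (r powr ?p / a ^ n) + y powr - \<kappa> * (R powr ?p / b ^ n))"
    using tm[of x r a] tm[of y R b] pos by (simp add: distrib_left)
  also have "x * (1 + ?p * (r * m / (x * \<sigma>) - 1) - n * (a * m / (x * c) - 1))
      + y * (1 + ?p * (R * m / (y * \<sigma>) - 1) - n * (b * m / (y * c) - 1))
    = (x + y) * (1 - ?p + n) + ?p * m * (r + R) / \<sigma> - n * m * (a + b) / c"
    using pos P by (simp add: field_simps)
  also have "\<dots> = 2 * m"
  proof -
    have e: "x + y = 2 * m" "r + R = 2 * \<sigma>" "a + b = 2 * c" by (simp_all add: m_def c_def \<sigma>_def)
    have "(\<beta> + 1) * m * (2 * \<sigma>) / \<sigma> = (\<beta> + 1) * m * 2" "n * m * (2 * c) / c = n * m * 2"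
      using P by simp_all
    then show ?thesis unfolding e by (simp add: algebra_simps)
  qed
  finally have main: "2 * m \<le> (c ^ n / \<sigma> powr ?p) * m powr (\<kappa> + 1) *
      (x powr - \<kappa> * (r powr ?p / a ^ n) + y powr - \<kappa> * (R powr ?p / b ^ n))" (is "_ \<le> ?A * _ * ?B") .
  have "m powr - (\<kappa> + 1) * (2 * m) \<le> m powr - (\<kappa> + 1) * (?A * m powr (\<kappa> + 1) * ?B)"
    by (intro mult_left_mono main) auto
  moreover have "m powr - (\<kappa> + 1) * (2 * m) = 2 * m powr - \<kappa>"
    using P powr_add[of m "- (\<kappa> + 1)" 1] by simp
  moreover have "m powr - (\<kappa> + 1) * m powr (\<kappa> + 1) = 1"
    using P powr_add[of m "- (\<kappa> + 1)" "\<kappa> + 1"] by simp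
  moreover have "m powr - (\<kappa> + 1) * (?A * m powr (\<kappa> + 1) * ?B) = (m powr - (\<kappa> + 1) * m powr (\<kappa> + 1)) * (?A * ?B)"
    by (simp only: mult_ac)
  ultimately have "2 * m powr - \<kappa> \<le> ?A * ?B" by (metis mult_1)
  then show ?thesis by (simp only: m_def c_def \<sigma>_def)
qed

text \<open>One-dimensional transport: \<open>S\<close> carries the mass distribution \<open>Fu / Ju\<close> to \<open>Fv / Jv\<close>, and the mass
  that \<open>Fh\<close> puts below the midpoint of \<open>r\<close> and \<open>S r\<close> grows fast enough.\<close>

lemma transport_midpoint:
  fixes Fu Fv Fh fu fv fh :: "real \<Rightarrow> real"
  assumes du: "\<And>r. ru < r \<Longrightarrow> (Fu has_real_derivative fu r) (at r)" "\<And>r. ru < r \<Longrightarrow> 0 < fu r"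
    and dv: "\<And>r. rv < r \<Longrightarrow> (Fv has_real_derivative fv r) (at r)" "\<And>r. rv < r \<Longrightarrow> 0 < fv r"
    and dh: "\<And>r. rh < r \<Longrightarrow> (Fh has_real_derivative fh r) (at r)"
    and lu: "(Fu \<longlongrightarrow> 0) (at_right ru)" "(Fu \<longlongrightarrow> Ju) at_top"
    and lv: "(Fv \<longlongrightarrow> 0) (at_right rv)" "(Fv \<longlongrightarrow> Jv) at_top"
    and bh: "\<And>r. 0 \<le> Fh r" "\<And>r. rh < r \<Longrightarrow> Fh r \<le> Jh" and J: "0 < Ju" "0 < Jv"
    and mid: "\<And>r R. ru < r \<Longrightarrow> rv < R \<Longrightarrow> rh < (r + R) / 2 \<and> 2 * M \<le> fh ((r + R) / 2) * (Ju / fu r + Jv / fv R)"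
    and M: "0 \<le> M"
  shows "M \<le> Jh"
proof -
  have strict: "F r < F r'" if d: "\<And>r. r0 < r \<Longrightarrow> (F has_real_derivative f r) (at r)" "\<And>r. r0 < r \<Longrightarrow> 0 < f r"
      and r: "r0 < r" "r < r'" for F f :: "real \<Rightarrow> real" and r0 r r'
    by (rule DERIV_pos_imp_increasing[OF r(2)]) (use d r in \<open>meson less_le_trans order.strict_trans2\<close>)
  have bounds: "0 < F r \<and> F r < L" if d: "\<And>r. r0 < r \<Longrightarrow> (F has_real_derivative f r) (at r)" "\<And>r. r0 < r \<Longrightarrow> 0 < f r"
      and l: "(F \<longlongrightarrow> 0) (at_right r0)" "(F \<longlongrightarrow> L) at_top" and r: "r0 < r" for F f :: "real \<Rightarrow> real" and r0 r L
  proof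
    define q where "q = (r0 + r) / 2"
    have q: "r0 < q" "q < r" using r by (auto simp: q_def)
    have "0 \<le> F q"
    proof (rule tendsto_upperbound[OF l(1)])
      show "eventually (\<lambda>x. F x \<le> F q) (at_right r0)"
        using eventually_at_right_real[OF q(1)] by eventually_elim (use strict[OF d] q in \<open>auto intro: less_imp_le\<close>)
    qed simp
    then show "0 < F r" using strict[OF d q] by linarith
    have "F (r + 1) \<le> L"
    proof (rule tendsto_lowerbound[OF l(2)])
      show "eventually (\<lambda>x. F (r + 1) \<le> F x) at_top"
        using eventually_gt_at_top[of "r + 1"] by eventually_elim (use strict[OF d] r in \<open>auto intro: less_imp_le\<close>)
    qed simp
    then show "F r < L" using strict[OF d r, of "r + 1"] by linarith
  qed
  have bu: "0 < Fu r \<and> Fu r < Ju" if "ru < r" for r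
    by (rule bounds[where f=fu, OF _ _ lu that]) (use du in auto)
  have bv: "0 < Fv r \<and> Fv r < Jv" if "rv < r" for r
    by (rule bounds[where f=fv, OF _ _ lv that]) (use dv in auto)
  have ex: "\<exists>R>rv. Fv R = y" if y: "0 < y" "y < Jv" for y
  proof -
    have "eventually (\<lambda>x. Fv x < y \<and> rv < x) (at_right rv)"
      using order_tendstoD(2)[OF lv(1) y(1)] eventually_at_right_less[of rv] by eventually_elim auto
    then obtain p where p: "Fv p < y" "rv < p"
      using eventually_happens[of _ "at_right rv"] by fastforce
    have "eventually (\<lambda>x. y < Fv x \<and> p < x) at_top"
      using order_tendstoD(1)[OF lv(2) y(2)] eventually_gt_at_top[of p] by eventually_elim auto
    then obtain q where q: "y < Fv q" "p < q" by (auto simp: eventually_at_top_linorder)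
    have "\<exists>x\<ge>p. x \<le> q \<and> Fv x = y"
    proof (intro IVT allI impI)
      fix x assume "p \<le> x \<and> x \<le> q"
      then show "isCont Fv x" using p dv(1)[of x] by (auto intro: DERIV_isCont)
    qed (use p q in auto)
    then show ?thesis using p(2) by (auto intro: less_le_trans)
  qed
  \<comment> \<open>The inverse of \<open>Fv\<close> on the open interval from 0 to
    \<open>Jv\<close>. Its derivative comes from the inverse function rule, which asks for its
    continuity first.\<close>
  define N where "N y = (SOME R. rv < R \<and> Fv R = y)" for y
  have N: "rv < N y" "Fv (N y) = y" if "0 < y" "y < Jv" for y
    using someI_ex[of "\<lambda>R. rv < R \<and> Fv R = y"] ex[OF that] by (auto simp: N_def)
  have inj: "R = R'" if "rv < R" "rv < R'" "Fv R = Fv R'" for R R'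
    using strict[where F=Fv and f=fv, OF dv that(1), of R'] strict[where F=Fv and f=fv, OF dv that(2), of R] that(3)
    by (cases R R' rule: linorder_cases) auto
  have NF: "N (Fv R) = R" if "rv < R" for R
    using N[of "Fv R"] bv[OF that] inj that by auto
  have dN: "(N has_real_derivative inverse (fv (N y))) (at y)" if y: "0 < y" "y < Jv" for y
  proof (rule DERIV_inverse_function[where f=Fv and g=N and x=y and D="fv (N y)" and a=0 and b=Jv])
    show "(Fv has_real_derivative fv (N y)) (at (N y))" "fv (N y) \<noteq> 0"
      using dv N[OF y] by (auto simp: less_imp_neq[symmetric])
    have "isCont N (Fv (N y))"
    proof (rule isCont_inverse_function[where f=Fv and g=N and x="N y" and d="(N y - rv) / 2"])
      show "0 < (N y - rv) / 2" using N[OF y] by simp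
      have "rv < z" if "\<bar>z - N y\<bar> \<le> (N y - rv) / 2" for z using abs_le_D2[OF that] N(1)[OF y] by (simp add: field_simps)
      then show "\<And>z. \<bar>z - N y\<bar> \<le> (N y - rv) / 2 \<Longrightarrow> N (Fv z) = z"
        "\<And>z. \<bar>z - N y\<bar> \<le> (N y - rv) / 2 \<Longrightarrow> isCont Fv z"
        using NF dv(1) by (auto intro: DERIV_isCont)
    qed
    then show "isCont N y" using N[OF y] by simp
  qed (use y N in auto)
  \<comment> \<open>With this factor \<open>S\<close> preserves relative mass:
    \<open>Fv (S r) / Jv = Fu r / Ju\<close>.\<close>
  define c where "c = Jv / Ju"
  define S where "S r = N (c * Fu r)" for r
  have cF: "0 < c * Fu r" "c * Fu r < Jv" if "ru < r" for r
    using bu[OF that] J by (auto simp: c_def field_simps)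
  have S: "rv < S r" if "ru < r" for r using N(1)[OF cF[OF that]] by (simp add: S_def)
  \<comment> \<open>Nondecreasing, because \<open>mid\<close> bounds the derivative of the first
    term from below by that of the second. It is nonnegative near \<open>ru\<close>, hence
    everywhere, and at infinity this compares \<open>M\<close> with \<open>Jh\<close>.\<close>
  define \<Phi> where "\<Phi> r = Fh ((r + S r) / 2) - (M / Ju) * Fu r" for r
  have d\<Phi>: "\<exists>D. (\<Phi> has_real_derivative D) (at r) \<and> 0 \<le> D" if r: "ru < r" for r
  proof (intro exI conjI)
    have dS: "(S has_real_derivative inverse (fv (S r)) * (c * fu r)) (at r)"
      unfolding S_def by (rule DERIV_chain2[where f=N and g="\<lambda>r. c * Fu r", OF dN[OF cF[OF r]] DERIV_cmult[OF du(1)[OF r]]])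
    have "((\<lambda>r. (r + S r) / 2) has_real_derivative (1 + inverse (fv (S r)) * (c * fu r)) / 2) (at r)"
      by (intro DERIV_cdivide DERIV_add DERIV_ident dS)
    then show "(\<Phi> has_real_derivative fh ((r + S r) / 2) * ((1 + inverse (fv (S r)) * (c * fu r)) / 2) - (M / Ju) * fu r) (at r)"
      unfolding \<Phi>_def using mid[OF r S[OF r]]
      by (intro DERIV_diff DERIV_cmult du r DERIV_chain2[OF dh]) auto
    have p: "0 < fu r" "0 < fv (S r)" using du(2)[OF r] dv(2)[OF S[OF r]] .
    have "(fu r / Ju / 2) * (2 * M) \<le> (fu r / Ju / 2) * (fh ((r + S r) / 2) * (Ju / fu r + Jv / fv (S r)))"
      using mid[OF r S[OF r]] p J by (intro mult_left_mono) auto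
    also have "\<dots> = fh ((r + S r) / 2) * ((1 + inverse (fv (S r)) * (c * fu r)) / 2)"
      using p J by (simp add: c_def field_simps)
    finally show "0 \<le> fh ((r + S r) / 2) * ((1 + inverse (fv (S r)) * (c * fu r)) / 2) - (M / Ju) * fu r"
      by (simp add: mult.commute[of M])
  qed
  have \<Phi>0: "0 \<le> \<Phi> r" if r: "ru < r" for r
  proof -
    have "((\<lambda>q. - (M / Ju) * Fu q) \<longlongrightarrow> - (M / Ju) * 0) (at_right ru)"
      by (intro tendsto_intros lu)
    moreover have "eventually (\<lambda>q. - (M / Ju) * Fu q \<le> \<Phi> r) (at_right ru)"
      using eventually_at_right_real[OF r]
    proof eventually_elim
      case (elim q)
      have "\<Phi> q \<le> \<Phi> r"
        by (rule DERIV_nonneg_imp_nondecreasing) (use elim d\<Phi> in \<open>auto intro: less_le_trans\<close>)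
      moreover have "- (M / Ju) * Fu q \<le> \<Phi> q" using bh(1) by (simp add: \<Phi>_def)
      ultimately show ?case by linarith
    qed
    ultimately have "- (M / Ju) * 0 \<le> \<Phi> r" by (rule tendsto_upperbound) simp
    then show ?thesis by simp
  qed
  have "((\<lambda>r. (M / Ju) * Fu r) \<longlongrightarrow> (M / Ju) * Ju) at_top" by (intro tendsto_intros lu)
  moreover have "eventually (\<lambda>r. (M / Ju) * Fu r \<le> Jh) at_top"
    using eventually_gt_at_top[of ru]
  proof eventually_elim
    case (elim r)
    have "(M / Ju) * Fu r \<le> Fh ((r + S r) / 2)" using \<Phi>0[OF elim] by (simp add: \<Phi>_def)
    also have "\<dots> \<le> Jh" using mid[OF elim S[OF elim]] bh(2) by blast
    finally show ?case .
  qed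
  ultimately have "(M / Ju) * Ju \<le> Jh" by (rule tendsto_upperbound) simp
  then show ?thesis using J by simp
qed

text \<open>Pointwise, the increment of the truncated power between \<open>r\<close> and
  \<open>r'\<close> equals \<open>r powr - \<beta> - r' powr - \<beta>\<close> where
  \<open>u x < r\<close>, vanishes where \<open>u x \<ge> r'\<close>, and lies between these values
  elsewhere.\<close>

lemma level_integral_diff_bounds:
  fixes u :: "'a \<Rightarrow> real"
  assumes "finite_measure M" and [measurable]: "u \<in> borel_measurable M" and upos: "\<And>x. x \<in> space M \<Longrightarrow> c \<le> u x" and c: "0 < c"
    and \<beta>: "0 < \<beta>" and r: "0 < r" "r \<le> r'"
  defines "V \<equiv> \<lambda>r. measure M {x \<in> space M. u x < r}"
    and "F \<equiv> \<lambda>r. \<integral>x. max (u x powr - \<beta> - r powr - \<beta>) 0 \<partial>M"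
  shows "(r powr - \<beta> - r' powr - \<beta>) * V r \<le> F r' - F r" "F r' - F r \<le> (r powr - \<beta> - r' powr - \<beta>) * V r'"
proof -
  interpret finite_measure M by fact
  have mono: "b powr - \<beta> \<le> a powr - \<beta>" if "0 < a" "a \<le> b" for a b :: real
    using that \<beta> by (intro powr_mono2') auto
  have int: "integrable M (\<lambda>x. max (u x powr - \<beta> - q powr - \<beta>) 0)" for q
  proof (rule integrable_const_bound[where B="c powr - \<beta>"])
    show "AE x in M. norm (max (u x powr - \<beta> - q powr - \<beta>) 0) \<le> c powr - \<beta>"
    proof (rule AE_I2)
      fix x assume "x \<in> space M"
      then have "u x powr - \<beta> \<le> c powr - \<beta>" using upos c mono by blast
      then show "norm (max (u x powr - \<beta> - q powr - \<beta>) 0) \<le> c powr - \<beta>"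
        using powr_ge_zero[of q "- \<beta>"] powr_ge_zero[of c "- \<beta>"] unfolding real_norm_def by linarith
    qed
  qed measurable
  let ?d = "r powr - \<beta> - r' powr - \<beta>"
  have d: "0 \<le> ?d" using mono r by simp
  have Fd: "F r' - F r = (\<integral>x. max (u x powr - \<beta> - r' powr - \<beta>) 0 - max (u x powr - \<beta> - r powr - \<beta>) 0 \<partial>M)"
    unfolding F_def using int by simp
  have Vi: "?d * V q = (\<integral>x. ?d * indicator {x \<in> space M. u x < q} x \<partial>M)" for q
    unfolding V_def by simp
  have ind: "integrable M (\<lambda>x. ?d * indicator {x \<in> space M. u x < q} x)" for q
    by (intro integrable_mult_right integrable_real_indicator) (auto simp: less_top[symmetric])
  show "?d * V r \<le> F r' - F r"
    unfolding Fd Vi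
  proof (intro integral_mono ind Bochner_Integration.integrable_diff int)
    fix x assume x: "x \<in> space M"
    then have u: "0 < u x" using upos c by (meson less_le_trans)
    show "?d * indicator {x \<in> space M. u x < r} x
      \<le> max (u x powr - \<beta> - r' powr - \<beta>) 0 - max (u x powr - \<beta> - r powr - \<beta>) 0"
      using x d r u mono[of "u x" r] mono[of r "u x"] by (auto simp: indicator_def max_def)
  qed
  show "F r' - F r \<le> ?d * V r'"
    unfolding Fd Vi
  proof (intro integral_mono ind Bochner_Integration.integrable_diff int)
    fix x assume x: "x \<in> space M"
    then have u: "0 < u x" using upos c by (meson less_le_trans)
    show "max (u x powr - \<beta> - r' powr - \<beta>) 0 - max (u x powr - \<beta> - r powr - \<beta>) 0
      \<le> ?d * indicator {x \<in> space M. u x < r'} x"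
      using x d r u mono[of "u x" r] mono[of r' "u x"] mono[of r "u x"] by (auto simp: indicator_def max_def)
  qed
qed

text \<open>In layer-cake form the integral accumulates the volume \<open>V\<close> of the sublevel
  sets against the increasing function \<open>g\<close>, so its derivative is the volume times the
  derivative of \<open>g\<close>. The difference quotient relative to \<open>g\<close> is squeezed
  between two values of \<open>V\<close>, and continuity of \<open>V\<close> does the rest.\<close>

lemma level_integral_has_derivative:
  fixes u :: "'a \<Rightarrow> real"
  assumes M: "finite_measure M" and u: "u \<in> borel_measurable M" "\<And>x. x \<in> space M \<Longrightarrow> c \<le> u x" "0 < c"
    and \<beta>: "0 < \<beta>" and r: "0 < r" and cont: "isCont (\<lambda>r. measure M {x \<in> space M. u x < r}) r"
  shows "((\<lambda>r. \<integral>x. max (u x powr - \<beta> - r powr - \<beta>) 0 \<partial>M) has_real_derivative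
    \<beta> * (measure M {x \<in> space M. u x < r} / r powr (\<beta> + 1))) (at r)"
proof -
  define V where "V r = measure M {x \<in> space M. u x < r}" for r
  define F where "F r = (\<integral>x. max (u x powr - \<beta> - r powr - \<beta>) 0 \<partial>M)" for r
  note bnd = level_integral_diff_bounds[OF M u \<beta>, folded V_def F_def]
  define g where "g r = - (r powr - \<beta>)" for r :: real
  have "(g has_real_derivative \<beta> * r powr (- \<beta> - 1)) (at r)"
    unfolding g_def using r by (auto intro!: derivative_eq_intros)
  then have g: "((\<lambda>y. (g y - g r) / (y - r)) \<longlongrightarrow> \<beta> * r powr (- \<beta> - 1)) (at r)"
    by (simp add: has_field_derivative_iff)
  have ginc: "g a < g b" if "0 < a" "a < b" for a b
    unfolding g_def using that \<beta> by (simp add: powr_less_mono2_neg)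
  define W where "W y = (F y - F r) / (g y - g r)" for y
  have ev: "eventually (\<lambda>y. 0 < y) (at r)"
    using r order_tendstoD(1)[OF tendsto_ident_at r] by simp
  have evr: "eventually (\<lambda>y. y \<noteq> r) (at r)" by (simp add: eventually_at_filter)
  have W: "min (V r) (V y) \<le> W y \<and> W y \<le> max (V r) (V y)" if "0 < y" "y \<noteq> r" for y
  proof (cases "r < y")
    case True
    then have p: "0 < g y - g r" using ginc r by simp
    have "(g y - g r) * V r \<le> F y - F r" "F y - F r \<le> (g y - g r) * V y"
      using bnd[of r y] r True by (auto simp: g_def)
    then have "V r \<le> W y" "W y \<le> V y" using p
      by (simp_all add: W_def pos_le_divide_eq pos_divide_le_eq mult.commute)
    then show ?thesis by auto
  next
    case False
    then have "y < r" using that by simp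
    then have p: "0 < g r - g y" using ginc that by simp
    have "(g r - g y) * V y \<le> F r - F y" "F r - F y \<le> (g r - g y) * V r"
      using bnd[of y r] that \<open>y < r\<close> by (auto simp: g_def)
    moreover have "W y = (F r - F y) / (g r - g y)" unfolding W_def by (metis minus_diff_eq minus_divide_divide)
    ultimately have "V y \<le> W y" "W y \<le> V r" using p
      by (simp_all add: pos_le_divide_eq pos_divide_le_eq mult.commute)
    then show ?thesis by auto
  qed
  have V: "(V \<longlongrightarrow> V r) (at r)" using cont by (simp add: isCont_def V_def[abs_def])
  have "(W \<longlongrightarrow> V r) (at r)"
  proof (rule tendsto_sandwich)
    show "eventually (\<lambda>y. min (V r) (V y) \<le> W y) (at r)" "eventually (\<lambda>y. W y \<le> max (V r) (V y)) (at r)"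
      using ev evr by (eventually_elim, use W in auto)+
    show "((\<lambda>y. min (V r) (V y)) \<longlongrightarrow> V r) (at r)" using tendsto_min[OF tendsto_const V, of "V r"] by simp
    show "((\<lambda>y. max (V r) (V y)) \<longlongrightarrow> V r) (at r)" using tendsto_max[OF tendsto_const V, of "V r"] by simp
  qed
  then have "((\<lambda>y. W y * ((g y - g r) / (y - r))) \<longlongrightarrow> V r * (\<beta> * r powr (- \<beta> - 1))) (at r)"
    by (intro tendsto_mult g)
  moreover have "eventually (\<lambda>y. W y * ((g y - g r) / (y - r)) = (F y - F r) / (y - r)) (at r)"
    using ev evr
  proof eventually_elim
    case (elim y)
    then have "g y - g r \<noteq> 0" using ginc[of y r] ginc[of r y] r by (cases "y < r") auto
    then show ?case by (simp add: W_def)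
  qed
  ultimately have "((\<lambda>y. (F y - F r) / (y - r)) \<longlongrightarrow> V r * (\<beta> * r powr (- \<beta> - 1))) (at r)"
    by (rule Lim_transform_eventually)
  moreover have "V r * (\<beta> * r powr (- \<beta> - 1)) = \<beta> * (V r / r powr (\<beta> + 1))"
    using powr_minus_divide[of r "\<beta> + 1"] by simp
  ultimately show ?thesis
    unfolding has_field_derivative_iff F_def V_def by simp
qed


text \<open>The Brunn-Minkowski inequality makes the root of the volume concave in the level
  wherever the sublevel sets are nonempty, and a concave function on an open interval is
  continuous.\<close>

lemma sublevel_root_measure_isCont:
  fixes u :: "'a::euclidean_space \<Rightarrow> real"
  assumes K: "open K" "bounded K" "convex K" and u: "convex_on K u" and x0: "x0 \<in> K" "u x0 < r"
  shows "isCont (\<lambda>r. measure lborel {x \<in> K. u x < r}) r"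
proof -
  let ?n = "DIM('a)"
  let ?L = "\<lambda>r. {x \<in> K. u x < r}"
  let ?a = "\<lambda>r. root ?n (measure lborel (?L r))"
  have op: "open (?L r)" for r
    using continuous_open_preimage[OF convex_on_continuous[OF K(1) u] K(1) open_lessThan, of r]
    by (simp add: vimage_def Int_def)
  have bd: "bounded (?L r)" for r using K(2) by (rule bounded_subset) auto
  have "convex_on {u x0<..} (\<lambda>r. - ?a r)"
  proof (rule convex_onI)
    fix t r1 r2 :: real assume t: "0 < t" "t < 1" and r: "r1 \<in> {u x0<..}" "r2 \<in> {u x0<..}"
    let ?r = "(1 - t) *\<^sub>R r1 + t *\<^sub>R r2"
    have "(1 - t) * ?a r1 + t * ?a r2 \<le> ?a ?r"
    proof (rule Brunn_Minkowski_convex_combination[OF op bd _ op bd])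
      show "?L ?r \<in> fmeasurable lborel"
        using op emeasure_bounded_finite[OF bd] by (auto simp: fmeasurable_def)
      show "(1 - t) *\<^sub>R x + t *\<^sub>R y \<in> ?L ?r" if "x \<in> ?L r1" "y \<in> ?L r2" for x y
      proof -
        have "(1 - t) * u x + t * u y < (1 - t) * r1 + t * r2"
          using that t by (intro add_strict_mono mult_strict_left_mono) auto
        moreover have "u ((1 - t) *\<^sub>R x + t *\<^sub>R y) \<le> (1 - t) * u x + t * u y"
          using that t by (intro convex_onD[OF u]) auto
        ultimately show ?thesis using that t convexD[OF K(3), of x y "1 - t" t] by auto
      qed
    qed (use t r x0 in auto)
    then show "- ?a ?r \<le> (1 - t) * - ?a r1 + t * - ?a r2" by simp
  qed simp
  then have "continuous_on {u x0<..} (\<lambda>r. - ?a r)"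
    by (intro convex_on_continuous) auto
  then have "isCont (\<lambda>r. - ?a r) r"
    using x0 by (simp add: continuous_on_eq_continuous_at)
  then have "isCont (\<lambda>r. - (- ?a r)) r" by (rule continuous_minus)
  then have "isCont (\<lambda>r. (- (- ?a r)) ^ ?n) r" by (rule continuous_power)
  moreover have "(- (- ?a r)) ^ ?n = measure lborel (?L r)" for r by simp
  ultimately show ?thesis by (simp only:)
qed

lemma Borell_Brascamp_Lieb_midpoint:
  fixes u v h :: "'a::euclidean_space \<Rightarrow> real" and \<beta> :: real
  assumes K: "open K" "bounded K" "convex K" "K \<noteq> {}"
    and conv: "convex_on K u" "convex_on K v" "convex_on K h"
    and lower: "0 < c" "\<And>x. x \<in> K \<Longrightarrow> c \<le> u x" "\<And>x. x \<in> K \<Longrightarrow> c \<le> v x" "\<And>x. x \<in> K \<Longrightarrow> c \<le> h x"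
    and mid: "\<And>x y. x \<in> K \<Longrightarrow> y \<in> K \<Longrightarrow> h ((1/2) *\<^sub>R x + (1/2) *\<^sub>R y) \<le> (u x + v y) / 2"
    and \<beta>: "DIM('a) < \<beta>"
  defines "J \<equiv> \<lambda>u. \<integral>x. u x powr - \<beta> \<partial>restrict_space lborel K" and "s \<equiv> - 1 / (\<beta> - DIM('a))"
  shows "0 < J u" "0 < J v" "0 < J h" "J h powr s \<le> (J u powr s + J v powr s) / 2"
proof -
  let ?n = "DIM('a)"
  let ?M = "restrict_space lborel K"
  define \<kappa> where "\<kappa> = \<beta> - ?n"
  have \<kappa>: "0 < \<kappa>" and \<beta>0: "0 < \<beta>" using \<beta> by (auto simp: \<kappa>_def)
  have Kb: "K \<in> sets borel" using K(1) by auto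
  have fin: "finite_measure ?M"
    using emeasure_bounded_finite[OF K(2)] Kb
    by (intro finite_measureI) (simp add: space_restrict_space emeasure_restrict_space)
  interpret finite_measure ?M by (rule fin)
  have spM: "space ?M = K" by (simp add: space_restrict_space)
  have meas: "f \<in> borel_measurable ?M" if "convex_on K f" for f
    using borel_measurable_continuous_on_restrict[OF convex_on_continuous[OF K(1) that]]
    by (simp cong: measurable_cong_sets add: sets_restrict_space)
  define V where "V f r = measure lborel {x \<in> K. f x < r}" for f :: "'a \<Rightarrow> real" and r
  \<comment> \<open>Truncation at the level \<open>r\<close> makes \<open>F f\<close> increase from
    0 at the infimum \<open>i f\<close> to \<open>J f\<close> at infinity, which is the shape that
    the transport argument needs.\<close>
  define F where "F f r = (\<integral>x. max (f x powr - \<beta> - r powr - \<beta>) 0 \<partial>?M)" for f r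
  define d where "d f r = \<beta> * (V f r / r powr (\<beta> + 1))" for f r
  define i where "i f = Inf (f ` K)" for f :: "'a \<Rightarrow> real"
  have op: "open {x \<in> K. f x < r}" if "convex_on K f" for f r
    using continuous_open_preimage[OF convex_on_continuous[OF K(1) that] K(1) open_lessThan, of r]
    by (simp add: vimage_def Int_def)
  have bd: "bounded {x \<in> K. f x < r}" for f :: "'a \<Rightarrow> real" and r using K(2) by (rule bounded_subset) auto
  have mV: "measure ?M {x \<in> space ?M. f x < r} = V f r" for f r
    unfolding V_def spM by (rule measure_restrict_space) (use Kb in auto)
  have props: "(\<forall>r>i f. (F f has_real_derivative d f r) (at r) \<and> 0 < d f r \<and> 0 < r \<and> 0 < V f r \<and> (\<exists>x\<in>K. f x < r)) \<and>
      (\<forall>r. 0 \<le> F f r \<and> F f r \<le> J f) \<and> 0 < J f \<and> (F f \<longlongrightarrow> 0) (at_right (i f)) \<and> (F f \<longlongrightarrow> J f) at_top \<and>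
      (\<forall>x\<in>K. i f \<le> f x)"
    if f: "convex_on K f" and c: "\<And>x. x \<in> K \<Longrightarrow> c \<le> f x" for f
  proof -
    have mf [measurable]: "f \<in> borel_measurable ?M" using meas[OF f] .
    have bb: "bdd_below (f ` K)" using c by (auto simp: bdd_below_def)
    have il: "i f \<le> f x" if "x \<in> K" for x unfolding i_def using bb that by (intro cInf_lower) auto
    have ic: "c \<le> i f" unfolding i_def using K(4) c by (intro cInf_greatest) auto
    then have i0: "0 < i f" using lower(1) by simp
    have ex: "\<exists>x\<in>K. f x < r" if "i f < r" for r
      using that K(4) bb unfolding i_def by (subst (asm) cInf_less_iff) auto
    have Vpos: "0 < V f r" if r: "i f < r" for r
    proof -
      have "{x \<in> K. f x < r} \<noteq> {}" using ex[OF r] by auto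
      then have "\<not> negligible {x \<in> K. f x < r}" using open_not_negligible op[OF f] by blast
      then have "emeasure lborel {x \<in> K. f x < r} \<noteq> 0"
        using op[OF f, of r] by (auto simp: negligible_iff_null_sets null_sets_def)
      then show ?thesis
        using emeasure_bounded_finite[OF bd[of f r]]
        by (simp add: V_def measure_def enn2real_positive_iff less_top[symmetric] zero_less_iff_neq_zero)
    qed
    have der: "(F f has_real_derivative d f r) (at r)" if r: "i f < r" for r
    proof -
      obtain x0 where x0: "x0 \<in> K" "f x0 < r" using ex[OF r] by auto
      have "isCont (\<lambda>r. measure ?M {x \<in> space ?M. f x < r}) r"
        unfolding mV V_def by (rule sublevel_root_measure_isCont[OF K(1-3) f x0])
      then have "((\<lambda>r. \<integral>x. max (f x powr - \<beta> - r powr - \<beta>) 0 \<partial>?M) has_real_derivative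
          \<beta> * (measure ?M {x \<in> space ?M. f x < r} / r powr (\<beta> + 1))) (at r)"
        using i0 r c spM by (intro level_integral_has_derivative[where c=c and u=f] fin mf lower(1) \<beta>0) auto
      then show ?thesis unfolding mV F_def[abs_def] d_def .
    qed
    have le: "f x powr - \<beta> \<le> q powr - \<beta>" if "x \<in> K" "0 < q" "q \<le> f x" for x q
      using that \<beta>0 by (intro powr_mono2') auto
    have bound: "AE x in ?M. norm (f x powr - \<beta>) \<le> c powr - \<beta>"
      using le[OF _ lower(1)] c spM by (intro AE_I2) auto
    have int0: "integrable ?M (\<lambda>x. f x powr - \<beta>)"
      by (rule integrable_const_bound[OF bound]) measurable
    have int: "integrable ?M (\<lambda>x. max (f x powr - \<beta> - r powr - \<beta>) 0)" for r
      using int0 by (intro Bochner_Integration.integrable_max Bochner_Integration.integrable_diff) auto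
    have F0: "0 \<le> F f r" for r unfolding F_def by (rule integral_nonneg_AE) auto
    have FJ: "F f r \<le> J f" for r
      unfolding F_def J_def by (intro integral_mono int int0) (auto simp: max_def)
    \<comment> \<open>A zero integral would make \<open>F f\<close> vanish identically, against its
      positive derivative.\<close>
    have J0: "0 < J f"
    proof -
      have "0 < d f (i f + 1)" using Vpos[of "i f + 1"] \<beta>0 i0 by (simp add: d_def)
      have "\<exists>r. F f r \<noteq> 0"
      proof (rule ccontr)
        assume "\<nexists>r. F f r \<noteq> 0"
        then have "F f = (\<lambda>_. 0)" by auto
        then have "d f (i f + 1) = 0" using DERIV_unique[OF der[of "i f + 1"], of 0] by simp
        then show False using \<open>0 < d f (i f + 1)\<close> by simp
      qed
      then obtain r where "F f r \<noteq> 0" by auto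
      then show ?thesis using F0[of r] FJ[of r] by linarith
    qed
    have lim0: "(F f \<longlongrightarrow> 0) (at_right (i f))"
    proof (rule tendsto_sandwich[where f="\<lambda>_. 0"])
      have "((\<lambda>r. r powr - \<beta>) \<longlongrightarrow> i f powr - \<beta>) (at_right (i f))"
        using i0 by (intro tendsto_powr tendsto_ident_at tendsto_const) linarith
      then have "((\<lambda>r. (i f powr - \<beta> - r powr - \<beta>) * measure ?M (space ?M)) \<longlongrightarrow> (i f powr - \<beta> - i f powr - \<beta>) * measure ?M (space ?M)) (at_right (i f))"
        by (intro tendsto_mult tendsto_diff tendsto_const)
      then show "((\<lambda>r. (i f powr - \<beta> - r powr - \<beta>) * measure ?M (space ?M)) \<longlongrightarrow> 0) (at_right (i f))"
        by (simp only: diff_self mult_zero_left)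
      show "eventually (\<lambda>r. F f r \<le> (i f powr - \<beta> - r powr - \<beta>) * measure ?M (space ?M)) (at_right (i f))"
        using eventually_at_right_less
      proof eventually_elim
        case (elim r)
        have "r powr - \<beta> \<le> i f powr - \<beta>" using elim i0 \<beta>0 by (intro powr_mono2') auto
        then have "F f r \<le> (\<integral>x. (i f powr - \<beta> - r powr - \<beta>) \<partial>?M)"
          unfolding F_def using le i0 il spM by (intro integral_mono int) (auto simp: max_def)
        then show ?case by (simp add: mult.commute)
      qed
    qed (use F0 in auto)
    have lim1: "(F f \<longlongrightarrow> J f) at_top"
    proof (rule tendsto_sandwich[where h="\<lambda>_. J f"])
      have "((\<lambda>r. r powr - \<beta>) \<longlongrightarrow> 0) at_top"
        using tendsto_neg_powr[of "- \<beta>" "\<lambda>r. r" at_top] \<beta>0 by (simp add: filterlim_ident)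
      then have "((\<lambda>r. J f - r powr - \<beta> * measure ?M (space ?M)) \<longlongrightarrow> J f - 0 * measure ?M (space ?M)) at_top"
        by (intro tendsto_mult tendsto_diff tendsto_const)
      then show "((\<lambda>r. J f - r powr - \<beta> * measure ?M (space ?M)) \<longlongrightarrow> J f) at_top" by simp
      have "J f - r powr - \<beta> * measure ?M (space ?M) \<le> F f r" for r
      proof -
        have "J f - r powr - \<beta> * measure ?M (space ?M) = (\<integral>x. f x powr - \<beta> - r powr - \<beta> \<partial>?M)"
          unfolding J_def using int0 by (simp add: mult.commute)
        also have "\<dots> \<le> F f r"
          unfolding F_def using int0 by (intro integral_mono int Bochner_Integration.integrable_diff) auto
        finally show ?thesis .
      qed
      then show "eventually (\<lambda>r. J f - r powr - \<beta> * measure ?M (space ?M) \<le> F f r) at_top" by simp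
    qed (use FJ in auto)
    show ?thesis
    proof (intro conjI allI impI ballI)
      fix r assume r: "i f < r"
      show "0 < r" using r i0 by simp
      then show "0 < d f r" using Vpos[OF r] \<beta>0 by (simp add: d_def)
    qed (use der Vpos ex F0 FJ J0 lim0 lim1 il in auto)
  qed
  note pu = props[OF conv(1) lower(2)] and pv = props[OF conv(2) lower(3)] and ph = props[OF conv(3) lower(4)]
  show J0: "0 < J u" "0 < J v" "0 < J h" using pu pv ph by auto
  \<comment> \<open>Chosen so that the right-hand side of the claim is \<open>(x + y) / 2\<close>.
    As \<open>s = - 1 / \<kappa>\<close>, the claim then amounts to the lower bound
    \<open>((x + y) / 2) powr - \<kappa>\<close> for \<open>J h\<close>.\<close>
  define x where "x = J u powr (- 1 / \<kappa>)"
  define y where "y = J v powr (- 1 / \<kappa>)"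
  have xy: "0 < x" "0 < y" using J0 by (auto simp: x_def y_def)
  have Jx: "x powr - \<kappa> = J u" "y powr - \<kappa> = J v"
    using J0 \<kappa> by (simp_all add: x_def y_def powr_powr)
  have "((x + y) / 2) powr - \<kappa> \<le> J h"
  proof (rule transport_midpoint)
    fix r R assume r: "i u < r" and R: "i v < R"
    obtain p q where p: "p \<in> K" "u p < r" and q: "q \<in> K" "v q < R" using pu pv r R by blast
    have in_K: "(1/2) *\<^sub>R p + (1/2) *\<^sub>R q \<in> K" if "p \<in> K" "q \<in> K" for p q
      using that convexD[OF K(3), of p q "1/2" "1/2"] by simp
    have "i h \<le> h ((1/2) *\<^sub>R p + (1/2) *\<^sub>R q)" using ph in_K p q by blast
    also have "\<dots> \<le> (u p + v q) / 2" using mid p q by blast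
    also have "\<dots> < (r + R) / 2" using p q by simp
    finally have ih: "i h < (r + R) / 2" .
    let ?a = "root ?n (V u r)" and ?b = "root ?n (V v R)" and ?c = "root ?n (V h ((r + R) / 2))"
    have pos: "0 < r" "0 < R" "0 < V u r" "0 < V v R" using pu pv r R by blast+
    have ab: "0 < ?a" "0 < ?b" using pos by auto
    \<comment> \<open>Midpoints of the two sublevel sets lie in the sublevel set of \<open>h\<close>
      at the midpoint level.\<close>
    have "(1/2) * ?a + (1/2) * ?b \<le> ?c"
      unfolding V_def
    proof (rule Brunn_Minkowski_convex_combination[OF op[OF conv(1)] bd _ op[OF conv(2)] bd])
      show "{x \<in> K. h x < (r + R) / 2} \<in> fmeasurable lborel"
        by (intro fmeasurableI emeasure_bounded_finite bd) (simp only: sets_lborel borel_open[OF op[OF conv(3)]])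
      show "(1/2) *\<^sub>R p + (1/2) *\<^sub>R q \<in> {x \<in> K. h x < (r + R) / 2}"
        if "p \<in> {x \<in> K. u x < r}" "q \<in> {x \<in> K. v x < R}" for p q
        using that in_K mid[of p q] by auto
    qed (use p q in auto)
    then have "((?a + ?b) / 2) ^ ?n \<le> ?c ^ ?n" using ab by (intro power_mono) auto
    also have "?c ^ ?n = V h ((r + R) / 2)" by (simp add: V_def)
    finally have Vh: "((?a + ?b) / 2) ^ ?n \<le> V h ((r + R) / 2)" .
    have an: "?a ^ ?n = V u r" "?b ^ ?n = V v R" by (simp_all add: V_def)
    let ?Q = "J u * (r powr (\<beta> + 1) / V u r) + J v * (R powr (\<beta> + 1) / V v R)"
    have "2 * ((x + y) / 2) powr - \<kappa> \<le> ((?a + ?b) / 2) ^ ?n / ((r + R) / 2) powr (\<beta> + 1) * ?Q"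
      using density_midpoint_ineq[OF xy pos(1,2) ab \<kappa>_def \<kappa>] unfolding Jx an .
    also have "\<dots> \<le> V h ((r + R) / 2) / ((r + R) / 2) powr (\<beta> + 1) * ?Q"
      using Vh J0 pos by (intro mult_right_mono divide_right_mono add_nonneg_nonneg) auto
    also have "\<dots> = d h ((r + R) / 2) * (J u / d u r + J v / d v R)"
      using \<beta>0 pos by (simp add: d_def field_simps)
    finally show "i h < (r + R) / 2 \<and> 2 * ((x + y) / 2) powr - \<kappa> \<le> d h ((r + R) / 2) * (J u / d u r + J v / d v R)"
      using ih by blast
  qed (use pu pv ph J0 in auto)
  then have "J h powr (- 1 / \<kappa>) \<le> (((x + y) / 2) powr - \<kappa>) powr (- 1 / \<kappa>)"
    using xy \<kappa> by (intro powr_mono2') auto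
  also have "\<dots> = (x + y) / 2" using xy \<kappa> by (simp add: powr_powr)
  finally show "J h powr s \<le> (J u powr s + J v powr s) / 2"
    by (simp add: x_def y_def s_def \<kappa>_def)
qed

section \<open>Second-order expansions\<close>

lemma powr_second_order:
  fixes a :: real
  obtains C where "0 \<le> C"
    "\<And>x. \<bar>x\<bar> \<le> 1/2 \<Longrightarrow> \<bar>(1 + x) powr a - (1 + a * x + a * (a - 1) / 2 * x\<^sup>2)\<bar> \<le> C * \<bar>x\<bar> ^ 3"
proof -
  define D where "D m x = (\<Prod>i<m. a - real i) * (1 + x) powr (a - real m)" for m and x :: real
  \<comment> \<open>The third derivative contains \<open>(1 + t) powr (a - 3)\<close> with
    \<open>1 + t\<close> between 1/2 and 3/2. Adding the two endpoint values covers either sign of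
    \<open>a - 3\<close>; 6 is the factorial of 3.\<close>
  define C where "C = \<bar>\<Prod>i<3. a - real i\<bar> * ((1/2) powr (a - 3) + (3/2) powr (a - 3)) / 6"
  have C0: "0 \<le> C" by (simp add: C_def)
  have dD: "(D m has_real_derivative D (Suc m) x) (at x)" if "-(1/2) \<le> x" for m x
  proof -
    have "((\<lambda>x. (1 + x) powr (a - real m)) has_real_derivative (a - real m) * (1 + x) powr (a - real m - 1)) (at x)"
      using that by (auto intro!: derivative_eq_intros)
    from DERIV_cmult[OF this, of "\<Prod>i<m. a - real i"] show ?thesis
      unfolding D_def by (simp add: mult_ac diff_diff_eq add.commute)
  qed
  have bound: "\<bar>(1 + x) powr a - (1 + a * x + a * (a - 1) / 2 * x\<^sup>2)\<bar> \<le> C * \<bar>x\<bar> ^ 3" if x: "\<bar>x\<bar> \<le> 1/2" for x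
  proof (cases "x = 0")
    case False
    obtain t where t: "if x < 0 then x < t \<and> t < 0 else 0 < t \<and> t < x"
      and e: "(1 + x) powr a = (\<Sum>m<3. D m 0 / fact m * (x - 0) ^ m) + D 3 t / fact 3 * (x - 0) ^ 3"
    proof -
      have "\<exists>t. (if x < 0 then x < t \<and> t < 0 else 0 < t \<and> t < x) \<and>
          (1 + x) powr a = (\<Sum>m<3. D m 0 / fact m * (x - 0) ^ m) + D 3 t / fact 3 * (x - 0) ^ 3"
      proof (rule Taylor[where a="-(1/2)" and b="1/2"])
        show "D 0 = (\<lambda>x. (1 + x) powr a)" by (auto simp: D_def)
        show "\<forall>m t. m < 3 \<and> - (1/2) \<le> t \<and> t \<le> 1/2 \<longrightarrow> (D m has_real_derivative D (Suc m) t) (at t)"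
          using dD by blast
      qed (use False x in auto)
      then show ?thesis using that by blast
    qed
    have t2: "\<bar>t\<bar> \<le> 1/2" using t x by (auto split: if_splits)
    have s: "(\<Sum>m<3. D m 0 / fact m * (x - 0) ^ m) = 1 + a * x + a * (a - 1) / 2 * x\<^sup>2"
      by (simp add: D_def numeral_3_eq_3 power2_eq_square fact_numeral)
    have "(1 + t) powr (a - 3) \<le> (1/2) powr (a - 3) + (3/2) powr (a - 3)"
    proof (cases "a - 3 \<ge> 0")
      case True
      then have "(1 + t) powr (a - 3) \<le> (3/2) powr (a - 3)" using t2 by (intro powr_mono2) auto
      then show ?thesis using powr_ge_zero[of "1/2" "a - 3"] by linarith
    next
      case False
      then have "(1 + t) powr (a - 3) \<le> (1/2) powr (a - 3)" using t2 by (intro powr_mono2') auto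
      then show ?thesis using powr_ge_zero[of "3/2" "a - 3"] by linarith
    qed
    then have "\<bar>D 3 t\<bar> \<le> 6 * C"
      unfolding D_def C_def by (simp add: abs_mult mult_left_mono)
    then have "\<bar>D 3 t\<bar> / 6 * \<bar>x\<bar> ^ 3 \<le> C * \<bar>x\<bar> ^ 3" by (intro mult_right_mono) auto
    then show ?thesis unfolding e s by (simp add: abs_mult power_abs fact_numeral)
  qed simp
  show ?thesis using that C0 bound by blast
qed

text \<open>After division by \<open>I powr s\<close> the first-order terms of the two summands
  cancel. What remains at order \<open>t\<^sup>2\<close> is
  \<open>s * c / I + s * (s - 1) / 2 * (b / I)\<^sup>2 \<ge> 0\<close>, and dividing by the negative
  \<open>s\<close> reverses the inequality.\<close>

lemma midpoint_powr_second_order: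
  fixes I b c s :: real and t :: "nat \<Rightarrow> real"
  assumes s: "s < 0" and I: "0 < I" and t: "\<And>n. 0 < t n" "t \<longlonglongrightarrow> 0"
    and ev: "eventually (\<lambda>n. 2 * I powr s \<le> (I - t n * b + (t n)\<^sup>2 * c) powr s + (I + t n * b + (t n)\<^sup>2 * c) powr s) sequentially"
  shows "2 * c * I \<le> (1 - s) * b\<^sup>2"
proof -
  obtain C where C: "0 \<le> C"
    "\<And>x. \<bar>x\<bar> \<le> 1/2 \<Longrightarrow> \<bar>(1 + x) powr s - (1 + s * x + s * (s - 1) / 2 * x\<^sup>2)\<bar> \<le> C * \<bar>x\<bar> ^ 3"
    using powr_second_order[of s] by metis
  \<comment> \<open>Bounds the relative perturbations divided by \<open>t n\<close> as soon as
    \<open>t n < 1\<close>. The summand 1 keeps it positive.\<close>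
  define D where "D = (\<bar>b\<bar> + \<bar>c\<bar>) / I + 1"
  have D: "0 < D" using I by (simp add: D_def add_nonneg_pos)
  have "eventually (\<lambda>n. t n < 1) sequentially" "eventually (\<lambda>n. t n < 1 / (2 * D)) sequentially"
    using order_tendstoD(2)[OF t(2)] D by auto
  with ev have "eventually (\<lambda>n. 0 \<le> s * c / I + s * (s - 1) / 2 * (b\<^sup>2 / I\<^sup>2 + (t n)\<^sup>2 * c\<^sup>2 / I\<^sup>2) + C * t n * D ^ 3) sequentially"
  proof eventually_elim
    case (elim n)
    define \<tau> where "\<tau> = t n"
    have \<tau>: "0 < \<tau>" "\<tau> < 1" "\<tau> * D < 1/2" using elim t(1)[of n] D by (auto simp: \<tau>_def field_simps)
    have small: "\<bar>(e * \<tau> * b + \<tau>\<^sup>2 * c) / I\<bar> \<le> \<tau> * D" if "\<bar>e\<bar> = 1" for e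
    proof -
      have "\<bar>e * \<tau> * b + \<tau>\<^sup>2 * c\<bar> \<le> \<bar>e * \<tau> * b\<bar> + \<bar>\<tau>\<^sup>2 * c\<bar>" by (rule abs_triangle_ineq)
      also have "\<dots> = \<tau> * \<bar>b\<bar> + \<tau> * (\<tau> * \<bar>c\<bar>)" using \<tau> that by (simp add: abs_mult power2_eq_square)
      also have "\<dots> \<le> \<tau> * \<bar>b\<bar> + \<tau> * (1 * \<bar>c\<bar>)" using \<tau> by (intro add_left_mono mult_left_mono mult_right_mono) auto
      also have "\<dots> \<le> \<tau> * D * I" using I \<tau> by (simp add: D_def field_simps)
      finally show ?thesis using I by (simp add: abs_mult pos_divide_le_eq)
    qed
    define x1 where "x1 = (- \<tau> * b + \<tau>\<^sup>2 * c) / I"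
    define x2 where "x2 = (\<tau> * b + \<tau>\<^sup>2 * c) / I"
    have sm: "\<bar>x1\<bar> \<le> \<tau> * D" "\<bar>x2\<bar> \<le> \<tau> * D"
      using small[of "-1"] small[of 1] by (simp_all add: x1_def x2_def)
    have up: "(1 + x) powr s \<le> 1 + s * x + s * (s - 1) / 2 * x\<^sup>2 + C * (\<tau> * D) ^ 3" if "\<bar>x\<bar> \<le> \<tau> * D" for x
    proof -
      have "C * \<bar>x\<bar> ^ 3 \<le> C * (\<tau> * D) ^ 3" using that C(1) by (intro mult_left_mono power_mono) auto
      then show ?thesis using C(2)[of x] that \<tau> by linarith
    qed
    have "I - \<tau> * b + \<tau>\<^sup>2 * c = I * (1 + x1)" "I + \<tau> * b + \<tau>\<^sup>2 * c = I * (1 + x2)"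
      using I by (simp_all add: x1_def x2_def field_simps)
    moreover have "0 \<le> 1 + x1" "0 \<le> 1 + x2" using sm \<tau> by linarith+
    ultimately have "(I - \<tau> * b + \<tau>\<^sup>2 * c) powr s = I powr s * (1 + x1) powr s"
      "(I + \<tau> * b + \<tau>\<^sup>2 * c) powr s = I powr s * (1 + x2) powr s"
      using I by (simp_all only: powr_mult less_imp_le)
    then have "2 * I powr s \<le> I powr s * ((1 + x1) powr s + (1 + x2) powr s)"
      using elim(1) by (simp add: \<tau>_def[symmetric] distrib_left)
    then have "2 \<le> (1 + x1) powr s + (1 + x2) powr s" using I by simp
    also have "\<dots> \<le> 2 + s * (x1 + x2) + s * (s - 1) / 2 * (x1\<^sup>2 + x2\<^sup>2) + 2 * C * (\<tau> * D) ^ 3"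
      using up[OF sm(1)] up[OF sm(2)] by (simp add: algebra_simps)
    also have "x1 + x2 = 2 * \<tau>\<^sup>2 * (c / I)" by (simp add: x1_def x2_def add_divide_distrib[symmetric])
    also have "x1\<^sup>2 + x2\<^sup>2 = 2 * \<tau>\<^sup>2 * (b\<^sup>2 / I\<^sup>2 + \<tau>\<^sup>2 * c\<^sup>2 / I\<^sup>2)"
      using I by (simp add: x1_def x2_def power_divide add_divide_distrib[symmetric]) (simp add: power2_eq_square algebra_simps)
    finally have "0 \<le> 2 * \<tau>\<^sup>2 * (s * (c / I) + s * (s - 1) / 2 * (b\<^sup>2 / I\<^sup>2 + \<tau>\<^sup>2 * c\<^sup>2 / I\<^sup>2) + C * \<tau> * D ^ 3)"
      by (simp add: power_mult_distrib power3_eq_cube power2_eq_square algebra_simps)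
    then have "0 \<le> s * (c / I) + s * (s - 1) / 2 * (b\<^sup>2 / I\<^sup>2 + \<tau>\<^sup>2 * c\<^sup>2 / I\<^sup>2) + C * \<tau> * D ^ 3"
      using \<tau> by (simp add: zero_le_mult_iff)
    then show ?case by (simp add: \<tau>_def)
  qed
  moreover have "(\<lambda>n. s * c / I + s * (s - 1) / 2 * (b\<^sup>2 / I\<^sup>2 + (t n)\<^sup>2 * c\<^sup>2 / I\<^sup>2) + C * t n * D ^ 3)
     \<longlonglongrightarrow> s * c / I + s * (s - 1) / 2 * (b\<^sup>2 / I\<^sup>2 + 0\<^sup>2 * c\<^sup>2 / I\<^sup>2) + C * 0 * D ^ 3"
    using I by (intro tendsto_intros t) auto
  ultimately have "0 \<le> s * c / I + s * (s - 1) / 2 * (b\<^sup>2 / I\<^sup>2 + 0\<^sup>2 * c\<^sup>2 / I\<^sup>2) + C * 0 * D ^ 3"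
    by (intro tendsto_lowerbound[where F=sequentially]) auto
  then have "0 \<le> 2 * I\<^sup>2 * (s * c / I + s * (s - 1) / 2 * (b\<^sup>2 / I\<^sup>2))" using I by simp
  also have "\<dots> = s * (2 * c * I - (1 - s) * b\<^sup>2)"
    using I by (simp add: power2_eq_square field_simps)
  finally show ?thesis using s by (simp add: zero_le_mult_iff)
qed

text \<open>The majorants \<open>E n\<close> move with \<open>n\<close>, so dominated convergence
  does not apply to \<open>\<rho> n\<close> directly. Cutting \<open>\<rho> n\<close> at
  \<open>E0\<close> costs at most the distance of \<open>E n\<close> from \<open>E0\<close>, which
  is small in \<open>L\<^sup>1\<close>. The excess \<open>h n\<close> of the cut function over
  \<open>r\<close> is dominated by \<open>E0\<close> and tends to 0.\<close>

lemma reverse_Fatou_L1: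
  fixes \<rho> E :: "nat \<Rightarrow> 'a \<Rightarrow> real"
  assumes [measurable]: "\<And>n. \<rho> n \<in> borel_measurable M" "w \<in> borel_measurable M"
    and E: "\<And>n. integrable M (E n)" "integrable M E0" "(\<lambda>n. \<integral>x. \<bar>E n x - E0 x\<bar> \<partial>M) \<longlonglongrightarrow> 0"
    and \<rho>: "\<And>n. AE x in M. 0 \<le> \<rho> n x \<and> \<rho> n x \<le> E n x" and r: "integrable M r" "AE x in M. 0 \<le> r x"
    and lim: "AE x in M. \<forall>e>0. eventually (\<lambda>n. \<rho> n x \<le> r x + e) sequentially"
    and w: "AE x in M. 0 \<le> w x \<and> w x \<le> B" and "0 < e"
  shows "\<And>n. integrable M (\<lambda>x. \<rho> n x * w x)" "integrable M (\<lambda>x. r x * w x)"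
    "eventually (\<lambda>n. (\<integral>x. \<rho> n x * w x \<partial>M) \<le> (\<integral>x. r x * w x \<partial>M) + e) sequentially"
proof -
  have [measurable]: "\<And>n. E n \<in> borel_measurable M" "E0 \<in> borel_measurable M" "r \<in> borel_measurable M"
    using E r by auto
  have i\<rho>: "integrable M (\<rho> n)" for n
    by (rule Bochner_Integration.integrable_bound[OF E(1)[of n]]) (use \<rho>[of n] in auto)
  have iw: "integrable M (\<lambda>x. f x * w x)" if f: "integrable M f" for f
  proof (rule Bochner_Integration.integrable_bound[OF integrable_mult_left[OF f, of B]])
    have [measurable]: "f \<in> borel_measurable M" using f by auto
    show "(\<lambda>x. f x * w x) \<in> borel_measurable M" by measurable
    show "AE x in M. norm (f x * w x) \<le> norm (f x * B)"
      using w by eventually_elim (auto simp: abs_mult intro!: mult_left_mono)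
  qed
  show "integrable M (\<lambda>x. \<rho> n x * w x)" for n by (rule iw[OF i\<rho>])
  show irw: "integrable M (\<lambda>x. r x * w x)" by (rule iw[OF r(1)])
  define h where "h n x = max 0 (min (\<rho> n x) (E0 x) - r x)" for n x
  have [measurable]: "h n \<in> borel_measurable M" for n unfolding h_def by measurable
  have hb: "AE x in M. norm (h n x) \<le> \<bar>E0 x\<bar>" for n
    using \<rho>[of n] r(2) by eventually_elim (auto simp: h_def)
  have "(\<lambda>n. \<integral>x. h n x \<partial>M) \<longlonglongrightarrow> (\<integral>x. 0 \<partial>M)"
  proof (rule integral_dominated_convergence[where w="\<lambda>x. \<bar>E0 x\<bar>"])
    show "AE x in M. (\<lambda>n. h n x) \<longlonglongrightarrow> 0"
      using lim
    proof eventually_elim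
      case (elim x)
      show ?case
      proof (rule LIMSEQ_I)
        fix e :: real assume "0 < e"
        then have "eventually (\<lambda>n. \<rho> n x \<le> r x + e/2) sequentially" using elim by simp
        then have "eventually (\<lambda>n. norm (h n x - 0) < e) sequentially"
          by eventually_elim (use \<open>0 < e\<close> in \<open>auto simp: h_def\<close>)
        then show "\<exists>no. \<forall>n\<ge>no. norm (h n x - 0) < e" by (simp add: eventually_sequentially)
      qed
    qed
  qed (use E(2) hb in auto)
  then have "(\<lambda>n. \<bar>B\<bar> * ((\<integral>x. \<bar>E n x - E0 x\<bar> \<partial>M) + (\<integral>x. h n x \<partial>M))) \<longlonglongrightarrow> \<bar>B\<bar> * (0 + 0)"
    by (intro tendsto_intros E) simp
  then have "eventually (\<lambda>n. \<bar>B\<bar> * ((\<integral>x. \<bar>E n x - E0 x\<bar> \<partial>M) + (\<integral>x. h n x \<partial>M)) < e) sequentially"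
    using \<open>0 < e\<close> by (intro order_tendstoD) auto
  then show "eventually (\<lambda>n. (\<integral>x. \<rho> n x * w x \<partial>M) \<le> (\<integral>x. r x * w x \<partial>M) + e) sequentially"
  proof eventually_elim
    case (elim n)
    have ih: "integrable M (h n)"
      by (rule Bochner_Integration.integrable_bound[OF integrable_abs[OF E(2)]]) (use hb[of n] in auto)
    have iE: "integrable M (\<lambda>x. \<bar>E n x - E0 x\<bar>)" using E by auto
    have "(\<integral>x. \<rho> n x * w x \<partial>M) \<le> (\<integral>x. r x * w x + \<bar>B\<bar> * (\<bar>E n x - E0 x\<bar> + h n x) \<partial>M)"
    proof (rule integral_mono_AE)
      show "integrable M (\<lambda>x. r x * w x + \<bar>B\<bar> * (\<bar>E n x - E0 x\<bar> + h n x))"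
        using irw ih iE by auto
      show "AE x in M. \<rho> n x * w x \<le> r x * w x + \<bar>B\<bar> * (\<bar>E n x - E0 x\<bar> + h n x)"
        using \<rho>[of n] w
      proof eventually_elim
        case (elim x)
        have "\<rho> n x - r x \<le> \<bar>E n x - E0 x\<bar> + h n x" using elim by (auto simp: h_def)
        then have "(\<rho> n x - r x) * w x \<le> (\<bar>E n x - E0 x\<bar> + h n x) * w x"
          using elim by (intro mult_right_mono) auto
        also have "\<dots> \<le> (\<bar>E n x - E0 x\<bar> + h n x) * \<bar>B\<bar>"
          using elim by (intro mult_left_mono) (auto simp: h_def)
        finally show ?case by (simp add: algebra_simps)
      qed
    qed (rule iw[OF i\<rho>])
    also have "\<dots> = (\<integral>x. r x * w x \<partial>M) + \<bar>B\<bar> * ((\<integral>x. \<bar>E n x - E0 x\<bar> \<partial>M) + (\<integral>x. h n x \<partial>M))"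
      using irw ih iE by simp
    finally show ?case using elim by linarith
  qed
qed

lemma one_plus_powr_neg_ge:
  fixes z \<beta> :: real
  assumes "0 \<le> z" "0 \<le> \<beta>"
  shows "1 - \<beta> * z \<le> (1 + z) powr - \<beta>"
proof -
  have "1 - \<beta> * z \<le> 1 + (- \<beta> * ln (1 + z))"
    using assms ln_add_one_self_le_self[of z] by (simp add: mult_left_mono)
  also have "\<dots> \<le> exp (- \<beta> * ln (1 + z))" by (rule exp_ge_add_one_self)
  finally show ?thesis using assms by (simp add: powr_def)
qed

text \<open>A decreasing power turns the upper bound for \<open>u n\<close> into a lower bound for
  the integral. The power of \<open>X = \<phi> x + \<sigma> * t n * W x\<close> is expanded with a
  cubic error that is uniform because \<open>W / \<phi>\<close> is bounded. The remainder
  \<open>\<rho>\<close> may be unbounded, so it is split off by \<open>one_plus_powr_neg_ge\<close>,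
  which is linear in it. Taking \<open>c0\<close> strictly below the limit coefficient leaves room
  for all errors.\<close>

lemma second_variation_lower_bound:
  fixes \<phi> W :: "'a \<Rightarrow> real" and u \<rho> :: "nat \<Rightarrow> 'a \<Rightarrow> real" and t :: "nat \<Rightarrow> real" and \<beta> \<sigma> :: real
  assumes M: "finite_measure M"
    and meas [measurable]: "\<phi> \<in> borel_measurable M" "W \<in> borel_measurable M" "\<And>n. u n \<in> borel_measurable M" "\<And>n. \<rho> n \<in> borel_measurable M"
    and \<phi>: "0 < c" "\<And>x. x \<in> space M \<Longrightarrow> c \<le> \<phi> x" and W: "\<And>x. x \<in> space M \<Longrightarrow> 0 \<le> W x \<and> W x \<le> B"
    and t: "\<And>n. 0 < t n" "t \<longlonglongrightarrow> 0" and \<sigma>: "\<bar>\<sigma>\<bar> = 1" and \<beta>: "0 < \<beta>"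
    and u: "0 < c'" "\<And>n x. x \<in> space M \<Longrightarrow> c' \<le> u n x" "\<And>n. AE x in M. u n x \<le> \<phi> x + \<sigma> * t n * W x + (t n)\<^sup>2 * \<rho> n x"
    and \<rho>: "\<And>n. AE x in M. 0 \<le> \<rho> n x" "\<And>n. integrable M (\<lambda>x. \<rho> n x * \<phi> x powr - (\<beta> + 1))"
    and P: "\<And>e. 0 < e \<Longrightarrow> eventually (\<lambda>n. (\<integral>x. \<rho> n x * \<phi> x powr - (\<beta> + 1) \<partial>M) \<le> P + e) sequentially"
  defines "I \<equiv> \<integral>x. \<phi> x powr - \<beta> \<partial>M"
    and "b \<equiv> \<beta> * (\<integral>x. W x * \<phi> x powr - (\<beta> + 1) \<partial>M)"
    and "Q \<equiv> \<integral>x. (W x)\<^sup>2 * \<phi> x powr - (\<beta> + 2) \<partial>M"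
  assumes c0: "c0 < \<beta> * (\<beta> + 1) / 2 * Q - \<beta> * P"
  shows "eventually (\<lambda>n. I - \<sigma> * t n * b + (t n)\<^sup>2 * c0 \<le> (\<integral>x. u n x powr - \<beta> \<partial>M)) sequentially"
proof -
  interpret finite_measure M by fact
  have \<phi>0: "0 < \<phi> x" if "x \<in> space M" for x using \<phi> that by (meson less_le_trans)
  have \<phi>p: "\<phi> x powr - q \<le> c powr - q" if "x \<in> space M" "0 < q" for x q
    using \<phi> that by (intro powr_mono2') auto
  have B0: "0 \<le> B" if "x \<in> space M" for x using W[OF that] by linarith
  define L where "L = \<bar>B\<bar> / c"
  have L0: "0 \<le> L" using \<phi> by (simp add: L_def)
  have GL: "0 \<le> W x / \<phi> x" "W x / \<phi> x \<le> L" if "x \<in> space M" for x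
    using \<phi>0[OF that] \<phi> W[OF that] unfolding L_def by (auto intro!: frac_le \<phi>(2)[OF that])
  have int\<phi>: "integrable M (\<lambda>x. \<phi> x powr - q)" if "0 < q" for q
    by (rule integrable_const_bound[where B="c powr - q"]) (use \<phi>p that in auto)
  have intW: "integrable M (\<lambda>x. W x ^ k * \<phi> x powr - q)" if "0 < q" for q k
  proof (rule integrable_const_bound[where B="\<bar>B\<bar> ^ k * c powr - q"])
    show "AE x in M. norm (W x ^ k * \<phi> x powr - q) \<le> \<bar>B\<bar> ^ k * c powr - q"
    proof (rule AE_I2)
      fix x assume x: "x \<in> space M"
      have "W x ^ k * \<phi> x powr - q \<le> \<bar>B\<bar> ^ k * c powr - q"
        using W[OF x] \<phi>p[OF x that] by (intro mult_mono power_mono) auto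
      then show "norm (W x ^ k * \<phi> x powr - q) \<le> \<bar>B\<bar> ^ k * c powr - q"
        using W[OF x] by (simp add: abs_mult power_abs)
    qed
  qed measurable
  have intu: "integrable M (\<lambda>x. u n x powr - \<beta>)" for n
    by (rule integrable_const_bound[where B="c' powr - \<beta>"]) (use u(1,2) \<beta> in \<open>auto intro!: AE_I2 powr_mono2'\<close>)
  obtain C where C: "0 \<le> C"
    "\<And>x. \<bar>x\<bar> \<le> 1/2 \<Longrightarrow> \<bar>(1 + x) powr - \<beta> - (1 + - \<beta> * x + - \<beta> * (- \<beta> - 1) / 2 * x\<^sup>2)\<bar> \<le> C * \<bar>x\<bar> ^ 3"
    using powr_second_order[of "- \<beta>"] by metis
  define \<epsilon> where "\<epsilon> = \<beta> * (\<beta> + 1) / 2 * Q - \<beta> * P - c0"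
  have \<epsilon>: "0 < \<epsilon>" using c0 by (simp add: \<epsilon>_def)
  define e where "e = \<epsilon> / (4 * \<beta>)"
  have e: "0 < e" using \<epsilon> \<beta> by (simp add: e_def)
  have I0: "0 \<le> I" unfolding I_def by (rule integral_nonneg_AE) auto
  have lim1: "(\<lambda>n. C * t n * L ^ 3 * I) \<longlonglongrightarrow> C * 0 * L ^ 3 * I" by (intro tendsto_intros t)
  have lim2: "(\<lambda>n. \<beta> * (((1 - t n * L) powr - (\<beta> + 1)) * (P + e))) \<longlonglongrightarrow> \<beta> * (((1 - 0 * L) powr - (\<beta> + 1)) * (P + e))"
    by (intro tendsto_mult tendsto_powr tendsto_diff tendsto_const t) simp
  have "eventually (\<lambda>n. C * t n * L ^ 3 * I < \<epsilon> / 4) sequentially" using order_tendstoD(2)[OF lim1, of "\<epsilon> / 4"] \<epsilon> by simp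
  moreover have "eventually (\<lambda>n. \<beta> * (((1 - t n * L) powr - (\<beta> + 1)) * (P + e)) < \<beta> * (P + e) + \<epsilon> / 4) sequentially"
    using order_tendstoD(2)[OF lim2, of "\<beta> * (P + e) + \<epsilon> / 4"] \<epsilon> by simp
  moreover have "eventually (\<lambda>n. t n < 1 / (2 * (L + 1))) sequentially"
    using order_tendstoD(2)[OF t(2)] L0 by simp
  moreover note P[OF e]
  ultimately show ?thesis
  proof eventually_elim
    case (elim n)
    define \<tau> where "\<tau> = t n"
    have \<tau>: "0 < \<tau>" "\<tau> * L \<le> 1/2"
    proof -
      show "0 < \<tau>" using t by (simp add: \<tau>_def)
      have "\<tau> * (L + 1) < 1/2" using elim(3) L0 by (simp add: \<tau>_def field_simps)
      then show "\<tau> * L \<le> 1/2" using \<open>0 < \<tau>\<close> by (simp add: algebra_simps)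
    qed
    \<comment> \<open>For either sign \<open>\<sigma>\<close>, this bounds the quotient of
      \<open>X powr - (\<beta> + 1)\<close> by \<open>\<phi> x powr - (\<beta> + 1)\<close>.\<close>
    define \<delta> where "\<delta> = (1 - \<tau> * L) powr - (\<beta> + 1)"
    have \<delta>0: "0 \<le> \<delta>" by (simp add: \<delta>_def)
    let ?low = "\<lambda>x. \<phi> x powr - \<beta> - \<beta> * \<sigma> * \<tau> * (W x ^ 1 * \<phi> x powr - (\<beta> + 1))
        + \<beta> * (\<beta> + 1) / 2 * \<tau>\<^sup>2 * (W x ^ 2 * \<phi> x powr - (\<beta> + 2)) - C * \<tau> ^ 3 * L ^ 3 * \<phi> x powr - \<beta>
        - \<beta> * \<tau>\<^sup>2 * \<delta> * (\<rho> n x * \<phi> x powr - (\<beta> + 1))"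
    have int1: "integrable M (\<lambda>x. \<phi> x powr - \<beta>)" using int\<phi> \<beta> by simp
    have int2: "integrable M (\<lambda>x. W x ^ 1 * \<phi> x powr - (\<beta> + 1))" "integrable M (\<lambda>x. W x ^ 2 * \<phi> x powr - (\<beta> + 2))"
      by (rule intW; use \<beta> in simp)+
    have intlow: "integrable M ?low"
      by (intro Bochner_Integration.integrable_diff Bochner_Integration.integrable_add integrable_mult_right int1 int2 \<rho>(2))
    have "AE x in M. ?low x \<le> u n x powr - \<beta>"
      using u(3)[of n] \<rho>(1)[of n] AE_space
    proof eventually_elim
      case (elim x)
      define G where "G = W x / \<phi> x"
      define X where "X = \<phi> x + \<sigma> * \<tau> * W x"
      define y where "y = \<tau>\<^sup>2 * \<rho> n x"
      have p: "0 < \<phi> x" using \<phi>0 elim by simp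
      have G: "0 \<le> G" "G \<le> L" using GL elim by (auto simp: G_def)
      have \<tau>G: "\<tau> * G \<le> \<tau> * L" using G \<tau> by (intro mult_left_mono) auto
      have abs: "\<bar>\<sigma> * \<tau> * G\<bar> \<le> \<tau> * L" using \<tau>G G \<tau> \<sigma> by (simp add: abs_mult)
      have X: "X = \<phi> x * (1 + \<sigma> * \<tau> * G)" using p by (simp add: X_def G_def field_simps)
      have g: "1 - \<tau> * L \<le> 1 + \<sigma> * \<tau> * G" "0 < 1 - \<tau> * L" using abs \<tau> by linarith+
      then have g': "0 < 1 + \<sigma> * \<tau> * G" by linarith
      then have X0: "0 < X" using p X by simp
      have y0: "0 \<le> y" using elim by (simp add: y_def)
      have "X powr - \<beta> - \<beta> * y * X powr - (\<beta> + 1) = X powr - \<beta> * (1 - \<beta> * (y / X))"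
        using X0 powr_add[of X "- \<beta>" "-1"] by (simp add: powr_minus_divide[of X 1] algebra_simps)
      also have "\<dots> \<le> X powr - \<beta> * (1 + y / X) powr - \<beta>"
        using X0 y0 \<beta> by (intro mult_left_mono one_plus_powr_neg_ge) auto
      also have "\<dots> = (X * (1 + y / X)) powr - \<beta>"
        using X0 y0 by (simp add: powr_mult)
      also have "X * (1 + y / X) = X + y" using X0 by (simp add: distrib_left)
      also have "(X + y) powr - \<beta> \<le> u n x powr - \<beta>"
      proof (rule powr_mono2')
        show "0 < u n x" using u(1) u(2)[of x n] elim by linarith
        show "u n x \<le> X + y" using elim by (simp add: X_def y_def \<tau>_def)
      qed (use \<beta> in auto)
      finally have 1: "X powr - \<beta> - \<beta> * y * X powr - (\<beta> + 1) \<le> u n x powr - \<beta>" .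
      have "X powr - (\<beta> + 1) = \<phi> x powr - (\<beta> + 1) * (1 + \<sigma> * \<tau> * G) powr - (\<beta> + 1)"
        unfolding X using p g' by (simp add: powr_mult)
      also have "\<dots> \<le> \<phi> x powr - (\<beta> + 1) * \<delta>"
        unfolding \<delta>_def using g \<beta> by (intro mult_left_mono powr_mono2') auto
      finally have 2: "\<beta> * y * X powr - (\<beta> + 1) \<le> \<beta> * y * (\<phi> x powr - (\<beta> + 1) * \<delta>)"
        using \<beta> y0 by (intro mult_left_mono) auto
      have "C * \<bar>\<sigma> * \<tau> * G\<bar> ^ 3 \<le> C * (\<tau> * L) ^ 3" using abs C(1) by (intro mult_left_mono power_mono) auto
      moreover have "\<bar>\<sigma> * \<tau> * G\<bar> \<le> 1/2" using abs \<tau> by linarith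
      ultimately have "1 - \<beta> * (\<sigma> * \<tau> * G) + \<beta> * (\<beta> + 1) / 2 * (\<sigma> * \<tau> * G)\<^sup>2 - C * (\<tau> * L) ^ 3 \<le> (1 + \<sigma> * \<tau> * G) powr - \<beta>"
        using C(2)[of "\<sigma> * \<tau> * G"] by (simp add: algebra_simps abs_le_iff)
      then have "\<phi> x powr - \<beta> * (1 - \<beta> * (\<sigma> * \<tau> * G) + \<beta> * (\<beta> + 1) / 2 * (\<sigma> * \<tau> * G)\<^sup>2 - C * (\<tau> * L) ^ 3)
         \<le> \<phi> x powr - \<beta> * (1 + \<sigma> * \<tau> * G) powr - \<beta>"
        by (intro mult_left_mono) auto
      also have "\<dots> = X powr - \<beta>" unfolding X using p g' by (simp add: powr_mult)
      finally have 3: "\<phi> x powr - \<beta> * (1 - \<beta> * (\<sigma> * \<tau> * G) + \<beta> * (\<beta> + 1) / 2 * (\<sigma> * \<tau> * G)\<^sup>2 - C * (\<tau> * L) ^ 3) \<le> X powr - \<beta>" .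
      have s2: "\<sigma>\<^sup>2 = 1" using \<sigma> by (metis abs_power2 one_power2 power2_abs)
      have p1: "\<phi> x powr - (\<beta> + 1) = \<phi> x powr - \<beta> / \<phi> x" "\<phi> x powr - (\<beta> + 2) = \<phi> x powr - \<beta> / (\<phi> x)\<^sup>2"
        using p powr_add[of "\<phi> x" "- \<beta>" "-1"] powr_add[of "\<phi> x" "- \<beta>" "-2"]
        by (simp_all add: powr_minus_divide)
      have "?low x = \<phi> x powr - \<beta> * (1 - \<beta> * (\<sigma> * \<tau> * G) + \<beta> * (\<beta> + 1) / 2 * (\<sigma> * \<tau> * G)\<^sup>2 - C * (\<tau> * L) ^ 3)
          - \<beta> * y * (\<phi> x powr - (\<beta> + 1) * \<delta>)"
        unfolding p1 y_def G_def power_mult_distrib s2 power_divide by (simp add: algebra_simps)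
      then show ?case using 1 2 3 by linarith
    qed
    then have low_le: "(\<integral>x. ?low x \<partial>M) \<le> (\<integral>x. u n x powr - \<beta> \<partial>M)"
      by (intro integral_mono_AE intlow intu)
    have low_eq: "(\<integral>x. ?low x \<partial>M) = I - \<sigma> * \<tau> * b + \<beta> * (\<beta> + 1) / 2 * \<tau>\<^sup>2 * Q - C * \<tau> ^ 3 * L ^ 3 * I
        - \<beta> * \<tau>\<^sup>2 * \<delta> * (\<integral>x. \<rho> n x * \<phi> x powr - (\<beta> + 1) \<partial>M)"
      using int1 int2 \<rho>(2)[of n] by (simp add: I_def b_def Q_def)
    have c0_le: "\<tau>\<^sup>2 * (c0 - \<beta> * (\<beta> + 1) / 2 * Q) \<le> \<tau>\<^sup>2 * (- (C * \<tau> * L ^ 3 * I) - \<beta> * \<delta> * (\<integral>x. \<rho> n x * \<phi> x powr - (\<beta> + 1) \<partial>M))"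
    proof (rule mult_left_mono)
      have "\<beta> * \<delta> * (\<integral>x. \<rho> n x * \<phi> x powr - (\<beta> + 1) \<partial>M) \<le> \<beta> * \<delta> * (P + e)"
        using elim(4) \<beta> \<delta>0 by (intro mult_left_mono) auto
      moreover have "\<beta> * \<delta> * (P + e) < \<beta> * (P + e) + \<epsilon> / 4" using elim(2) by (simp add: \<delta>_def \<tau>_def mult.assoc)
      moreover have "\<beta> * e = \<epsilon> / 4" using \<beta> by (simp add: e_def)
      moreover have "C * \<tau> * L ^ 3 * I < \<epsilon> / 4" using elim(1) by (simp add: \<tau>_def)
      moreover have "c0 - \<beta> * (\<beta> + 1) / 2 * Q = - \<epsilon> - \<beta> * P" by (simp add: \<epsilon>_def)
      moreover have "\<beta> * (P + e) = \<beta> * P + \<beta> * e" by (rule distrib_left)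
      ultimately show "c0 - \<beta> * (\<beta> + 1) / 2 * Q \<le> - (C * \<tau> * L ^ 3 * I) - \<beta> * \<delta> * (\<integral>x. \<rho> n x * \<phi> x powr - (\<beta> + 1) \<partial>M)"
        using \<epsilon> by linarith
    qed simp
    have "I - \<sigma> * \<tau> * b + \<tau>\<^sup>2 * c0 = (I - \<sigma> * \<tau> * b + \<beta> * (\<beta> + 1) / 2 * \<tau>\<^sup>2 * Q) + \<tau>\<^sup>2 * (c0 - \<beta> * (\<beta> + 1) / 2 * Q)"
      by (simp add: algebra_simps)
    also have "\<dots> \<le> (I - \<sigma> * \<tau> * b + \<beta> * (\<beta> + 1) / 2 * \<tau>\<^sup>2 * Q)
        + \<tau>\<^sup>2 * (- (C * \<tau> * L ^ 3 * I) - \<beta> * \<delta> * (\<integral>x. \<rho> n x * \<phi> x powr - (\<beta> + 1) \<partial>M))"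
      using c0_le by simp
    also have "\<dots> = (\<integral>x. ?low x \<partial>M)"
      unfolding low_eq by (simp add: power3_eq_cube power2_eq_square right_diff_distrib mult_ac)
    also note low_le
    finally show ?case by (simp add: \<tau>_def)
  qed
qed

section \<open>Taylor remainders of a convex function\<close>

lemma convex_above_tangent:
  fixes f :: "'a::real_inner \<Rightarrow> real"
  assumes conv: "convex_on UNIV f" and deriv: "(f has_derivative (\<lambda>h. q \<bullet> h)) (at y)"
  shows "f y + q \<bullet> h \<le> f (y + h)"
proof -
  have c: "convex_on UNIV (\<lambda>\<tau>::real. f (y + \<tau> *\<^sub>R h))"
  proof (rule convex_onI)
    fix t a b :: real assume t: "0 < t" "t < 1"
    have "y + ((1 - t) *\<^sub>R a + t *\<^sub>R b) *\<^sub>R h = (1 - t) *\<^sub>R (y + a *\<^sub>R h) + t *\<^sub>R (y + b *\<^sub>R h)"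
      by (simp add: algebra_simps)
    then show "f (y + ((1 - t) *\<^sub>R a + t *\<^sub>R b) *\<^sub>R h) \<le> (1 - t) * f (y + a *\<^sub>R h) + t * f (y + b *\<^sub>R h)"
      using convex_onD[OF conv, of t "y + a *\<^sub>R h" "y + b *\<^sub>R h"] t by simp
  qed simp
  have "((\<lambda>\<tau>. y + \<tau> *\<^sub>R h) has_derivative (\<lambda>k. k *\<^sub>R h)) (at (0::real))"
    by (auto intro!: derivative_eq_intros)
  from has_derivative_compose[OF this, of f "\<lambda>h. q \<bullet> h"] deriv
  have d: "((\<lambda>\<tau>. f (y + \<tau> *\<^sub>R h)) has_real_derivative q \<bullet> h) (at 0)"
    by (simp add: has_field_derivative_def mult.commute mult_commute_abs)
  have "q \<bullet> h * (1 - 0) \<le> f (y + 1 *\<^sub>R h) - f (y + 0 *\<^sub>R h)"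
    by (rule convex_on_imp_above_tangent[OF c]) (use d in auto)
  then show ?thesis by simp
qed

text \<open>Here \<open>p\<close> is the gradient and \<open>D z\<close> its derivative at
  \<open>z\<close>. Nothing is assumed on how \<open>D\<close> varies with \<open>z\<close>, so
  measurability and local integrability of its quadratic form have to be derived.\<close>

locale convex_twice_differentiable =
  fixes \<phi> :: "'a::euclidean_space \<Rightarrow> real" and p :: "'a \<Rightarrow> 'a" and D :: "'a \<Rightarrow> 'a \<Rightarrow> 'a"
  assumes conv: "convex_on UNIV \<phi>"
    and deriv1: "\<And>z. (\<phi> has_derivative (\<lambda>h. p z \<bullet> h)) (at z)"
    and deriv2: "\<And>z. (p has_derivative D z) (at z)"
begin

text \<open>The first-order Taylor remainder, also known as the Bregman distance of
  \<open>\<phi>\<close> between \<open>y\<close> and \<open>y + t *\<^sub>R q\<close>. Convexity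
  makes it nonnegative; for small \<open>t\<close> it behaves like
  \<open>t\<^sup>2 * (D y q \<bullet> q) / 2\<close>.\<close>

definition R :: "'a \<Rightarrow> real \<Rightarrow> 'a \<Rightarrow> real" where
  "R q t y = \<phi> (y + t *\<^sub>R q) - \<phi> y - t * (p y \<bullet> q)"

lemma continuous_\<phi>: "continuous_on S \<phi>" and continuous_p: "continuous_on S p"
  by (auto intro!: continuous_at_imp_continuous_on has_derivative_continuous[OF deriv1] has_derivative_continuous[OF deriv2])

lemma measurable_\<phi> [measurable]: "\<phi> \<in> borel_measurable borel" and measurable_p [measurable]: "p \<in> borel_measurable borel"
  by (intro borel_measurable_continuous_onI continuous_\<phi> continuous_p)+

lemma continuous_R: "continuous_on S (R q t)"
  unfolding R_def by (intro continuous_intros continuous_on_compose2[OF continuous_\<phi>[of UNIV]] continuous_\<phi> continuous_p) auto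

lemma measurable_R [measurable]: "R q t \<in> borel_measurable borel"
  by (rule borel_measurable_continuous_onI[OF continuous_R])

lemma line_derivative1: "((\<lambda>\<tau>. \<phi> (y + \<tau> *\<^sub>R q)) has_real_derivative p (y + \<tau> *\<^sub>R q) \<bullet> q) (at \<tau>)"
proof -
  have "((\<lambda>\<tau>. y + \<tau> *\<^sub>R q) has_derivative (\<lambda>h. h *\<^sub>R q)) (at \<tau>)"
    by (auto intro!: derivative_eq_intros)
  from has_derivative_compose[OF this deriv1] show ?thesis
    by (simp add: has_field_derivative_def mult.commute mult_commute_abs)
qed

lemma linear_D: "linear (D z)"
  using deriv2 has_derivative_linear by blast

lemma line_derivative2: "((\<lambda>\<tau>. p (y + \<tau> *\<^sub>R q) \<bullet> q') has_real_derivative D (y + \<tau> *\<^sub>R q) q \<bullet> q') (at \<tau>)"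
proof -
  have "((\<lambda>\<tau>. y + \<tau> *\<^sub>R q) has_derivative (\<lambda>h. h *\<^sub>R q)) (at \<tau>)"
    by (auto intro!: derivative_eq_intros)
  from has_derivative_inner_left[OF has_derivative_compose[OF this deriv2], of q'] show ?thesis
    by (simp add: has_field_derivative_def linear_scale[OF linear_D] mult.commute mult_commute_abs)
qed

lemma above_tangent: "\<phi> y + p y \<bullet> h \<le> \<phi> (y + h)"
  by (rule convex_above_tangent[OF conv deriv1])

lemma R_nonneg: "0 \<le> R q t y"
  using above_tangent[of y "t *\<^sub>R q"] by (simp add: R_def)

lemma monotone_p: "0 \<le> (p z' - p z) \<bullet> (z' - z)"
  using above_tangent[of z "z' - z"] above_tangent[of z' "z - z'"] by (simp add: inner_simps algebra_simps)

lemma D_nonneg: "0 \<le> D z q \<bullet> q"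
proof (rule mono_on_imp_deriv_nonneg)
  show "mono_on UNIV (\<lambda>\<tau>. p (z + \<tau> *\<^sub>R q) \<bullet> q)"
  proof (rule mono_onI)
    fix a b :: real assume "a \<le> b"
    have "0 \<le> (b - a) * ((p (z + b *\<^sub>R q) - p (z + a *\<^sub>R q)) \<bullet> q)"
      using monotone_p[of "z + b *\<^sub>R q" "z + a *\<^sub>R q"] by (simp add: scaleR_diff_left[symmetric])
    then show "p (z + a *\<^sub>R q) \<bullet> q \<le> p (z + b *\<^sub>R q) \<bullet> q"
      using \<open>a \<le> b\<close> by (cases "a = b") (auto simp: zero_le_mult_iff inner_diff_left)
  qed
  show "((\<lambda>\<tau>. p (z + \<tau> *\<^sub>R q) \<bullet> q) has_real_derivative D z q \<bullet> q) (at 0)"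
    using line_derivative2[of z q q 0] by simp
qed auto

text \<open>A pointwise limit of difference quotients of the continuous function
  \<open>p\<close>.\<close>

lemma measurable_D [measurable]: "(\<lambda>z. D z q \<bullet> q') \<in> borel_measurable borel"
proof (rule borel_measurable_LIMSEQ_real)
  fix z
  have "((\<lambda>\<tau>. (p (z + \<tau> *\<^sub>R q) \<bullet> q' - p z \<bullet> q') / \<tau>) \<longlongrightarrow> D z q \<bullet> q') (at 0)"
    using line_derivative2[of z q q' 0] by (simp add: has_field_derivative_iff)
  moreover have "filterlim (\<lambda>n. 1 / real (Suc n)) (at 0) sequentially"
    by (auto simp: filterlim_at intro!: LIMSEQ_Suc[OF lim_1_over_n] always_eventually simp del: of_nat_Suc)
  ultimately show "(\<lambda>n. (p (z + (1 / real (Suc n)) *\<^sub>R q) \<bullet> q' - p z \<bullet> q') / (1 / real (Suc n))) \<longlonglongrightarrow> D z q \<bullet> q'"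
    by (rule filterlim_compose)
next
  fix n
  have "(\<lambda>z. p (z + (1 / real (Suc n)) *\<^sub>R q)) \<in> borel_measurable borel"
    by (rule measurable_compose[OF _ measurable_p]) measurable
  then show "(\<lambda>z. (p (z + (1 / real (Suc n)) *\<^sub>R q) \<bullet> q' - p z \<bullet> q') / (1 / real (Suc n))) \<in> borel_measurable borel"
    by measurable
qed

text \<open>The expansion in Peano form rests on the derivative of \<open>p\<close> at the point
  \<open>y\<close> alone: the mean value theorem on the segment is applied to \<open>\<phi>\<close>
  minus its quadratic polynomial, and the derivative of this difference is the remainder of
  \<open>p\<close>.\<close>

lemma second_order:
  assumes "0 < e"
  obtains d where "0 < d" "\<And>h. norm h < d \<Longrightarrow> \<bar>\<phi> (y + h) - \<phi> y - p y \<bullet> h - D y h \<bullet> h / 2\<bar> \<le> e * (norm h)\<^sup>2"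
proof -
  obtain d where d: "0 < d" "\<And>z. norm (z - y) < d \<Longrightarrow> norm (p z - p y - D y (z - y)) \<le> e * norm (z - y)"
    using deriv2[of y] \<open>0 < e\<close> unfolding has_derivative_at_alt by metis
  have "\<bar>\<phi> (y + h) - \<phi> y - p y \<bullet> h - D y h \<bullet> h / 2\<bar> \<le> e * (norm h)\<^sup>2" if h: "norm h < d" for h
  proof -
    define a where "a \<tau> = \<phi> (y + \<tau> *\<^sub>R h) - \<tau> * (p y \<bullet> h) - \<tau>\<^sup>2 * (D y h \<bullet> h / 2)" for \<tau>
    have da: "(a has_real_derivative (p (y + \<tau> *\<^sub>R h) \<bullet> h - p y \<bullet> h - \<tau> * (D y h \<bullet> h))) (at \<tau>)" for \<tau>
      unfolding a_def by (rule derivative_eq_intros line_derivative1 refl | simp)+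
    obtain \<tau> where \<tau>: "0 < \<tau>" "\<tau> < 1" "a 1 - a 0 = (1 - 0) * (p (y + \<tau> *\<^sub>R h) \<bullet> h - p y \<bullet> h - \<tau> * (D y h \<bullet> h))"
      using MVT2[of 0 1 a] da by force
    have "\<bar>a 1 - a 0\<bar> = \<bar>(p (y + \<tau> *\<^sub>R h) - p y - D y (\<tau> *\<^sub>R h)) \<bullet> h\<bar>"
      unfolding \<tau>(3) by (simp add: inner_diff_left linear_scale[OF linear_D])
    also have "\<dots> \<le> norm (p (y + \<tau> *\<^sub>R h) - p y - D y (\<tau> *\<^sub>R h)) * norm h" by (rule Cauchy_Schwarz_ineq2)
    also have "\<dots> \<le> (e * norm (\<tau> *\<^sub>R h)) * norm h"
    proof (rule mult_right_mono)
      have "norm (\<tau> *\<^sub>R h) \<le> norm h" using \<tau> by (simp add: mult_left_le_one_le)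
      then show "norm (p (y + \<tau> *\<^sub>R h) - p y - D y (\<tau> *\<^sub>R h)) \<le> e * norm (\<tau> *\<^sub>R h)"
        using d(2)[of "y + \<tau> *\<^sub>R h"] h by simp
    qed simp
    also have "\<dots> \<le> e * (norm h)\<^sup>2"
      using \<tau> \<open>0 < e\<close> by (simp add: power2_eq_square mult_left_le_one_le mult.assoc mult.left_commute)
    finally show ?thesis by (simp add: a_def algebra_simps)
  qed
  then show ?thesis using that d by blast
qed

lemma R_limit:
  assumes t: "\<And>n. 0 < t n" "t \<longlonglongrightarrow> 0"
  shows "(\<lambda>n. R q (t n) y / (t n)\<^sup>2) \<longlonglongrightarrow> D y q \<bullet> q / 2"
proof (rule LIMSEQ_I)
  fix r :: real assume r: "0 < r"
  define e where "e = r / (2 * ((norm q)\<^sup>2 + 1))"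
  have e: "0 < e" using r by (simp add: e_def add_nonneg_pos)
  have er: "e * (norm q)\<^sup>2 < r"
  proof -
    have "e * (norm q)\<^sup>2 \<le> e * ((norm q)\<^sup>2 + 1)" using e by (intro mult_left_mono) auto
    also have "\<dots> = r / 2"
    proof -
      have "0 < (norm q)\<^sup>2 + 1" by (simp add: add_nonneg_pos)
      then have "(norm q)\<^sup>2 + 1 \<noteq> 0" by linarith
      then have "r / (2 * ((norm q)\<^sup>2 + 1)) * ((norm q)\<^sup>2 + 1) = r / 2"
        by (metis divide_divide_eq_left nonzero_eq_divide_eq)
      then show ?thesis unfolding e_def .
    qed
    finally show ?thesis using r by linarith
  qed
  obtain d where d: "0 < d" "\<And>h. norm h < d \<Longrightarrow> \<bar>\<phi> (y + h) - \<phi> y - p y \<bullet> h - D y h \<bullet> h / 2\<bar> \<le> e * (norm h)\<^sup>2"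
    using second_order[OF e] by metis
  have "(\<lambda>n. t n * norm q) \<longlonglongrightarrow> 0 * norm q" by (intro tendsto_intros t)
  then have "eventually (\<lambda>n. t n * norm q < d) sequentially" using order_tendstoD(2)[of _ 0] d by simp
  then have "eventually (\<lambda>n. norm (R q (t n) y / (t n)\<^sup>2 - D y q \<bullet> q / 2) < r) sequentially"
  proof eventually_elim
    case (elim n)
    have "\<bar>R q (t n) y - (t n)\<^sup>2 * (D y q \<bullet> q / 2)\<bar> \<le> e * (t n * norm q)\<^sup>2"
      using d(2)[of "t n *\<^sub>R q"] elim t(1)[of n]
      by (simp add: R_def linear_scale[OF linear_D] power2_eq_square mult_ac)
    then have "\<bar>R q (t n) y - (t n)\<^sup>2 * (D y q \<bullet> q / 2)\<bar> / (t n)\<^sup>2 \<le> e * (norm q)\<^sup>2"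
      using t(1)[of n] by (simp add: pos_divide_le_eq power_mult_distrib mult_ac)
    moreover have "R q (t n) y / (t n)\<^sup>2 - D y q \<bullet> q / 2 = (R q (t n) y - (t n)\<^sup>2 * (D y q \<bullet> q / 2)) / (t n)\<^sup>2"
      using t(1)[of n] by (simp add: diff_divide_distrib)
    ultimately show ?case using er by (simp add: abs_divide)
  qed
  then show "\<exists>no. \<forall>n\<ge>no. norm (R q (t n) y / (t n)\<^sup>2 - D y q \<bullet> q / 2) < r"
    by (simp add: eventually_sequentially)
qed

section \<open>Local integrability of the second derivative\<close>

definition N :: "'a \<Rightarrow> 'a set \<Rightarrow> ennreal" where
  "N q S = (\<integral>\<^sup>+z. ennreal (D z q \<bullet> q) * indicator S z \<partial>lborel)"

lemma measurable_N:
  assumes "S \<in> sets borel" shows "(\<lambda>z. ennreal (D z q \<bullet> q) * indicator S z) \<in> borel_measurable lborel"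
  using measurable_D[of q q] assms by (intro borel_measurable_times_ennreal borel_measurable_indicator measurable_compose[OF _ measurable_ennreal]) auto

lemma N_mono: "S \<subseteq> T \<Longrightarrow> N q S \<le> N q T"
  unfolding N_def by (intro nn_integral_mono) (auto simp: indicator_def)

lemma N_translate:
  assumes "S \<in> sets borel"
  shows "(\<integral>\<^sup>+y. ennreal (D (y + c) q \<bullet> q) * indicator S y \<partial>lborel) = N q ((+) c ` S)"
proof -
  have [measurable]: "S \<in> sets borel" by fact
  have "(+) c ` S = (\<lambda>z. z - c) -` S" by (auto simp: image_iff intro!: bexI[where x="_ - c"])
  moreover have "(\<lambda>z. z - c) -` S \<inter> space borel \<in> sets borel" by (rule measurable_sets[of _ borel borel]) auto
  ultimately have [measurable]: "(+) c ` S \<in> sets borel" by simp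
  have "N q ((+) c ` S) = (\<integral>\<^sup>+z. ennreal (D z q \<bullet> q) * indicator ((+) c ` S) z \<partial>distr lborel borel ((+) c))"
    unfolding N_def lborel_distr_plus by simp
  also have "\<dots> = (\<integral>\<^sup>+y. ennreal (D (c + y) q \<bullet> q) * indicator ((+) c ` S) (c + y) \<partial>lborel)"
    by (subst nn_integral_distr) auto
  also have "\<dots> = (\<integral>\<^sup>+y. ennreal (D (y + c) q \<bullet> q) * indicator S y \<partial>lborel)"
    by (intro nn_integral_cong) (auto simp: indicator_def add.commute)
  finally show ?thesis by simp
qed

text \<open>Taylor's formula with integral remainder. The integrand may be discontinuous in
  \<open>\<tau>\<close>; the fundamental theorem of calculus for a nonnegative measurable derivative
  still applies, because \<open>?F\<close> is differentiable at every point of the segment and not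
  just at almost all of them.\<close>

lemma R_eq_integral:
  assumes "0 \<le> t"
  shows "ennreal (R q t y) = (\<integral>\<^sup>+\<tau>. ennreal ((t - \<tau>) * (D (y + \<tau> *\<^sub>R q) q \<bullet> q)) * indicator {0..t} \<tau> \<partial>lborel)"
proof -
  let ?F = "\<lambda>\<tau>. \<phi> (y + \<tau> *\<^sub>R q) + (t - \<tau>) * (p (y + \<tau> *\<^sub>R q) \<bullet> q)"
  have "(\<lambda>\<tau>. D (y + \<tau> *\<^sub>R q) q \<bullet> q) \<in> borel_measurable borel"
    by (rule measurable_compose[OF _ measurable_D]) measurable
  then have "(\<integral>\<^sup>+\<tau>. ennreal ((t - \<tau>) * (D (y + \<tau> *\<^sub>R q) q \<bullet> q)) * indicator {0..t} \<tau> \<partial>lborel) = ?F t - ?F 0"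
  proof (intro nn_integral_FTC_Icc)
    show "(?F has_real_derivative (t - x) * (D (y + x *\<^sub>R q) q \<bullet> q)) (at x)" for x
      by (rule derivative_eq_intros line_derivative1 line_derivative2 refl | simp)+
  qed (use assms D_nonneg in auto)
  then show ?thesis by (simp add: R_def diff_diff_eq)
qed

text \<open>By Tonelli and translation, the integral of the remainder over \<open>S\<close> becomes
  an average of the second derivative over translates of \<open>S\<close>, with weights
  \<open>t - \<tau>\<close> of total mass \<open>t\<^sup>2 / 2\<close>.\<close>

lemma integral_R:
  assumes t: "0 \<le> t" and [measurable]: "S \<in> sets borel"
  shows "(\<integral>\<^sup>+y. ennreal (R q t y) * indicator S y \<partial>lborel)
    = (\<integral>\<^sup>+\<tau>. ennreal (t - \<tau>) * indicator {0..t} \<tau> * N q ((+) (\<tau> *\<^sub>R q) ` S) \<partial>lborel)"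
proof -
  have [measurable]: "(\<lambda>x. D (fst x + snd x *\<^sub>R q) q \<bullet> q) \<in> borel_measurable (lborel \<Otimes>\<^sub>M lborel)"
    by (rule measurable_compose[OF _ measurable_D]) measurable
  have [measurable]: "(\<lambda>y. D (y + \<tau> *\<^sub>R q) q \<bullet> q) \<in> borel_measurable borel" for \<tau>
    by (rule measurable_compose[OF _ measurable_D]) measurable
  have "(\<integral>\<^sup>+y. ennreal (R q t y) * indicator S y \<partial>lborel)
    = (\<integral>\<^sup>+y. (\<integral>\<^sup>+\<tau>. ennreal ((t - \<tau>) * (D (y + \<tau> *\<^sub>R q) q \<bullet> q)) * indicator {0..t} \<tau> * indicator S y \<partial>lborel) \<partial>lborel)"
  proof (intro nn_integral_cong)
    fix y
    have [measurable]: "(\<lambda>\<tau>. D (y + \<tau> *\<^sub>R q) q \<bullet> q) \<in> borel_measurable borel"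
      by (rule measurable_compose[OF _ measurable_D]) measurable
    show "ennreal (R q t y) * indicator S y = (\<integral>\<^sup>+\<tau>. ennreal ((t - \<tau>) * (D (y + \<tau> *\<^sub>R q) q \<bullet> q)) * indicator {0..t} \<tau> * indicator S y \<partial>lborel)"
      unfolding R_eq_integral[OF t] by (subst nn_integral_multc) auto
  qed
  also have "\<dots> = (\<integral>\<^sup>+\<tau>. (\<integral>\<^sup>+y. ennreal ((t - \<tau>) * (D (y + \<tau> *\<^sub>R q) q \<bullet> q)) * indicator {0..t} \<tau> * indicator S y \<partial>lborel) \<partial>lborel)"
    by (rule lborel_pair.Fubini'[symmetric]) (simp add: split_beta')
  also have "\<dots> = (\<integral>\<^sup>+\<tau>. ennreal (t - \<tau>) * indicator {0..t} \<tau> * N q ((+) (\<tau> *\<^sub>R q) ` S) \<partial>lborel)"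
  proof (intro nn_integral_cong)
    fix \<tau> :: real
    have "(\<integral>\<^sup>+y. ennreal ((t - \<tau>) * (D (y + \<tau> *\<^sub>R q) q \<bullet> q)) * indicator {0..t} \<tau> * indicator S y \<partial>lborel)
      = (\<integral>\<^sup>+y. ennreal (t - \<tau>) * indicator {0..t} \<tau> * (ennreal (D (y + \<tau> *\<^sub>R q) q \<bullet> q) * indicator S y) \<partial>lborel)"
      by (intro nn_integral_cong) (auto simp: indicator_def ennreal_mult D_nonneg)
    also have "\<dots> = ennreal (t - \<tau>) * indicator {0..t} \<tau> * N q ((+) (\<tau> *\<^sub>R q) ` S)"
      by (subst nn_integral_cmult) (auto simp: N_translate)
    finally show "(\<integral>\<^sup>+y. ennreal ((t - \<tau>) * (D (y + \<tau> *\<^sub>R q) q \<bullet> q)) * indicator {0..t} \<tau> * indicator S y \<partial>lborel)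
      = ennreal (t - \<tau>) * indicator {0..t} \<tau> * N q ((+) (\<tau> *\<^sub>R q) ` S)" .
  qed
  finally show ?thesis .
qed

lemma integral_triangle:
  assumes "0 \<le> (t::real)"
  shows "(\<integral>\<^sup>+\<tau>. ennreal (t - \<tau>) * indicator {0..t} \<tau> \<partial>lborel) = ennreal (t\<^sup>2 / 2)"
proof -
  have "(\<integral>\<^sup>+\<tau>. ennreal (t - \<tau>) * indicator {0..t} \<tau> \<partial>lborel) = (t * t - t\<^sup>2 / 2) - (t * 0 - 0\<^sup>2 / 2)"
    by (rule nn_integral_FTC_Icc) (use assms in \<open>auto intro!: derivative_eq_intros\<close>)
  then show ?thesis by (simp add: power2_eq_square)
qed

text \<open>Every translate of the larger ball by \<open>\<tau> *\<^sub>R q\<close> with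
  \<open>\<tau>\<close> between 0 and 1 contains the given ball. Averaging over
  \<open>\<tau>\<close> therefore bounds half of \<open>N q (ball 0 r)\<close> by the integral of
  the continuous function \<open>R q 1\<close> over the larger ball.\<close>

lemma N_ball_finite: "N q (ball 0 r) < \<infinity>"
proof -
  let ?B = "ball (0::'a) (r + norm q)"
  have sub: "ball 0 r \<subseteq> (+) (\<tau> *\<^sub>R q) ` ?B" if "0 \<le> \<tau>" "\<tau> \<le> 1" for \<tau>
  proof
    fix z :: 'a assume "z \<in> ball 0 r"
    then have "norm (z - \<tau> *\<^sub>R q) < r + norm q"
      using norm_triangle_ineq4[of z "\<tau> *\<^sub>R q"] that mult_left_le_one_le[of "norm q" \<tau>] by simp
    then show "z \<in> (+) (\<tau> *\<^sub>R q) ` ?B" by (auto intro!: image_eqI[where x="z - \<tau> *\<^sub>R q"] simp: dist_norm norm_minus_commute)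
  qed
  have "ennreal (1 / 2) * N q (ball 0 r) = (\<integral>\<^sup>+\<tau>. ennreal (1 - \<tau>) * indicator {0..1} \<tau> * N q (ball 0 r) \<partial>lborel)"
    using integral_triangle[of 1] by (subst nn_integral_multc) auto
  also have "\<dots> \<le> (\<integral>\<^sup>+\<tau>. ennreal (1 - \<tau>) * indicator {0..1} \<tau> * N q ((+) (\<tau> *\<^sub>R q) ` ?B) \<partial>lborel)"
  proof (intro nn_integral_mono)
    fix \<tau> :: real
    show "ennreal (1 - \<tau>) * indicator {0..1} \<tau> * N q (ball 0 r) \<le> ennreal (1 - \<tau>) * indicator {0..1} \<tau> * N q ((+) (\<tau> *\<^sub>R q) ` ?B)"
      using N_mono[OF sub[of \<tau>], of q] by (cases "\<tau> \<in> {0..1}") (auto intro: mult_left_mono)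
  qed
  also have "\<dots> = (\<integral>\<^sup>+y. ennreal (R q 1 y) * indicator ?B y \<partial>lborel)"
    by (rule integral_R[symmetric]) auto
  also have "\<dots> < \<infinity>"
  proof -
    have "compact (R q 1 ` cball 0 (r + norm q))" by (intro compact_continuous_image continuous_R) auto
    then obtain B where B: "\<And>y. y \<in> cball 0 (r + norm q) \<Longrightarrow> norm (R q 1 y) \<le> B"
      by (meson bounded_iff compact_imp_bounded image_eqI)
    have "(\<integral>\<^sup>+y. ennreal (R q 1 y) * indicator ?B y \<partial>lborel) \<le> (\<integral>\<^sup>+y. ennreal B * indicator ?B y \<partial>lborel)"
    proof (intro nn_integral_mono)
      fix y
      show "ennreal (R q 1 y) * indicator ?B y \<le> ennreal B * indicator ?B y"
        using B[of y] by (auto simp: indicator_def intro!: ennreal_leI)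
    qed
    also have "\<dots> = ennreal B * emeasure lborel ?B" by (rule nn_integral_cmult_indicator) auto
    also have "\<dots> < \<infinity>" using emeasure_lborel_ball_finite[of "0::'a" "r + norm q"]
      by (simp add: ennreal_mult_less_top)
    finally show ?thesis .
  qed
  finally show ?thesis by (auto simp: ennreal_mult_less_top)
qed

text \<open>Scheffe's lemma. Pointwise convergence is \<open>R_limit\<close>. The norms do not
  exceed the norm of the limit asymptotically, because the translates of the ball stay in balls that
  shrink to the closed ball, and the sphere has measure zero.\<close>

lemma R_scaled_L1:
  fixes r :: real
  assumes t: "\<And>n. 0 < t n" "\<And>n. t n \<le> 1" "t \<longlonglongrightarrow> 0"
  defines "M \<equiv> restrict_space lborel (ball 0 r)"
  shows "\<And>n. integrable M (\<lambda>y. R q (t n) y / (t n)\<^sup>2)" "integrable M (\<lambda>y. D y q \<bullet> q / 2)"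
    "(\<lambda>n. \<integral>\<^sup>+y. norm (R q (t n) y / (t n)\<^sup>2 - D y q \<bullet> q / 2) \<partial>M) \<longlonglongrightarrow> 0"
proof -
  let ?B = "ball (0::'a) r"
  have [measurable]: "?B \<in> sets borel" by simp
  have nnM: "(\<integral>\<^sup>+y. f y \<partial>M) = (\<integral>\<^sup>+y. f y * indicator ?B y \<partial>lborel)" if "f \<in> borel_measurable borel" for f :: "'a \<Rightarrow> ennreal"
    unfolding M_def by (rule nn_integral_restrict_space) auto
  have mM: "f \<in> borel_measurable M" if "f \<in> borel_measurable borel" for f :: "'a \<Rightarrow> real"
    unfolding M_def using that by (simp add: measurable_restrict_space1)
  have Dfin: "(\<integral>\<^sup>+y. norm (D y q \<bullet> q / 2) \<partial>M) = ennreal (1/2) * N q ?B"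
  proof -
    have "(\<integral>\<^sup>+y. norm (D y q \<bullet> q / 2) \<partial>M) = (\<integral>\<^sup>+y. ennreal (1/2) * (ennreal (D y q \<bullet> q) * indicator ?B y) \<partial>lborel)"
    proof -
      have "(\<integral>\<^sup>+y. norm (D y q \<bullet> q / 2) \<partial>M) = (\<integral>\<^sup>+y. ennreal (norm (D y q \<bullet> q / 2)) * indicator ?B y \<partial>lborel)"
        by (rule nnM) measurable
      also have "\<dots> = (\<integral>\<^sup>+y. ennreal (1/2) * (ennreal (D y q \<bullet> q) * indicator ?B y) \<partial>lborel)"
      proof (intro nn_integral_cong)
        fix y
        have "ennreal (norm (D y q \<bullet> q / 2)) = ennreal (1/2) * ennreal (D y q \<bullet> q)"
          by (subst ennreal_mult'[symmetric]) (auto simp: D_nonneg)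
        then show "ennreal (norm (D y q \<bullet> q / 2)) * indicator ?B y = ennreal (1/2) * (ennreal (D y q \<bullet> q) * indicator ?B y)"
          by (simp only: mult.assoc)
      qed
      finally show ?thesis .
    qed
    also have "\<dots> = ennreal (1/2) * N q ?B" unfolding N_def by (rule nn_integral_cmult[OF measurable_N]) auto
    finally show ?thesis .
  qed
  have half_N: "ennreal (1/2) * N q (ball 0 r') < \<infinity>" for r'
    unfolding infinity_ennreal_def ennreal_mult_less_top
    using N_ball_finite[of q r'] ennreal_less_top[of "1/2"] by simp
  show iD: "integrable M (\<lambda>y. D y q \<bullet> q / 2)"
  proof (rule integrableI_bounded)
    show "(\<lambda>y. D y q \<bullet> q / 2) \<in> borel_measurable M"
      by (intro mM borel_measurable_divide measurable_D) auto
    show "(\<integral>\<^sup>+y. norm (D y q \<bullet> q / 2) \<partial>M) < \<infinity>"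
      unfolding Dfin by (rule half_N)
  qed
  have RN: "(\<integral>\<^sup>+y. norm (R q s y / s\<^sup>2) \<partial>M) \<le> ennreal (1/2) * N q (ball 0 (r + s * norm q))" if s: "0 < s" for s
  proof -
    have "(\<integral>\<^sup>+y. norm (R q s y / s\<^sup>2) \<partial>M) = (\<integral>\<^sup>+y. ennreal (1 / s\<^sup>2) * (ennreal (R q s y) * indicator ?B y) \<partial>lborel)"
    proof -
      have "(\<integral>\<^sup>+y. norm (R q s y / s\<^sup>2) \<partial>M) = (\<integral>\<^sup>+y. ennreal (norm (R q s y / s\<^sup>2)) * indicator ?B y \<partial>lborel)"
        by (rule nnM) measurable
      also have "\<dots> = (\<integral>\<^sup>+y. ennreal (1 / s\<^sup>2) * (ennreal (R q s y) * indicator ?B y) \<partial>lborel)"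
      proof (intro nn_integral_cong)
        fix y
        have "ennreal (norm (R q s y / s\<^sup>2)) = ennreal (1 / s\<^sup>2) * ennreal (R q s y)"
          by (subst ennreal_mult'[symmetric]) (auto simp: R_nonneg)
        then show "ennreal (norm (R q s y / s\<^sup>2)) * indicator ?B y = ennreal (1 / s\<^sup>2) * (ennreal (R q s y) * indicator ?B y)"
          by (simp only: mult.assoc)
      qed
      finally show ?thesis .
    qed
    also have "\<dots> = ennreal (1 / s\<^sup>2) * (\<integral>\<^sup>+y. ennreal (R q s y) * indicator ?B y \<partial>lborel)"
      by (rule nn_integral_cmult) measurable
    finally have norm_eq: "(\<integral>\<^sup>+y. norm (R q s y / s\<^sup>2) \<partial>M) = ennreal (1 / s\<^sup>2) * (\<integral>\<^sup>+y. ennreal (R q s y) * indicator ?B y \<partial>lborel)" .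
    have "(\<integral>\<^sup>+y. ennreal (R q s y) * indicator ?B y \<partial>lborel)
      = (\<integral>\<^sup>+\<tau>. ennreal (s - \<tau>) * indicator {0..s} \<tau> * N q ((+) (\<tau> *\<^sub>R q) ` ?B) \<partial>lborel)"
      using s by (intro integral_R) auto
    also have "\<dots> \<le> (\<integral>\<^sup>+\<tau>. ennreal (s - \<tau>) * indicator {0..s} \<tau> * N q (ball 0 (r + s * norm q)) \<partial>lborel)"
    proof (intro nn_integral_mono)
      fix \<tau> :: real
      show "ennreal (s - \<tau>) * indicator {0..s} \<tau> * N q ((+) (\<tau> *\<^sub>R q) ` ?B) \<le> ennreal (s - \<tau>) * indicator {0..s} \<tau> * N q (ball 0 (r + s * norm q))"
      proof (cases "\<tau> \<in> {0..s}")
        case True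
        have "(+) (\<tau> *\<^sub>R q) ` ?B \<subseteq> ball 0 (r + s * norm q)"
        proof
          fix z assume "z \<in> (+) (\<tau> *\<^sub>R q) ` ?B"
          then obtain y where y: "z = \<tau> *\<^sub>R q + y" "y \<in> ?B" by (rule imageE)
          then have "norm y < r" by simp
          have "norm z \<le> \<tau> * norm q + norm y" using norm_triangle_ineq[of "\<tau> *\<^sub>R q" y] True y by simp
          also have "\<dots> < s * norm q + r" using \<open>norm y < r\<close> True by (intro add_le_less_mono mult_right_mono) auto
          finally show "z \<in> ball 0 (r + s * norm q)" by simp
        qed
        then show ?thesis by (intro mult_left_mono N_mono) auto
      qed simp
    qed
    also have "\<dots> = ennreal (s\<^sup>2 / 2) * N q (ball 0 (r + s * norm q))"
      using integral_triangle[of s] s by (subst nn_integral_multc) auto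
    finally have Rle: "(\<integral>\<^sup>+y. ennreal (R q s y) * indicator ?B y \<partial>lborel) \<le> ennreal (s\<^sup>2 / 2) * N q (ball 0 (r + s * norm q))" .
    have "(\<integral>\<^sup>+y. norm (R q s y / s\<^sup>2) \<partial>M) \<le> ennreal (1 / s\<^sup>2) * (ennreal (s\<^sup>2 / 2) * N q (ball 0 (r + s * norm q)))"
      unfolding norm_eq by (intro mult_left_mono Rle) simp
    also have "\<dots> = ennreal (1 / s\<^sup>2) * ennreal (s\<^sup>2 / 2) * N q (ball 0 (r + s * norm q))"
      by (rule mult.assoc[symmetric])
    also have "ennreal (1 / s\<^sup>2) * ennreal (s\<^sup>2 / 2) = ennreal (1/2)"
      using s by (subst ennreal_mult'[symmetric]) auto
    finally show ?thesis .
  qed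
  show iR: "integrable M (\<lambda>y. R q (t n) y / (t n)\<^sup>2)" for n
  proof (rule integrableI_bounded)
    show "(\<lambda>y. R q (t n) y / (t n)\<^sup>2) \<in> borel_measurable M"
      by (intro mM borel_measurable_divide measurable_R) auto
    show "(\<integral>\<^sup>+y. norm (R q (t n) y / (t n)\<^sup>2) \<partial>M) < \<infinity>"
      using RN[OF t(1)[of n]] half_N by (rule order.strict_trans1)
  qed
  have Nlim: "(\<lambda>n. N q (ball 0 (r + t n * norm q))) \<longlonglongrightarrow> N q (cball 0 r)"
    unfolding N_def
  proof (rule nn_integral_dominated_convergence[where w="\<lambda>z. ennreal (D z q \<bullet> q) * indicator (ball 0 (r + 1 * norm q)) z"])
    show "(\<integral>\<^sup>+z. ennreal (D z q \<bullet> q) * indicator (ball 0 (r + 1 * norm q)) z \<partial>lborel) < \<infinity>"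
      using N_ball_finite by (simp add: N_def)
    have le: "t n * norm q \<le> 1 * norm q" for n using t by (intro mult_right_mono) auto
    show "AE z in lborel. ennreal (D z q \<bullet> q) * indicator (ball 0 (r + t n * norm q)) z \<le> ennreal (D z q \<bullet> q) * indicator (ball 0 (r + 1 * norm q)) z" for n
      using le[of n] by (intro AE_I2 mult_left_mono) (auto simp: indicator_def)
    show "AE z in lborel. (\<lambda>n. ennreal (D z q \<bullet> q) * indicator (ball 0 (r + t n * norm q)) z) \<longlonglongrightarrow> ennreal (D z q \<bullet> q) * indicator (cball 0 r) z"
    proof (cases "q = 0")
      \<comment> \<open>For \<open>q = 0\<close> the open balls do not grow, so they never cover the
        sphere; but then the density vanishes.\<close>
      case True then show ?thesis using linear_0[OF linear_D] by simp
    next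
      case False
      show ?thesis
      proof (intro AE_I2 tendsto_eventually)
        fix z :: 'a
        have l: "(\<lambda>n. r + t n * norm q) \<longlonglongrightarrow> r + 0 * norm q" by (intro tendsto_intros t)
        have "eventually (\<lambda>n. z \<in> ball 0 (r + t n * norm q) \<longleftrightarrow> z \<in> cball 0 r) sequentially"
        proof (cases "norm z \<le> r")
          case True
          have "norm z < r + t n * norm q" for n using True t(1)[of n] False by (intro order.strict_trans1[OF True]) simp
          then show ?thesis using True by simp
        next
          case False
          then have "eventually (\<lambda>n. r + t n * norm q < norm z) sequentially" using order_tendstoD(2)[OF l] by simp
          then show ?thesis by eventually_elim (use False in auto)
        qed
        then show "eventually (\<lambda>n. ennreal (D z q \<bullet> q) * indicator (ball 0 (r + t n * norm q)) z = ennreal (D z q \<bullet> q) * indicator (cball 0 r) z) sequentially"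
          by eventually_elim (simp add: indicator_def)
      qed
    qed
  qed (intro measurable_N, simp)+
  have Nball: "N q (cball 0 r) = N q ?B"
    unfolding N_def
  proof (rule nn_integral_cong_AE)
    have "negligible (sphere (0::'a) r)" by (rule negligible_sphere)
    then have "sphere (0::'a) r \<in> null_sets lborel" by (simp add: negligible_iff_null_sets null_sets_def)
    then have "AE z in lborel. z \<notin> sphere (0::'a) r" by (rule AE_not_in)
    then show "AE z in lborel. ennreal (D z q \<bullet> q) * indicator (cball 0 r) z = ennreal (D z q \<bullet> q) * indicator ?B z"
      by eventually_elim (auto simp: indicator_def)
  qed
  show "(\<lambda>n. \<integral>\<^sup>+y. norm (R q (t n) y / (t n)\<^sup>2 - D y q \<bullet> q / 2) \<partial>M) \<longlonglongrightarrow> 0"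
  proof (rule Scheffe_lemma1[OF iR iD])
    show "AE y in M. (\<lambda>n. R q (t n) y / (t n)\<^sup>2) \<longlonglongrightarrow> D y q \<bullet> q / 2"
      by (intro AE_I2 R_limit t)
    have "limsup (\<lambda>n. \<integral>\<^sup>+y. norm (R q (t n) y / (t n)\<^sup>2) \<partial>M) \<le> limsup (\<lambda>n. ennreal (1/2) * N q (ball 0 (r + t n * norm q)))"
      by (intro Limsup_mono always_eventually allI RN t)
    also have "\<dots> = ennreal (1/2) * N q (cball 0 r)"
    proof (rule lim_imp_Limsup)
      show "(\<lambda>n. ennreal (1/2) * N q (ball 0 (r + t n * norm q))) \<longlonglongrightarrow> ennreal (1/2) * N q (cball 0 r)"
        by (rule ennreal_tendsto_cmult[OF ennreal_less_top Nlim])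
    qed simp
    finally show "limsup (\<lambda>n. \<integral>\<^sup>+y. norm (R q (t n) y / (t n)\<^sup>2) \<partial>M) \<le> (\<integral>\<^sup>+y. norm (D y q \<bullet> q / 2) \<partial>M)"
      unfolding Dfin Nball .
  qed
qed

end

section \<open>The inequality on balls\<close>

text \<open>The two infima run over independent arguments and are taken one after the other. It is
  meant for the convexity of the infimal convolution.\<close>

lemma le_INF_combination:
  fixes f g :: "'b \<Rightarrow> real"
  assumes "A \<noteq> {}" "0 < u" "0 < v" "\<And>a b. a \<in> A \<Longrightarrow> b \<in> A \<Longrightarrow> c \<le> u * f a + v * g b"
  shows "c \<le> u * (INF a\<in>A. f a) + v * (INF a\<in>A. g a)"
proof -
  have 1: "(c - v * g b) / u \<le> (INF a\<in>A. f a)" if "b \<in> A" for b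
    using assms that by (intro cINF_greatest) (auto simp: pos_divide_le_eq mult.commute diff_le_eq)
  have "(c - u * (INF a\<in>A. f a)) / v \<le> (INF a\<in>A. g a)"
    using assms 1 by (intro cINF_greatest) (auto simp: pos_divide_le_eq mult.commute diff_le_eq add.commute)
  then show ?thesis using assms by (simp add: pos_divide_le_eq mult.commute diff_le_eq add.commute)
qed

locale convex_pair = convex_twice_differentiable \<phi> p D
  for \<phi> :: "'a::euclidean_space \<Rightarrow> real" and p D +
  fixes V :: "'a \<Rightarrow> real"
  assumes conv_V: "convex_on UNIV V" and V_nonneg: "\<And>x. 0 \<le> V x" and \<phi>_pos: "\<And>x. 0 < \<phi> x"
begin

definition W :: "'a \<Rightarrow> real" where "W y = V (p y)"

text \<open>Slopes and intercepts of affine minorants of \<open>V\<close>. For a slope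
  \<open>q\<close> the admissible intercepts reach up to minus the convex conjugate of
  \<open>V\<close> at \<open>q\<close>, so the conjugate itself, which may be infinite, is never
  formed. The bound \<open>L\<close> keeps the points \<open>y + t *\<^sub>R q\<close> in a bounded
  set.\<close>

definition Aff :: "real \<Rightarrow> ('a \<times> real) set" where
  "Aff L = {(q, a). norm q \<le> L \<and> (\<forall>x. a + q \<bullet> x \<le> V x)}"

text \<open>With \<open>V\<close> the supremum of the affine functions \<open>a + q \<bullet> x\<close>, these are the supremal and infimal
  convolutions of \<open>\<phi>\<close> with the conjugate of \<open>V\<close>; they play the roles of \<open>\<phi> + t W\<close> and \<open>\<phi> - t W\<close>.\<close>

definition up :: "real \<Rightarrow> real \<Rightarrow> 'a \<Rightarrow> real" where
  "up L t y = (SUP (q, a)\<in>Aff L. \<phi> (y + t *\<^sub>R q) + t * a)"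

definition down :: "real \<Rightarrow> real \<Rightarrow> 'a \<Rightarrow> real" where
  "down L t y = (INF (q, a)\<in>Aff L. \<phi> (y - t *\<^sub>R q) - t * a)"

lemma continuous_V: "continuous_on S V"
  using convex_on_continuous[OF open_UNIV conv_V] continuous_on_subset by blast

lemma continuous_W: "continuous_on S W"
  unfolding W_def by (intro continuous_on_compose2[OF continuous_V[of UNIV]] continuous_p) auto

lemma W_nonneg: "0 \<le> W y" by (simp add: W_def V_nonneg)

lemma zero_Aff: "0 \<le> L \<Longrightarrow> (0, 0) \<in> Aff L" by (simp add: Aff_def V_nonneg)

lemma Aff_le: "(q, a) \<in> Aff L \<Longrightarrow> a \<le> V 0"
  unfolding Aff_def by (auto dest: spec[of _ 0])

lemma bounded_\<phi>: obtains B where "\<And>x. norm x \<le> r \<Longrightarrow> \<phi> x \<le> B"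
proof -
  have "compact (\<phi> ` cball 0 r)" by (intro compact_continuous_image continuous_\<phi>) auto
  then have "bounded (\<phi> ` cball 0 r)" by (rule compact_imp_bounded)
  then obtain B where B: "\<forall>x\<in>cball 0 r. norm (\<phi> x) \<le> B" unfolding bounded_iff by auto
  show ?thesis
  proof (rule that[of B])
    fix x :: 'a assume "norm x \<le> r"
    then have "norm (\<phi> x) \<le> B" using B by simp
    then show "\<phi> x \<le> B" by simp
  qed
qed

lemma \<phi>_lower: obtains c where "0 < c" "\<And>x. norm x \<le> r \<Longrightarrow> c \<le> \<phi> x"
proof (cases "cball (0::'a) r = {}")
  case True then show ?thesis using that[of 1] by (metis cball_empty empty_iff mem_cball_0 zero_less_one)
next
  case False
  then obtain x where "x \<in> cball 0 r" "\<forall>y\<in>cball 0 r. \<phi> x \<le> \<phi> y"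
    using continuous_attains_inf[OF compact_cball False continuous_\<phi>] by metis
  then show ?thesis using that[of "\<phi> x"] \<phi>_pos by auto
qed

section \<open>Bounds and convexity of the two convolutions\<close>

lemma bdd_up:
  assumes "0 \<le> t" shows "bdd_above ((\<lambda>(q, a). \<phi> (y + t *\<^sub>R q) + t * a) ` Aff L)"
proof -
  obtain B where B: "\<And>x. norm x \<le> norm y + t * L \<Longrightarrow> \<phi> x \<le> B" using bounded_\<phi> by blast
  have "\<phi> (y + t *\<^sub>R q) + t * a \<le> B + t * V 0" if "(q, a) \<in> Aff L" for q a
  proof (intro add_mono mult_left_mono B)
    have "norm (y + t *\<^sub>R q) \<le> norm y + t * norm q" using norm_triangle_ineq[of y "t *\<^sub>R q"] assms by simp
    also have "\<dots> \<le> norm y + t * L" using that assms by (intro add_left_mono mult_left_mono) (auto simp: Aff_def)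
    finally show "norm (y + t *\<^sub>R q) \<le> norm y + t * L" .
  qed (use assms Aff_le[OF that] in auto)
  then show ?thesis by (intro bdd_aboveI2[where M="B + t * V 0"]) auto
qed

lemma bdd_down:
  assumes "0 \<le> t" shows "bdd_below ((\<lambda>(q, a). \<phi> (y - t *\<^sub>R q) - t * a) ` Aff L)"
proof (rule bdd_belowI2[where m="- t * V 0"])
  fix x assume "x \<in> Aff L"
  then obtain q a where x: "x = (q, a)" "(q, a) \<in> Aff L" by (cases x) auto
  have "t * a \<le> t * V 0" using Aff_le[OF x(2)] assms by (rule mult_left_mono)
  then show "- t * V 0 \<le> (case x of (q, a) \<Rightarrow> \<phi> (y - t *\<^sub>R q) - t * a)"
    using \<phi>_pos[of "y - t *\<^sub>R q"] x by simp
qed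

lemma up_ge: "0 \<le> t \<Longrightarrow> (q, a) \<in> Aff L \<Longrightarrow> \<phi> (y + t *\<^sub>R q) + t * a \<le> up L t y"
  unfolding up_def using cSUP_upper[OF _ bdd_up, of "(q, a)" L t y] by simp

lemma down_le: "0 \<le> t \<Longrightarrow> (q, a) \<in> Aff L \<Longrightarrow> down L t y \<le> \<phi> (y - t *\<^sub>R q) - t * a"
  unfolding down_def using cINF_lower[OF bdd_down, of t "(q, a)" L y] by simp

lemma up_least:
  assumes "0 \<le> L" "\<And>q a. (q, a) \<in> Aff L \<Longrightarrow> \<phi> (y + t *\<^sub>R q) + t * a \<le> c" shows "up L t y \<le> c"
  unfolding up_def using zero_Aff[OF assms(1)] assms(2) by (intro cSUP_least) auto

lemma down_greatest:
  assumes "0 \<le> L" "\<And>q a. (q, a) \<in> Aff L \<Longrightarrow> c \<le> \<phi> (y - t *\<^sub>R q) - t * a" shows "c \<le> down L t y"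
  unfolding down_def using zero_Aff[OF assms(1)] assms(2) by (intro cINF_greatest) auto

lemma convex_up:
  assumes L: "0 \<le> L" and t: "0 \<le> t" shows "convex_on UNIV (up L t)"
proof (rule convex_onI)
  fix s :: real and x y :: 'a assume s: "0 < s" "s < 1"
  show "up L t ((1 - s) *\<^sub>R x + s *\<^sub>R y) \<le> (1 - s) * up L t x + s * up L t y"
  proof (rule up_least[OF L])
    fix q a assume qa: "(q, a) \<in> Aff L"
    have "(1 - s) *\<^sub>R x + s *\<^sub>R y + t *\<^sub>R q = (1 - s) *\<^sub>R (x + t *\<^sub>R q) + s *\<^sub>R (y + t *\<^sub>R q)"
      by (simp add: algebra_simps)
    then have "\<phi> ((1 - s) *\<^sub>R x + s *\<^sub>R y + t *\<^sub>R q) + t * a \<le> ((1 - s) * \<phi> (x + t *\<^sub>R q) + s * \<phi> (y + t *\<^sub>R q)) + t * a"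
      using convex_onD[OF conv, of s "x + t *\<^sub>R q" "y + t *\<^sub>R q"] s by simp
    also have "\<dots> = (1 - s) * (\<phi> (x + t *\<^sub>R q) + t * a) + s * (\<phi> (y + t *\<^sub>R q) + t * a)"
      by (simp add: algebra_simps)
    also have "\<dots> \<le> (1 - s) * up L t x + s * up L t y"
      using s by (intro add_mono mult_left_mono up_ge t qa) auto
    finally show "\<phi> ((1 - s) *\<^sub>R x + s *\<^sub>R y + t *\<^sub>R q) + t * a \<le> (1 - s) * up L t x + s * up L t y" .
  qed
qed simp

lemma convex_Aff:
  assumes "(q, a) \<in> Aff L" "(q', a') \<in> Aff L" "0 < s" "s < 1"
  shows "((1 - s) *\<^sub>R q + s *\<^sub>R q', (1 - s) * a + s * a') \<in> Aff L"
  unfolding Aff_def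
proof (clarsimp, intro conjI allI)
  have "norm ((1 - s) *\<^sub>R q + s *\<^sub>R q') \<le> (1 - s) * norm q + s * norm q'"
    using norm_triangle_ineq[of "(1 - s) *\<^sub>R q" "s *\<^sub>R q'"] assms by simp
  also have "\<dots> \<le> (1 - s) * L + s * L"
    using assms by (intro add_mono mult_left_mono) (auto simp: Aff_def)
  finally show "norm ((1 - s) *\<^sub>R q + s *\<^sub>R q') \<le> L" by (simp add: algebra_simps)
  fix x
  have "(1 - s) * a + s * a' + ((1 - s) *\<^sub>R q + s *\<^sub>R q') \<bullet> x = (1 - s) * (a + q \<bullet> x) + s * (a' + q' \<bullet> x)"
    by (simp add: algebra_simps inner_simps)
  also have "\<dots> \<le> (1 - s) * V x + s * V x"
    using assms by (intro add_mono mult_left_mono) (auto simp: Aff_def)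
  finally show "(1 - s) * a + s * a' + ((1 - s) *\<^sub>R q + s *\<^sub>R q') \<bullet> x \<le> V x" by (simp add: algebra_simps)
qed

text \<open>The infimum preserves convexity here because
  \<open>\<phi> (y - t *\<^sub>R q) - t * a\<close> is jointly convex in \<open>y\<close>,
  \<open>q\<close> and \<open>a\<close>, and \<open>Aff L\<close> is a convex set.\<close>

lemma convex_down:
  assumes L: "0 \<le> L" and t: "0 \<le> t" shows "convex_on UNIV (down L t)"
proof (rule convex_onI)
  fix s :: real and x y :: 'a assume s: "0 < s" "s < 1"
  let ?f = "\<lambda>y (q, a). \<phi> (y - t *\<^sub>R q) - t * a"
  have "down L t ((1 - s) *\<^sub>R x + s *\<^sub>R y) \<le> (1 - s) * (INF \<alpha>\<in>Aff L. ?f x \<alpha>) + s * (INF \<alpha>\<in>Aff L. ?f y \<alpha>)"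
  proof (rule le_INF_combination)
    fix \<alpha> \<alpha>' assume "\<alpha> \<in> Aff L" "\<alpha>' \<in> Aff L"
    then obtain q a q' a' where qa: "\<alpha> = (q, a)" "\<alpha>' = (q', a')" "(q, a) \<in> Aff L" "(q', a') \<in> Aff L"
      by (cases \<alpha>; cases \<alpha>') auto
    let ?q = "(1 - s) *\<^sub>R q + s *\<^sub>R q'" and ?a = "(1 - s) * a + s * a'"
    have "down L t ((1 - s) *\<^sub>R x + s *\<^sub>R y) \<le> \<phi> ((1 - s) *\<^sub>R x + s *\<^sub>R y - t *\<^sub>R ?q) - t * ?a"
      by (rule down_le[OF t convex_Aff[OF qa(3,4) s]])
    also have "(1 - s) *\<^sub>R x + s *\<^sub>R y - t *\<^sub>R ?q = (1 - s) *\<^sub>R (x - t *\<^sub>R q) + s *\<^sub>R (y - t *\<^sub>R q')"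
      by (simp add: algebra_simps)
    also have "\<phi> ((1 - s) *\<^sub>R (x - t *\<^sub>R q) + s *\<^sub>R (y - t *\<^sub>R q')) \<le> (1 - s) * \<phi> (x - t *\<^sub>R q) + s * \<phi> (y - t *\<^sub>R q')"
      using convex_onD[OF conv, of s "x - t *\<^sub>R q" "y - t *\<^sub>R q'"] s by simp
    finally show "down L t ((1 - s) *\<^sub>R x + s *\<^sub>R y) \<le> (1 - s) * ?f x \<alpha> + s * ?f y \<alpha>'"
      by (simp add: qa(1,2) algebra_simps)
  qed (use s zero_Aff[OF L] in auto)
  then show "down L t ((1 - s) *\<^sub>R x + s *\<^sub>R y) \<le> (1 - s) * down L t x + s * down L t y"
    by (simp only: down_def)
qed simp

text \<open>With the same pair \<open>(q, a)\<close> in both functions, the opposite shifts of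
  \<open>x\<close> and \<open>y\<close> leave the midpoint unchanged and the intercepts
  cancel.\<close>

lemma midpoint_up_down:
  assumes L: "0 \<le> L" and t: "0 \<le> t"
  shows "\<phi> ((1/2) *\<^sub>R x + (1/2) *\<^sub>R y) \<le> (up L t x + down L t y) / 2"
proof -
  have "2 * \<phi> ((1/2) *\<^sub>R x + (1/2) *\<^sub>R y) - up L t x \<le> down L t y"
  proof (rule down_greatest[OF L])
    fix q a assume qa: "(q, a) \<in> Aff L"
    have "(1/2) *\<^sub>R x + (1/2) *\<^sub>R y = (1 - 1/2) *\<^sub>R (x + t *\<^sub>R q) + (1/2) *\<^sub>R (y - t *\<^sub>R q)"
      by (simp add: algebra_simps)
    then have "\<phi> ((1/2) *\<^sub>R x + (1/2) *\<^sub>R y) \<le> (1 - 1/2) * \<phi> (x + t *\<^sub>R q) + (1/2) * \<phi> (y - t *\<^sub>R q)"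
      using convex_onD[OF conv, of "1/2" "x + t *\<^sub>R q" "y - t *\<^sub>R q"] by simp
    then show "2 * \<phi> ((1/2) *\<^sub>R x + (1/2) *\<^sub>R y) - up L t x \<le> \<phi> (y - t *\<^sub>R q) - t * a"
      using up_ge[OF t qa, of x] by simp
  qed
  then show ?thesis by simp
qed

lemma up_ge_\<phi>: "0 \<le> L \<Longrightarrow> 0 \<le> t \<Longrightarrow> \<phi> y \<le> up L t y"
  using up_ge[OF _ zero_Aff, of t L y] by simp

lemma expand_up: "\<phi> (y + t *\<^sub>R q) + t * a = \<phi> y + t * (a + q \<bullet> p y) + R q t y"
  by (simp add: R_def algebra_simps inner_commute)

lemma Aff_le_W: "(q, a) \<in> Aff L \<Longrightarrow> a + q \<bullet> p y \<le> W y"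
  by (auto simp: Aff_def W_def)

section \<open>Control of the remainder over all slopes\<close>

lemma R_convex: "convex_on S (\<lambda>q. R q t y)" if "convex S"
proof (rule convex_onI)
  fix s :: real and q q' assume s: "0 < s" "s < 1"
  have "y + t *\<^sub>R ((1 - s) *\<^sub>R q + s *\<^sub>R q') = (1 - s) *\<^sub>R (y + t *\<^sub>R q) + s *\<^sub>R (y + t *\<^sub>R q')"
    by (simp add: algebra_simps)
  then have "\<phi> (y + t *\<^sub>R ((1 - s) *\<^sub>R q + s *\<^sub>R q')) \<le> (1 - s) * \<phi> (y + t *\<^sub>R q) + s * \<phi> (y + t *\<^sub>R q')"
    using convex_onD[OF conv, of s "y + t *\<^sub>R q" "y + t *\<^sub>R q'"] s by simp
  then show "R ((1 - s) *\<^sub>R q + s *\<^sub>R q') t y \<le> (1 - s) * R q t y + s * R q' t y"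
    by (simp add: R_def inner_simps algebra_simps)
qed (rule that)

text \<open>On a polytope a convex function of the slope is at most its largest vertex value, and
  nonnegativity replaces the maximum by a sum, whose terms converge in \<open>L\<^sup>1\<close> one
  by one.\<close>

lemma R_le_sum:
  assumes S: "finite S" "cball 0 L \<subseteq> convex hull S" and q: "norm q \<le> L"
  shows "R q t y \<le> (\<Sum>v\<in>S. R v t y)"
proof -
  have "\<forall>q\<in>convex hull S. R q t y \<le> (\<Sum>v\<in>S. R v t y)"
    using S(1) by (intro convex_on_convex_hull_bound R_convex ballI member_le_sum R_nonneg) auto
  then show ?thesis using S(2) q by (simp add: subset_iff)
qed

lemma up_le:
  assumes L: "0 \<le> L" and t: "0 \<le> t" and S: "finite S" "cball 0 L \<subseteq> convex hull S"
  shows "up L t y \<le> \<phi> y + t * W y + (\<Sum>v\<in>S. R v t y)"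
proof (rule up_least[OF L])
  fix q a assume qa: "(q, a) \<in> Aff L"
  have "t * (a + q \<bullet> p y) \<le> t * W y" using Aff_le_W[OF qa] t by (rule mult_left_mono)
  then show "\<phi> (y + t *\<^sub>R q) + t * a \<le> \<phi> y + t * W y + (\<Sum>v\<in>S. R v t y)"
    unfolding expand_up using R_le_sum[OF S, of q t y] qa by (simp add: Aff_def)
qed

text \<open>The tangent to \<open>V\<close> at \<open>p y\<close> is the affine minorant that
  attains \<open>W y\<close> there, hence the right competitor for the infimal convolution at
  \<open>y\<close>.\<close>

lemma tangent_Aff:
  assumes "(V has_derivative (\<lambda>h. q \<bullet> h)) (at (p y))" "norm q \<le> L"
  shows "(q, W y - q \<bullet> p y) \<in> Aff L"
proof -
  have "W y - q \<bullet> p y + q \<bullet> x \<le> V x" for x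
    using convex_above_tangent[OF conv_V assms(1), of "x - p y"] by (simp add: W_def inner_simps)
  then show ?thesis using assms(2) by (simp add: Aff_def)
qed

lemma down_le_tangent:
  assumes "(V has_derivative (\<lambda>h. q \<bullet> h)) (at (p y))" "norm q \<le> L" "0 \<le> t"
  shows "down L t y \<le> \<phi> y - t * W y + R (- q) t y"
  using down_le[OF assms(3) tangent_Aff[OF assms(1,2)], of y] by (simp add: R_def algebra_simps inner_commute)

text \<open>Two kinds of slopes compete in the supremum. For \<open>q\<close> near \<open>q0\<close>
  the second-order expansion applies, and the quadratic form is close to its value at
  \<open>q0\<close>. For the others, differentiability of \<open>V\<close> leaves a fixed gap
  between \<open>a + q \<bullet> p y\<close> and \<open>W y\<close>; multiplied by
  \<open>t n\<close> it outweighs the remainder, which is of order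
  \<open>(t n)\<^sup>2\<close>.\<close>

lemma up_limit:
  fixes S :: "'a set"
  assumes dV: "(V has_derivative (\<lambda>h. q0 \<bullet> h)) (at (p y))" and L: "0 \<le> L"
    and S: "finite S" "cball 0 L \<subseteq> convex hull S"
    and t: "\<And>n. 0 < t n" "t \<longlonglongrightarrow> 0" and e: "0 < e"
  shows "eventually (\<lambda>n. up L (t n) y \<le> \<phi> y + t n * W y + (t n)\<^sup>2 * (D y q0 \<bullet> q0 / 2 + e)) sequentially"
proof -
  have blD: "bounded_linear (D y)" using deriv2 has_derivative_bounded_linear by blast
  have "isCont (\<lambda>q. D y q \<bullet> q / 2) q0"
    by (intro continuous_intros bounded_linear.isCont[OF blD]) simp
  then have "\<exists>\<eta>>0. \<forall>q. norm (q - q0) < \<eta> \<longrightarrow> norm (D y q \<bullet> q / 2 - D y q0 \<bullet> q0 / 2) < e / 3"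
    using e unfolding isCont_def LIM_eq by (metis diff_self norm_zero zero_less_divide_iff zero_less_numeral)
  then obtain \<eta> where \<eta>0: "0 < \<eta>" "\<forall>q. norm (q - q0) < \<eta> \<longrightarrow> norm (D y q \<bullet> q / 2 - D y q0 \<bullet> q0 / 2) < e / 3"
    by blast
  have "D y q \<bullet> q / 2 \<le> D y q0 \<bullet> q0 / 2 + e / 3" if "norm (q - q0) < \<eta>" for q
    using \<eta>0(2)[rule_format, OF that] unfolding real_norm_def by linarith
  note \<eta> = \<eta>0(1) this
  define G where "G = L\<^sup>2 + 1"
  have G: "0 < G" by (simp add: G_def add_nonneg_pos)
  define e' where "e' = e / (3 * G)"
  have e': "0 < e'" using e G by (simp add: e'_def)
  have e'L: "e' * L\<^sup>2 \<le> e / 3"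
  proof -
    have "e' * L\<^sup>2 \<le> e' * G" using e' by (intro mult_left_mono) (auto simp: G_def)
    also have "\<dots> = e / 3" using G by (simp add: e'_def)
    finally show ?thesis .
  qed
  obtain d where d: "0 < d" "\<And>h. norm h < d \<Longrightarrow> \<bar>\<phi> (y + h) - \<phi> y - p y \<bullet> h - D y h \<bullet> h / 2\<bar> \<le> e' * (norm h)\<^sup>2"
    using second_order[OF e'] by metis
  obtain r0 where r0: "0 < r0" "\<And>z. norm (z - p y) < r0 \<Longrightarrow> norm (V z - V (p y) - q0 \<bullet> (z - p y)) \<le> (\<eta> / 2) * norm (z - p y)"
    using dV \<eta>(1) unfolding has_derivative_at_alt by (metis half_gt_zero)
  define r where "r = r0 / 2"
  have r: "0 < r" "r < r0" using r0 by (auto simp: r_def)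
  \<comment> \<open>The minorant is tested at distance \<open>r\<close> from \<open>p y\<close> in
    the direction of \<open>q - q0\<close>. Without the gap it would overtake the first-order
    expansion of \<open>V\<close> there.\<close>
  have gap: "a + q \<bullet> p y \<le> W y - r * \<eta> / 2" if qa: "(q, a) \<in> Aff L" and far: "\<eta> \<le> norm (q - q0)" for q a
  proof -
    define h where "h = (r / norm (q - q0)) *\<^sub>R (q - q0)"
    have n0: "0 < norm (q - q0)" using far \<eta> by linarith
    have h: "norm h = r" using n0 r by (simp add: h_def)
    have qh: "(q - q0) \<bullet> h = r * norm (q - q0)"
      using n0 by (simp add: h_def power2_norm_eq_inner[symmetric] power2_eq_square)
    have "a + q \<bullet> (p y + h) \<le> V (p y + h)" using qa by (simp add: Aff_def)
    also have "\<dots> \<le> V (p y) + q0 \<bullet> h + (\<eta> / 2) * r"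
      using abs_le_D1[of "V (p y + h) - V (p y) - q0 \<bullet> h" "(\<eta> / 2) * r"] r0(2)[of "p y + h"] h r by simp
    finally have "a + q \<bullet> p y \<le> W y - r * norm (q - q0) + (\<eta> / 2) * r"
      using qh by (simp add: W_def inner_simps)
    moreover have "r * \<eta> \<le> r * norm (q - q0)" using far r by (intro mult_left_mono) auto
    ultimately show ?thesis by (simp add: algebra_simps)
  qed
  \<comment> \<open>The vertex sum bounds all remainders at once; even after division by
    \<open>t n\<close> it tends to 0, hence drops below the gap.\<close>
  have "(\<lambda>n. t n * (\<Sum>v\<in>S. R v (t n) y / (t n)\<^sup>2)) \<longlonglongrightarrow> 0 * (\<Sum>v\<in>S. D y v \<bullet> v / 2)"
    by (intro tendsto_intros R_limit t)
  then have ev1: "eventually (\<lambda>n. t n * (\<Sum>v\<in>S. R v (t n) y / (t n)\<^sup>2) < r * \<eta> / 2) sequentially"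
    by (rule order_tendstoD(2)) (use r \<eta>(1) in simp)
  have "(\<lambda>n. t n * L) \<longlonglongrightarrow> 0 * L" by (intro tendsto_intros t)
  then have ev2: "eventually (\<lambda>n. t n * L < d) sequentially"
    by (rule order_tendstoD(2)) (use d(1) in simp)
  from ev1 ev2 show ?thesis
  proof eventually_elim
    case (elim n)
    have tn: "0 < t n" using t by blast
    have D0: "0 \<le> D y q0 \<bullet> q0 / 2 + e" using D_nonneg[of y q0] e by linarith
    show ?case
    proof (rule up_least[OF L])
      fix q a assume qa: "(q, a) \<in> Aff L"
      have qL: "norm q \<le> L" using qa by (simp add: Aff_def)
      show "\<phi> (y + t n *\<^sub>R q) + t n * a \<le> \<phi> y + t n * W y + (t n)\<^sup>2 * (D y q0 \<bullet> q0 / 2 + e)"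
      proof (cases "norm (q - q0) < \<eta>")
        case True
        have "t n * norm q \<le> t n * L" using qL tn by (intro mult_left_mono) auto
        then have "t n * norm q < d" using elim(2) by linarith
        then have "norm (t n *\<^sub>R q) < d" using tn by simp
        from d(2)[OF this] have "R q (t n) y \<le> (t n)\<^sup>2 * (D y q \<bullet> q / 2) + e' * (t n * norm q)\<^sup>2"
          using tn by (simp add: R_def linear_scale[OF linear_D] power2_eq_square abs_le_iff mult_ac)
        also have "e' * (t n * norm q)\<^sup>2 = (t n)\<^sup>2 * (e' * (norm q)\<^sup>2)" by (simp add: power_mult_distrib)
        also have "(t n)\<^sup>2 * (D y q \<bullet> q / 2) + (t n)\<^sup>2 * (e' * (norm q)\<^sup>2) \<le> (t n)\<^sup>2 * (D y q0 \<bullet> q0 / 2 + e)"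
        proof -
          have "e' * (norm q)\<^sup>2 \<le> e' * L\<^sup>2" using e' qL by (intro mult_left_mono power_mono) auto
          then have "D y q \<bullet> q / 2 + e' * (norm q)\<^sup>2 \<le> D y q0 \<bullet> q0 / 2 + e"
            using \<eta>(2)[OF True] e'L e by linarith
          then show ?thesis unfolding distrib_left[symmetric] by (intro mult_left_mono) auto
        qed
        finally have "R q (t n) y \<le> (t n)\<^sup>2 * (D y q0 \<bullet> q0 / 2 + e)" .
        moreover have "t n * (a + q \<bullet> p y) \<le> t n * W y" using Aff_le_W[OF qa] tn by (intro mult_left_mono) auto
        ultimately show ?thesis unfolding expand_up by linarith
      next
        case False
        have "R q (t n) y \<le> (\<Sum>v\<in>S. R v (t n) y)" by (rule R_le_sum[OF S qL])
        also have "\<dots> = t n * (t n * (\<Sum>v\<in>S. R v (t n) y / (t n)\<^sup>2))"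
          using tn by (simp add: sum_divide_distrib[symmetric] power2_eq_square)
        also have "\<dots> \<le> t n * (r * \<eta> / 2)" using elim tn by (intro mult_left_mono) auto
        finally have "R q (t n) y \<le> t n * (r * \<eta> / 2)" .
        moreover have "t n * (a + q \<bullet> p y) \<le> t n * (W y - r * \<eta> / 2)"
          using gap[OF qa] False tn by (intro mult_left_mono) auto
        moreover have "0 \<le> (t n)\<^sup>2 * (D y q0 \<bullet> q0 / 2 + e)" using D0 by simp
        ultimately show ?thesis unfolding expand_up by (simp add: right_diff_distrib)
      qed
    qed
  qed
qed


text \<open>One unit from \<open>p y\<close> in the direction of \<open>q\<close>, the tangent, and
  with it the convex \<open>V\<close>, is at least \<open>norm q\<close>, since \<open>V\<close> is
  nonnegative at \<open>p y\<close>. Over all \<open>y\<close> in the ball these points stay in a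
  bounded set, on which \<open>V\<close> is bounded.\<close>

lemma tangent_bounded:
  obtains L where "0 < L" "\<And>y q. norm y \<le> r \<Longrightarrow> (V has_derivative (\<lambda>h. q \<bullet> h)) (at (p y)) \<Longrightarrow> norm q \<le> L"
proof -
  have "bounded (p ` cball 0 r)" by (intro compact_imp_bounded compact_continuous_image continuous_p) auto
  then obtain P where P: "\<forall>x\<in>cball 0 r. norm (p x) \<le> P" unfolding bounded_iff by auto
  have "bounded (V ` cball 0 (P + 1))" by (intro compact_imp_bounded compact_continuous_image continuous_V) auto
  then obtain L where L: "\<forall>x\<in>cball 0 (P + 1). norm (V x) \<le> L" unfolding bounded_iff by auto
  show ?thesis
  proof (rule that[of "\<bar>L\<bar> + 1"])
    fix y q assume y: "norm y \<le> r" and d: "(V has_derivative (\<lambda>h. q \<bullet> h)) (at (p y))"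
    define u where "u = sgn q"
    have u: "norm u \<le> 1" "q \<bullet> u = norm q"
    proof -
      show "norm u \<le> 1" by (simp add: u_def norm_sgn)
      show "q \<bullet> u = norm q"
        by (cases "q = 0") (simp_all add: u_def sgn_div_norm power2_norm_eq_inner[symmetric] power2_eq_square)
    qed
    have "norm (p y + u) \<le> P + 1" using P[rule_format, of y] y u(1) norm_triangle_ineq[of "p y" u] by simp
    then have "V (p y + u) \<le> L" using L[rule_format, of "p y + u"] by simp
    moreover have "V (p y) + q \<bullet> u \<le> V (p y + u)" by (rule convex_above_tangent[OF conv_V d])
    ultimately show "norm q \<le> \<bar>L\<bar> + 1" using u(2) V_nonneg[of "p y"] by linarith
  qed simp
qed

text \<open>The Borell-Brascamp-Lieb inequality on the ball is applied to \<open>up\<close>,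
  \<open>down\<close> and \<open>\<phi>\<close> along a sequence \<open>t n\<close> tending to 0.
  Both perturbed integrals get the same second-order coefficient, and only the sign of the
  first-order term differs. The function \<open>k\<close> is the Hessian form at the gradient of
  \<open>V\<close>; it is supplied as a measurable function because that gradient is available only
  almost everywhere.\<close>

theorem local_variance:
  fixes r \<beta> :: real and k :: "'a \<Rightarrow> real"
  assumes r: "0 < r" and \<beta>: "DIM('a) < \<beta>"
    and k: "k \<in> borel_measurable borel" "AE y in lborel. \<exists>q. (V has_derivative (\<lambda>h. q \<bullet> h)) (at (p y)) \<and> k y = D y q \<bullet> q"
  defines "M \<equiv> restrict_space lborel (ball 0 r)" and "s \<equiv> - 1 / (\<beta> - DIM('a))"
  shows "integrable M (\<lambda>y. k y * \<phi> y powr - (\<beta> + 1))"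
    "(\<beta> * (\<beta> + 1) * (\<integral>y. (W y)\<^sup>2 * \<phi> y powr - (\<beta> + 2) \<partial>M) - \<beta> * (\<integral>y. k y * \<phi> y powr - (\<beta> + 1) \<partial>M))
       * (\<integral>y. \<phi> y powr - \<beta> \<partial>M)
     \<le> (1 - s) * (\<beta> * (\<integral>y. W y * \<phi> y powr - (\<beta> + 1) \<partial>M))\<^sup>2"
proof -
  let ?K = "ball (0::'a) r"
  have Kb [measurable]: "?K \<in> sets borel" by simp
  have spM: "space M = ?K" by (simp add: M_def space_restrict_space)
  have fin: "finite_measure M"
    using emeasure_lborel_ball_finite[of "0::'a" r]
    by (intro finite_measureI) (simp add: M_def space_restrict_space emeasure_restrict_space)
  interpret finite_measure M by (rule fin)
  have mM: "f \<in> borel_measurable M" if "f \<in> borel_measurable borel" for f :: "'a \<Rightarrow> real"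
    unfolding M_def using that by (simp add: measurable_restrict_space1)
  have AEM: "AE y in M. P y" if "AE y in lborel. P y" for P
    unfolding M_def using that by (subst AE_restrict_space_iff) (auto elim: eventually_mono)
  have \<beta>0: "0 < \<beta>" using \<beta> by (meson of_nat_0_le_iff le_less_trans)
  have s0: "s < 0" using \<beta> by (simp add: s_def)
  obtain L where L: "0 < L" "\<And>y q. norm y \<le> r \<Longrightarrow> (V has_derivative (\<lambda>h. q \<bullet> h)) (at (p y)) \<Longrightarrow> norm q \<le> L"
    using tangent_bounded by blast
  then have L0: "0 \<le> L" by simp
  \<comment> \<open>The vertices of a cube around the ball of admissible slopes.\<close>
  obtain S :: "'a set" where S: "finite S" "cball 0 L \<subseteq> convex hull S"
  proof -
    obtain S :: "'a set" where "finite S" and S: "cbox (0 - (\<Sum>i\<in>Basis. L *\<^sub>R i)) (0 + (\<Sum>i\<in>Basis. L *\<^sub>R i)) = convex hull S"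
      using cube_convex_hull[OF L(1), of "0::'a"] by blast
    moreover have "cball 0 L \<subseteq> cbox (0 - (\<Sum>i\<in>Basis. L *\<^sub>R i)) (0 + (\<Sum>i\<in>Basis. L *\<^sub>R (i::'a)))"
    proof
      fix x :: 'a assume "x \<in> cball 0 L"
      then have "\<bar>x \<bullet> i\<bar> \<le> L" if "i \<in> Basis" for i using Basis_le_norm[OF that, of x] by simp
      then show "x \<in> cbox (0 - (\<Sum>i\<in>Basis. L *\<^sub>R i)) (0 + (\<Sum>i\<in>Basis. L *\<^sub>R (i::'a)))"
        by (simp add: mem_box inner_diff_left abs_le_iff minus_le_iff)
    qed
    ultimately show ?thesis using that by simp
  qed
  obtain c where c: "0 < c" "\<And>x. norm x \<le> r + L \<Longrightarrow> c \<le> \<phi> x" using \<phi>_lower by blast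
  \<comment> \<open>Intercepts are at most \<open>V 0\<close>, so for \<open>t \<le> t0\<close> the
    term \<open>t * a\<close> consumes at most half of the lower bound \<open>c\<close> of
    \<open>\<phi>\<close>, and the infimal convolution stays above \<open>c / 2\<close>.\<close>
  define t0 where "t0 = min 1 (c / (2 * (V 0 + 1)))"
  have t0: "0 < t0" "t0 \<le> 1" "t0 * V 0 \<le> c / 2"
  proof -
    have V1: "0 < V 0 + 1" using V_nonneg[of 0] by linarith
    show "0 < t0" "t0 \<le> 1" using c V1 by (auto simp: t0_def)
    have "t0 * V 0 \<le> t0 * (V 0 + 1)" using \<open>0 < t0\<close> by (intro mult_left_mono) auto
    also have "\<dots> \<le> c / (2 * (V 0 + 1)) * (V 0 + 1)" using V1 by (intro mult_right_mono) (auto simp: t0_def)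
    also have "\<dots> = c / 2"
      using V1 unfolding divide_divide_eq_left[symmetric] by (metis nonzero_eq_divide_eq less_irrefl)
    finally show "t0 * V 0 \<le> c / 2" .
  qed
  define t where "t n = t0 / real (Suc n)" for n
  have t: "0 < t n" "t n \<le> t0" "t n \<le> 1" for n
  proof -
    show "0 < t n" using t0 by (simp add: t_def)
    show "t n \<le> t0" using t0 by (simp add: t_def pos_divide_le_eq)
    then show "t n \<le> 1" using t0 by linarith
  qed
  have tlim: "t \<longlonglongrightarrow> 0"
    using tendsto_mult[OF tendsto_const LIMSEQ_Suc[OF lim_1_over_n], of t0] by (simp add: t_def[abs_def])
  have tnn: "0 \<le> t n" for n using t(1)[of n] by simp
  define u where "u n = up L (t n)" for n
  define v where "v n = down L (t n)" for n
  have convu: "convex_on UNIV (u n)" "convex_on UNIV (v n)" for n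
    unfolding u_def v_def by (intro convex_up convex_down L0 tnn)+
  have mconv: "f \<in> borel_measurable borel" if "convex_on UNIV f" for f :: "'a \<Rightarrow> real"
    using convex_on_continuous[OF open_UNIV that] by (rule borel_measurable_continuous_onI)
  have mW: "W \<in> borel_measurable borel" by (rule borel_measurable_continuous_onI[OF continuous_W])
  have [measurable]: "\<phi> \<in> borel_measurable M" "W \<in> borel_measurable M" "\<And>n. u n \<in> borel_measurable M" "\<And>n. v n \<in> borel_measurable M" "k \<in> borel_measurable M"
    using mM[OF measurable_\<phi>] mM[OF mW] mM[OF mconv[OF convu(1)]] mM[OF mconv[OF convu(2)]] mM[OF k(1)] by auto
  have \<phi>c: "c \<le> \<phi> x" if "x \<in> ?K" for x using that L0 by (intro c(2)) auto
  have lower: "c / 2 \<le> \<phi> x" "c / 2 \<le> u n x" "c / 2 \<le> v n x" if x: "x \<in> ?K" for x n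
  proof -
    show 1: "c / 2 \<le> \<phi> x" using \<phi>c[OF x] c(1) by linarith
    show "c / 2 \<le> u n x" using up_ge_\<phi>[OF L0 tnn[of n], of x] 1 by (simp add: u_def)
    show "c / 2 \<le> v n x" unfolding v_def
    proof (rule down_greatest[OF L0])
      fix q a assume qa: "(q, a) \<in> Aff L"
      have "t n * norm q \<le> 1 * L" using qa t(3)[of n] L0 by (intro mult_mono) (auto simp: Aff_def)
      then have "norm (t n *\<^sub>R q) \<le> 1 * L" using t(1)[of n] by simp
      then have "norm (x - t n *\<^sub>R q) \<le> r + L" using x norm_triangle_ineq4[of x "t n *\<^sub>R q"] by simp
      then have "c \<le> \<phi> (x - t n *\<^sub>R q)" by (rule c(2))
      moreover have "t n * a \<le> t n * V 0" using Aff_le[OF qa] tnn by (rule mult_left_mono)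
      moreover have "t n * V 0 \<le> t0 * V 0" using t(2) V_nonneg by (rule mult_right_mono)
      ultimately show "c / 2 \<le> \<phi> (x - t n *\<^sub>R q) - t n * a" using t0(3) by linarith
    qed
  qed
  note BBL = Borell_Brascamp_Lieb_midpoint[of ?K "u n" "v n" \<phi> "c / 2" \<beta> for n, folded M_def s_def]
  have BBL': "0 < (\<integral>x. \<phi> x powr - \<beta> \<partial>M)"
    "(\<integral>x. \<phi> x powr - \<beta> \<partial>M) powr s \<le> ((\<integral>x. u n x powr - \<beta> \<partial>M) powr s + (\<integral>x. v n x powr - \<beta> \<partial>M) powr s) / 2" for n
  proof -
    have *: "open ?K" "bounded ?K" "convex ?K" "?K \<noteq> {}" "convex_on ?K (u n)" "convex_on ?K (v n)" "convex_on ?K \<phi>" "0 < c / 2"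
      using r c(1) convex_on_subset[OF convu(1)] convex_on_subset[OF convu(2)] convex_on_subset[OF conv] by auto
    have mid: "\<phi> ((1/2) *\<^sub>R x + (1/2) *\<^sub>R y) \<le> (u n x + v n y) / 2" for x y
      unfolding u_def v_def by (rule midpoint_up_down[OF L0 tnn])
    show "0 < (\<integral>x. \<phi> x powr - \<beta> \<partial>M)" by (rule BBL(3)[OF * lower(2,3,1) mid \<beta>])
    show "(\<integral>x. \<phi> x powr - \<beta> \<partial>M) powr s \<le> ((\<integral>x. u n x powr - \<beta> \<partial>M) powr s + (\<integral>x. v n x powr - \<beta> \<partial>M) powr s) / 2"
      by (rule BBL(4)[OF * lower(2,3,1) mid \<beta>])
  qed
  define E where "E n y = (\<Sum>q\<in>S. R q (t n) y / (t n)\<^sup>2)" for n y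
  define E0 where "E0 y = (\<Sum>q\<in>S. D y q \<bullet> q / 2)" for y
  note L1 = R_scaled_L1[OF t(1) t(3) tlim, where r=r, folded M_def]
  have iE: "integrable M (E n)" "integrable M E0" for n
    unfolding E_def E0_def using L1(1,2) by (auto intro!: Bochner_Integration.integrable_sum)
  have Elim: "(\<lambda>n. \<integral>x. \<bar>E n x - E0 x\<bar> \<partial>M) \<longlonglongrightarrow> 0"
  proof (rule tendsto_sandwich[where f="\<lambda>_. 0"])
    have L1r: "(\<lambda>n. \<integral>y. \<bar>R q (t n) y / (t n)\<^sup>2 - D y q \<bullet> q / 2\<bar> \<partial>M) \<longlonglongrightarrow> 0" for q
    proof -
      have "(\<integral>y. \<bar>R q (t n) y / (t n)\<^sup>2 - D y q \<bullet> q / 2\<bar> \<partial>M) = enn2real (\<integral>\<^sup>+y. norm (R q (t n) y / (t n)\<^sup>2 - D y q \<bullet> q / 2) \<partial>M)" for n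
        unfolding real_norm_def using L1(1,2)[of q] by (intro integral_eq_nn_integral borel_measurable_abs borel_measurable_diff) auto
      moreover have "(\<lambda>n. enn2real (\<integral>\<^sup>+y. norm (R q (t n) y / (t n)\<^sup>2 - D y q \<bullet> q / 2) \<partial>M)) \<longlonglongrightarrow> 0"
        by (rule tendsto_enn2real) (use L1(3)[of q] in auto)
      ultimately show ?thesis by simp
    qed
    have "(\<lambda>n. \<Sum>q\<in>S. \<integral>y. \<bar>R q (t n) y / (t n)\<^sup>2 - D y q \<bullet> q / 2\<bar> \<partial>M) \<longlonglongrightarrow> (\<Sum>q\<in>S. 0)"
      by (intro tendsto_sum L1r)
    then show "(\<lambda>n. \<Sum>q\<in>S. \<integral>y. \<bar>R q (t n) y / (t n)\<^sup>2 - D y q \<bullet> q / 2\<bar> \<partial>M) \<longlonglongrightarrow> 0" by simp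
    have iabs: "integrable M (\<lambda>y. \<bar>R q (t n) y / (t n)\<^sup>2 - D y q \<bullet> q / 2\<bar>)" for n q
      by (intro integrable_abs Bochner_Integration.integrable_diff L1(1,2))
    have "(\<integral>x. \<bar>E n x - E0 x\<bar> \<partial>M) \<le> (\<Sum>q\<in>S. \<integral>y. \<bar>R q (t n) y / (t n)\<^sup>2 - D y q \<bullet> q / 2\<bar> \<partial>M)" for n
    proof -
      have "(\<integral>x. \<bar>E n x - E0 x\<bar> \<partial>M) \<le> (\<integral>y. (\<Sum>q\<in>S. \<bar>R q (t n) y / (t n)\<^sup>2 - D y q \<bullet> q / 2\<bar>) \<partial>M)"
      proof (rule integral_mono)
        show "integrable M (\<lambda>x. \<bar>E n x - E0 x\<bar>)"
          by (intro integrable_abs Bochner_Integration.integrable_diff iE)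
        show "integrable M (\<lambda>y. \<Sum>q\<in>S. \<bar>R q (t n) y / (t n)\<^sup>2 - D y q \<bullet> q / 2\<bar>)"
          by (intro Bochner_Integration.integrable_sum iabs)
        show "\<bar>E n y - E0 y\<bar> \<le> (\<Sum>q\<in>S. \<bar>R q (t n) y / (t n)\<^sup>2 - D y q \<bullet> q / 2\<bar>)" for y
          unfolding E_def E0_def sum_subtractf[symmetric] by (rule sum_abs)
      qed
      also have "\<dots> = (\<Sum>q\<in>S. \<integral>y. \<bar>R q (t n) y / (t n)\<^sup>2 - D y q \<bullet> q / 2\<bar> \<partial>M)"
        by (rule Bochner_Integration.integral_sum) (rule iabs)
      finally show ?thesis .
    qed
    then show "eventually (\<lambda>n. (\<integral>x. \<bar>E n x - E0 x\<bar> \<partial>M) \<le> (\<Sum>q\<in>S. \<integral>y. \<bar>R q (t n) y / (t n)\<^sup>2 - D y q \<bullet> q / 2\<bar> \<partial>M)) sequentially" by simp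
  qed auto
  \<comment> \<open>The excess of \<open>w n\<close> over its first-order expansion in units of
    \<open>(t n)\<^sup>2\<close>, cut at 0 to meet the sign condition of
    \<open>reverse_Fatou_L1\<close>.\<close>
  define \<rho> where "\<rho> \<sigma> w n y = max 0 ((w n y - \<phi> y - \<sigma> * t n * W y) / (t n)\<^sup>2)" for \<sigma> and w :: "nat \<Rightarrow> 'a \<Rightarrow> real" and n y
  have \<rho>m: "\<rho> \<sigma> w n \<in> borel_measurable M" if [measurable]: "w n \<in> borel_measurable M" for \<sigma> w n
    unfolding \<rho>_def by measurable
  have \<rho>_ge: "w n y \<le> \<phi> y + \<sigma> * t n * W y + (t n)\<^sup>2 * \<rho> \<sigma> w n y" for \<sigma> w n y
  proof -
    have "(w n y - \<phi> y - \<sigma> * t n * W y) / (t n)\<^sup>2 \<le> \<rho> \<sigma> w n y" by (simp add: \<rho>_def)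
    then have "w n y - \<phi> y - \<sigma> * t n * W y \<le> \<rho> \<sigma> w n y * (t n)\<^sup>2" using t(1)[of n] by (simp add: pos_divide_le_eq)
    then show ?thesis by (simp add: mult.commute)
  qed
  have \<rho>_le: "\<rho> \<sigma> w n y \<le> b" if "0 \<le> b" "w n y \<le> \<phi> y + \<sigma> * t n * W y + (t n)\<^sup>2 * b" for \<sigma> w n y b
    using that t(1)[of n] by (simp add: \<rho>_def pos_divide_le_eq mult.commute)
  have E_eq: "(t n)\<^sup>2 * E n y = (\<Sum>q\<in>S. R q (t n) y)" for n y
    using t(1)[of n] by (simp add: E_def sum_divide_distrib[symmetric])
  have E_nonneg: "0 \<le> E n y" for n y unfolding E_def by (intro sum_nonneg divide_nonneg_nonneg R_nonneg) auto
  have good: "AE y in M. norm y \<le> r \<and> (\<exists>q. (V has_derivative (\<lambda>h. q \<bullet> h)) (at (p y)) \<and> norm q \<le> L \<and> k y = D y q \<bullet> q)"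
    using AEM[OF k(2)] AE_space
  proof eventually_elim
    case (elim y)
    then have "norm y \<le> r" by (simp add: spM)
    then show ?case using elim L(2)[of y] by blast
  qed
  have \<rho>u: "AE y in M. 0 \<le> \<rho> 1 u n y \<and> \<rho> 1 u n y \<le> E n y" for n
  proof (rule AE_I2, rule conjI)
    fix y show "0 \<le> \<rho> 1 u n y" by (simp add: \<rho>_def)
    show "\<rho> 1 u n y \<le> E n y"
      by (rule \<rho>_le[OF E_nonneg]) (use up_le[OF L0 tnn S, of n y] in \<open>simp add: u_def E_eq\<close>)
  qed
  have \<rho>v: "AE y in M. 0 \<le> \<rho> (-1) v n y \<and> \<rho> (-1) v n y \<le> E n y" for n
    using good
  proof eventually_elim
    case (elim y)
    then obtain q where q: "(V has_derivative (\<lambda>h. q \<bullet> h)) (at (p y))" "norm q \<le> L" by blast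
    have "v n y \<le> \<phi> y - t n * W y + R (- q) (t n) y" unfolding v_def by (rule down_le_tangent[OF q tnn])
    also have "R (- q) (t n) y \<le> (t n)\<^sup>2 * E n y" unfolding E_eq by (rule R_le_sum[OF S]) (use q in simp)
    finally have "\<rho> (-1) v n y \<le> E n y" by (intro \<rho>_le E_nonneg) simp
    then show ?case by (simp add: \<rho>_def)
  qed
  have limu: "AE y in M. \<forall>e>0. eventually (\<lambda>n. \<rho> 1 u n y \<le> k y / 2 + e) sequentially"
    using good
  proof eventually_elim
    case (elim y)
    then obtain q where q: "(V has_derivative (\<lambda>h. q \<bullet> h)) (at (p y))" "k y = D y q \<bullet> q" by blast
    show ?case
    proof (intro allI impI)
      fix e :: real assume e: "0 < e"
      have "0 \<le> k y / 2 + e" using D_nonneg[of y q] q e by simp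
      show "eventually (\<lambda>n. \<rho> 1 u n y \<le> k y / 2 + e) sequentially"
        using up_limit[OF q(1) L0 S t(1) tlim e]
      proof eventually_elim
        case (elim n)
        show ?case by (rule \<rho>_le[OF \<open>0 \<le> k y / 2 + e\<close>]) (use elim in \<open>simp add: u_def q(2)\<close>)
      qed
    qed
  qed
  have limv: "AE y in M. \<forall>e>0. eventually (\<lambda>n. \<rho> (-1) v n y \<le> k y / 2 + e) sequentially"
    using good
  proof eventually_elim
    case (elim y)
    then obtain q where q: "(V has_derivative (\<lambda>h. q \<bullet> h)) (at (p y))" "norm q \<le> L" "k y = D y q \<bullet> q" by blast
    have k': "D y (- q) \<bullet> (- q) = k y" by (simp add: q(3) linear_neg[OF linear_D])
    show ?case
    proof (intro allI impI)
      fix e :: real assume e: "0 < e"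
      have k0: "0 \<le> k y / 2 + e" using D_nonneg[of y q] q e by simp
      have "eventually (\<lambda>n. R (- q) (t n) y / (t n)\<^sup>2 < k y / 2 + e) sequentially"
        using order_tendstoD(2)[OF R_limit[OF t(1) tlim, of "- q" y], of "k y / 2 + e"] e unfolding k' by simp
      then show "eventually (\<lambda>n. \<rho> (-1) v n y \<le> k y / 2 + e) sequentially"
      proof eventually_elim
        case (elim n)
        have "v n y \<le> \<phi> y - t n * W y + R (- q) (t n) y" unfolding v_def by (rule down_le_tangent[OF q(1,2) tnn])
        moreover have "R (- q) (t n) y \<le> (t n)\<^sup>2 * (k y / 2 + e)"
          using elim t(1)[of n] by (simp add: pos_divide_less_eq mult.commute)
        ultimately show ?case by (intro \<rho>_le k0) simp
      qed
    qed
  qed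
  have knn: "AE y in M. 0 \<le> k y / 2"
    using good by eventually_elim (use D_nonneg in auto)
  \<comment> \<open>In the limit \<open>k / 2\<close> inherits the bound by \<open>E0\<close> from
    the domination of the remainders.\<close>
  have ik: "integrable M (\<lambda>y. k y / 2)"
  proof (rule Bochner_Integration.integrable_bound[OF iE(2)])
    show "AE y in M. norm (k y / 2) \<le> norm (E0 y)"
      using good
    proof eventually_elim
      case (elim y)
      then obtain q where q: "norm q \<le> L" "k y = D y q \<bullet> q" by blast
      have "k y / 2 \<le> E0 y"
      proof (rule LIMSEQ_le)
        show "(\<lambda>n. R q (t n) y / (t n)\<^sup>2) \<longlonglongrightarrow> k y / 2" unfolding q(2) by (rule R_limit[OF t(1) tlim])
        show "(\<lambda>n. \<Sum>v\<in>S. R v (t n) y / (t n)\<^sup>2) \<longlonglongrightarrow> E0 y" unfolding E0_def by (intro tendsto_sum R_limit t(1) tlim)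
        show "\<exists>N. \<forall>n\<ge>N. R q (t n) y / (t n)\<^sup>2 \<le> (\<Sum>v\<in>S. R v (t n) y / (t n)\<^sup>2)"
          using R_le_sum[OF S q(1)] unfolding sum_divide_distrib[symmetric] by (auto intro!: divide_right_mono)
      qed
      then show ?case using D_nonneg[of y q] q(2) by simp
    qed
  qed measurable
  define w where "w y = \<phi> y powr - (\<beta> + 1)" for y
  have [measurable]: "w \<in> borel_measurable M" unfolding w_def by measurable
  have wb: "AE y in M. 0 \<le> w y \<and> w y \<le> c powr - (\<beta> + 1)"
    using AE_space by eventually_elim (use \<phi>c c(1) \<beta>0 in \<open>auto simp: w_def spM intro!: powr_mono2'\<close>)
  note RFu = reverse_Fatou_L1[OF \<rho>m \<open>w \<in> borel_measurable M\<close> iE Elim \<rho>u ik knn limu wb]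
  note RFv = reverse_Fatou_L1[OF \<rho>m \<open>w \<in> borel_measurable M\<close> iE Elim \<rho>v ik knn limv wb]
  have "integrable M (\<lambda>y. k y / 2 * w y)" by (rule RFu(2)[where e=1]) auto
  then have "integrable M (\<lambda>y. 2 * (k y / 2 * w y))" by (rule integrable_mult_right)
  then show ikw: "integrable M (\<lambda>y. k y * \<phi> y powr - (\<beta> + 1))" by (simp add: w_def)
  define P where "P = (\<integral>y. k y / 2 * w y \<partial>M)"
  have P: "2 * P = (\<integral>y. k y * \<phi> y powr - (\<beta> + 1) \<partial>M)"
    unfolding P_def w_def by (subst integral_mult_right_zero[symmetric]) (simp add: mult.assoc[symmetric])
  define I where "I = (\<integral>x. \<phi> x powr - \<beta> \<partial>M)"
  define b where "b = \<beta> * (\<integral>x. W x * \<phi> x powr - (\<beta> + 1) \<partial>M)"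
  define Q where "Q = (\<integral>x. (W x)\<^sup>2 * \<phi> x powr - (\<beta> + 2) \<partial>M)"
  have I0: "0 < I" using BBL'(1) by (simp add: I_def)
  have "bounded (W ` cball 0 r)" by (intro compact_imp_bounded compact_continuous_image continuous_W) auto
  then obtain B where B: "\<forall>x\<in>cball 0 r. norm (W x) \<le> B" unfolding bounded_iff by auto
  have WB: "0 \<le> W x \<and> W x \<le> B" if "x \<in> space M" for x
    using B[rule_format, of x] W_nonneg[of x] that by (simp add: spM)
  \<comment> \<open>Any \<open>c0\<close> below the limit coefficient serves in both expansions at
    once; afterwards it is pushed up to that coefficient.\<close>
  have main: "2 * c0 * I \<le> (1 - s) * b\<^sup>2" if c0: "c0 < \<beta> * (\<beta> + 1) / 2 * Q - \<beta> * P" for c0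
  proof -
    have eu: "eventually (\<lambda>n. I - 1 * t n * b + (t n)\<^sup>2 * c0 \<le> (\<integral>x. u n x powr - \<beta> \<partial>M)) sequentially"
      unfolding I_def b_def
    proof (rule second_variation_lower_bound[where W=W and \<rho>="\<rho> 1 u" and \<phi>=\<phi> and B=B and c=c and c'="c / 2" and P=P])
      show "AE x in M. u n x \<le> \<phi> x + 1 * t n * W x + (t n)\<^sup>2 * \<rho> 1 u n x" for n by (intro AE_I2 \<rho>_ge)
      show "eventually (\<lambda>n. (\<integral>x. \<rho> 1 u n x * \<phi> x powr - (\<beta> + 1) \<partial>M) \<le> P + e) sequentially" if "0 < e" for e
        using RFu(3)[OF _ that] by (simp add: P_def w_def)
      show "integrable M (\<lambda>x. \<rho> 1 u n x * \<phi> x powr - (\<beta> + 1))" for n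
        using RFu(1)[of 1 n] by (simp add: w_def)
      show "AE x in M. 0 \<le> \<rho> 1 u n x" for n by (simp add: \<rho>_def)
      show "\<rho> 1 u n \<in> borel_measurable M" for n by (rule \<rho>m) measurable
      show "c0 < \<beta> * (\<beta> + 1) / 2 * (\<integral>x. (W x)\<^sup>2 * \<phi> x powr - (\<beta> + 2) \<partial>M) - \<beta> * P" using c0 by (simp add: Q_def)
    qed (use fin c \<phi>c WB t tlim \<beta>0 lower in \<open>auto simp: spM\<close>)
    have ev: "eventually (\<lambda>n. I - (-1) * t n * b + (t n)\<^sup>2 * c0 \<le> (\<integral>x. v n x powr - \<beta> \<partial>M)) sequentially"
      unfolding I_def b_def
    proof (rule second_variation_lower_bound[where W=W and \<rho>="\<rho> (-1) v" and \<phi>=\<phi> and B=B and c=c and c'="c / 2" and P=P])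
      show "AE x in M. v n x \<le> \<phi> x + (-1) * t n * W x + (t n)\<^sup>2 * \<rho> (-1) v n x" for n by (intro AE_I2 \<rho>_ge)
      show "eventually (\<lambda>n. (\<integral>x. \<rho> (-1) v n x * \<phi> x powr - (\<beta> + 1) \<partial>M) \<le> P + e) sequentially" if "0 < e" for e
        using RFv(3)[OF _ that] by (simp add: P_def w_def)
      show "integrable M (\<lambda>x. \<rho> (-1) v n x * \<phi> x powr - (\<beta> + 1))" for n
        using RFv(1)[of 1 n] by (simp add: w_def)
      show "AE x in M. 0 \<le> \<rho> (-1) v n x" for n by (simp add: \<rho>_def)
      show "\<rho> (-1) v n \<in> borel_measurable M" for n by (rule \<rho>m) measurable
      show "c0 < \<beta> * (\<beta> + 1) / 2 * (\<integral>x. (W x)\<^sup>2 * \<phi> x powr - (\<beta> + 2) \<partial>M) - \<beta> * P" using c0 by (simp add: Q_def)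
    qed (use fin c \<phi>c WB t tlim \<beta>0 lower in \<open>auto simp: spM\<close>)
    \<comment> \<open>The lower bounds have to be positive before the decreasing power with exponent
      \<open>s\<close> can be applied to them.\<close>
    have pos: "eventually (\<lambda>n. 0 < I - \<sigma> * t n * b + (t n)\<^sup>2 * c0) sequentially" for \<sigma>
    proof -
      have "(\<lambda>n. I - \<sigma> * t n * b + (t n)\<^sup>2 * c0) \<longlonglongrightarrow> I - \<sigma> * 0 * b + 0\<^sup>2 * c0" by (intro tendsto_intros tlim)
      then show ?thesis using I0 by (intro order_tendstoD) auto
    qed
    show ?thesis
    proof (rule midpoint_powr_second_order[OF s0 I0 t(1) tlim])
      show "eventually (\<lambda>n. 2 * I powr s \<le> (I - t n * b + (t n)\<^sup>2 * c0) powr s + (I + t n * b + (t n)\<^sup>2 * c0) powr s) sequentially"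
        using eu ev pos[of 1] pos[of "-1"]
      proof eventually_elim
        case (elim n)
        have "(\<integral>x. u n x powr - \<beta> \<partial>M) powr s \<le> (I - t n * b + (t n)\<^sup>2 * c0) powr s"
          using elim s0 by (intro powr_mono2') auto
        moreover have "(\<integral>x. v n x powr - \<beta> \<partial>M) powr s \<le> (I + t n * b + (t n)\<^sup>2 * c0) powr s"
          using elim s0 by (intro powr_mono2') auto
        ultimately show ?case using BBL'(2)[of n] by (simp add: I_def)
      qed
    qed
  qed
  have "\<beta> * (\<beta> + 1) / 2 * Q - \<beta> * P \<le> (1 - s) * b\<^sup>2 / (2 * I)"
  proof (rule dense_le)
    fix c0 assume "c0 < \<beta> * (\<beta> + 1) / 2 * Q - \<beta> * P"
    from main[OF this] show "c0 \<le> (1 - s) * b\<^sup>2 / (2 * I)" using I0 by (simp add: pos_le_divide_eq mult_ac)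
  qed
  then have "(\<beta> * (\<beta> + 1) / 2 * Q - \<beta> * P) * (2 * I) \<le> (1 - s) * b\<^sup>2"
    using I0 by (subst (asm) pos_le_divide_eq) auto
  moreover have "(\<beta> * (\<beta> + 1) / 2 * Q - \<beta> * P) * (2 * I) = (\<beta> * (\<beta> + 1) * Q - \<beta> * (2 * P)) * I"
    by (simp add: algebra_simps)
  ultimately have "(\<beta> * (\<beta> + 1) * Q - \<beta> * (2 * P)) * I \<le> (1 - s) * b\<^sup>2"
    by linarith
  then show "(\<beta> * (\<beta> + 1) * (\<integral>y. (W y)\<^sup>2 * \<phi> y powr - (\<beta> + 2) \<partial>M) - \<beta> * (\<integral>y. k y * \<phi> y powr - (\<beta> + 1) \<partial>M))
       * (\<integral>y. \<phi> y powr - \<beta> \<partial>M)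
     \<le> (1 - s) * (\<beta> * (\<integral>y. W y * \<phi> y powr - (\<beta> + 1) \<partial>M))\<^sup>2"
    unfolding P I_def b_def Q_def .
qed

end

section \<open>Measurability and exhaustion by balls\<close>

text \<open>As \<open>gradient\<close> is a definite description, both existence and uniqueness are
  at stake. Existence is the Riesz representation of the derivative in the standard basis.\<close>

lemma GDERIV_gradient:
  fixes f :: "'a::euclidean_space \<Rightarrow> real"
  assumes "f differentiable (at z)"
  shows "(f has_derivative (\<lambda>h. gradient f z \<bullet> h)) (at z)"
proof -
  obtain f' where f': "(f has_derivative f') (at z)" using assms by (auto simp: differentiable_def)
  have lin: "linear f'" using f' by (rule has_derivative_linear)
  have "f' = (\<lambda>h. h \<bullet> (\<Sum>b\<in>Basis. f' b *\<^sub>R b))"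
  proof
    fix h
    have "f' h = f' (\<Sum>b\<in>Basis. (h \<bullet> b) *\<^sub>R b)" by (simp add: euclidean_representation)
    also have "\<dots> = (\<Sum>b\<in>Basis. (h \<bullet> b) * f' b)" using lin by (simp add: linear_sum linear_scale)
    finally show "f' h = h \<bullet> (\<Sum>b\<in>Basis. f' b *\<^sub>R b)" by (simp add: inner_sum_right mult.commute)
  qed
  then have ex: "GDERIV f z :> (\<Sum>b\<in>Basis. f' b *\<^sub>R b)" using f' by (simp add: gderiv_def)
  moreover have "D = D'" if "GDERIV f z :> D" "GDERIV f z :> D'" for D D'
  proof -
    have "(\<lambda>h. h \<bullet> D) = (\<lambda>h. h \<bullet> D')" using that unfolding gderiv_def by (rule has_derivative_unique)
    then show ?thesis by (metis vector_eq_ldot)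
  qed
  ultimately have "GDERIV f z :> gradient f z" unfolding gradient_def by (rule_tac theI') blast
  then show ?thesis by (simp add: gderiv_def inner_commute)
qed

text \<open>The segment from \<open>x\<close> through \<open>y\<close> is prolonged by unit length
  to \<open>z\<close>. Convexity bounds the increment by the fraction \<open>d / (1 + d)\<close> of
  \<open>V z - V x\<close>, where \<open>V z \<le> B\<close> and \<open>V x\<close> is
  nonnegative.\<close>

lemma convex_nonneg_Lipschitz:
  fixes V :: "'a::real_normed_vector \<Rightarrow> real"
  assumes V: "convex_on UNIV V" "\<And>x. 0 \<le> V x" and B: "\<And>z. norm (z - c) \<le> 2 \<Longrightarrow> V z \<le> B"
    and xy: "norm (y - c) \<le> 1"
  shows "V y - V x \<le> B * norm (y - x)"
proof (cases "x = y")
  case False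
  define d where "d = norm (y - x)"
  have d: "0 < d" using False by (simp add: d_def)
  define z where "z = y + (1 / d) *\<^sub>R (y - x)"
  have "norm (z - c) \<le> norm (y - c) + norm ((1 / d) *\<^sub>R (y - x))"
    using norm_triangle_ineq[of "y - c" "(1 / d) *\<^sub>R (y - x)"] by (simp add: z_def algebra_simps)
  also have "norm ((1 / d) *\<^sub>R (y - x)) = 1" using d by (simp add: d_def)
  finally have "V z \<le> B" using xy by (intro B) simp
  have "(1 + d) *\<^sub>R y = x + d *\<^sub>R z" using d by (simp add: z_def algebra_simps)
  then have "y = (1 / (1 + d)) *\<^sub>R (x + d *\<^sub>R z)" using d by (metis (no_types, opaque_lifting) add_pos_pos divide_self_if less_irrefl scaleR_one scaleR_scaleR times_divide_eq_left mult_1 zero_less_one)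
  also have "\<dots> = (1 - d / (1 + d)) *\<^sub>R x + (d / (1 + d)) *\<^sub>R z"
  proof -
    have "1 - d / (1 + d) = 1 / (1 + d)" using d by (simp add: field_simps)
    then show ?thesis by (simp add: scaleR_add_right)
  qed
  finally have "V y \<le> (1 - d / (1 + d)) * V x + (d / (1 + d)) * V z"
    using convex_onD[OF V(1), of "d / (1 + d)" x z] d by simp
  note le = this
  have "(1 - l) * V x + l * V z = V x + l * (V z - V x)" for l by (simp add: algebra_simps)
  from this[of "d / (1 + d)"] le have "V y - V x \<le> (d / (1 + d)) * (V z - V x)" by linarith
  also have "\<dots> \<le> (d / (1 + d)) * B" using d \<open>V z \<le> B\<close> V(2)[of x] by (intro mult_left_mono) auto
  also have "\<dots> \<le> d * B"
  proof (rule mult_right_mono)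
    show "d / (1 + d) \<le> d" using d by (simp add: pos_divide_le_eq algebra_simps)
    show "0 \<le> B" using V(2)[of z] \<open>V z \<le> B\<close> by linarith
  qed
  finally show ?thesis by (simp add: d_def mult.commute)
qed simp

text \<open>The first-order behaviour of \<open>V \<circ> p\<close> at \<open>z\<close> determines that of \<open>V\<close> at \<open>p z\<close>, because \<open>p\<close> covers all
  directions up to an error that the local Lipschitz bound for \<open>V\<close> absorbs.\<close>

lemma convex_derivative_from_composition:
  fixes V :: "'a::euclidean_space \<Rightarrow> real" and p :: "'a \<Rightarrow> 'a"
  assumes V: "convex_on UNIV V" "\<And>x. 0 \<le> V x"
    and p: "(p has_derivative H) (at z)" and W: "((\<lambda>x. V (p x)) has_derivative w) (at z)"
    and B: "bounded_linear B" "\<And>h. H (B h) = h"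
  shows "(V has_derivative (\<lambda>h. w (B h))) (at (p z))"
  unfolding has_derivative_at_alt
proof (intro conjI allI impI)
  have "bounded_linear w" using W by (rule has_derivative_bounded_linear)
  then show "bounded_linear (\<lambda>h. w (B h))" using B(1) by (rule bounded_linear_compose)
  fix e :: real assume e: "0 < e"
  have "bounded (V ` cball (p z) 2)"
    by (intro compact_imp_bounded compact_continuous_image continuous_on_subset[OF convex_on_continuous[OF open_UNIV V(1)]]) auto
  then obtain C where C: "\<forall>x\<in>cball (p z) 2. norm (V x) \<le> C" unfolding bounded_iff by auto
  have VC: "V x \<le> \<bar>C\<bar>" if "norm (x - p z) \<le> 2" for x
    using C[rule_format, of x] that by (simp add: dist_norm norm_minus_commute)
  obtain K where K: "0 < K" "\<And>h. norm (B h) \<le> norm h * K" using bounded_linear.pos_bounded[OF B(1)] by blast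
  define G where "G = \<bar>C\<bar> + 1"
  have G: "0 < G" by (simp add: G_def add_nonneg_pos)
  \<comment> \<open>The error \<open>e\<close> is halved: \<open>e1\<close>, enlarged by the
    Lipschitz bound, accounts for the distance of \<open>p x\<close> from \<open>y\<close>, and
    \<open>e2\<close> for the remainder of the composition. The factor \<open>K\<close> converts
    \<open>norm (B h)\<close> into \<open>norm h\<close>.\<close>
  define e1 where "e1 = e / (2 * K * G)"
  define e2 where "e2 = e / (2 * K)"
  have e12: "0 < e1" "0 < e2" using e K G by (auto simp: e1_def e2_def)
  obtain d1 where d1: "0 < d1" "\<And>x. norm (x - z) < d1 \<Longrightarrow> norm (p x - p z - H (x - z)) \<le> e1 * norm (x - z)"
    using p e12 unfolding has_derivative_at_alt by metis
  obtain d2 where d2: "0 < d2" "\<And>x. norm (x - z) < d2 \<Longrightarrow> norm (V (p x) - V (p z) - w (x - z)) \<le> e2 * norm (x - z)"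
    using W e12 unfolding has_derivative_at_alt by metis
  define d where "d = min (1/2) (min (min d1 d2 / K) (1 / (2 * (e1 * K))))"
  have d: "0 < d" using d1 d2 K e12 by (simp add: d_def)
  show "\<exists>d>0. \<forall>y. norm (y - p z) < d \<longrightarrow> norm (V y - V (p z) - w (B (y - p z))) \<le> e * norm (y - p z)"
  proof (intro exI[of _ d] conjI allI impI d)
    fix y assume y: "norm (y - p z) < d"
    define h where "h = y - p z"
    \<comment> \<open>As \<open>B\<close> is a right inverse of \<open>H\<close>, the point
      \<open>p x\<close> misses \<open>y\<close> only by the remainder of \<open>p\<close>.\<close>
    define x where "x = z + B h"
    have yh: "y = p z + h" by (simp add: h_def)
    have hd: "norm h < d" using y by (simp add: h_def)
    have Bh: "norm (B h) \<le> norm h * K" by (rule K(2))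
    have "norm h * K < min d1 d2"
    proof -
      have "norm h < min d1 d2 / K" using hd by (simp add: d_def)
      then show ?thesis using K by (simp add: pos_less_divide_eq)
    qed
    then have small: "norm (x - z) < d1" "norm (x - z) < d2" using Bh by (auto simp: x_def)
    have px: "norm (p x - y) \<le> e1 * (norm h * K)"
    proof -
      have "p x - y = p x - p z - H (x - z)" by (simp add: x_def B(2) yh)
      then have "norm (p x - y) \<le> e1 * norm (x - z)" using d1(2)[OF small(1)] by (simp only:)
      also have "\<dots> \<le> e1 * (norm h * K)" using Bh e12 by (intro mult_left_mono) (auto simp: x_def)
      finally show ?thesis .
    qed
    have "norm h < 1 / (2 * (e1 * K))" using hd by (simp add: d_def)
    then have "e1 * (norm h * K) \<le> 1 / 2" using e12 K by (simp add: pos_less_divide_eq mult_ac)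
    then have px1: "norm (p x - p z) \<le> 1" "norm (y - p z) \<le> 1"
      using px hd norm_triangle_ineq[of "p x - y" "y - p z"] by (auto simp: d_def h_def)
    have Lip: "\<bar>V y - V (p x)\<bar> \<le> \<bar>C\<bar> * norm (p x - y)"
      using convex_nonneg_Lipschitz[OF V VC px1(1), of y] convex_nonneg_Lipschitz[OF V VC px1(2), of "p x"]
      by (simp add: abs_le_iff norm_minus_commute)
    have "\<bar>V y - V (p x)\<bar> \<le> (e / 2) * norm h"
    proof -
      have "\<bar>C\<bar> * norm (p x - y) \<le> G * (e1 * (norm h * K))" using px G by (intro mult_mono) (auto simp: G_def)
      also have "\<dots> = (e / 2) * norm h"
      proof -
        have "e1 * K * G = e / 2" using K G by (simp add: e1_def)
        moreover have "G * (e1 * (norm h * K)) = (e1 * K * G) * norm h" by (simp add: mult_ac)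
        ultimately show ?thesis by (simp only:)
      qed
      finally show ?thesis using Lip by linarith
    qed
    moreover have "\<bar>V (p x) - V (p z) - w (B h)\<bar> \<le> (e / 2) * norm h"
    proof -
      have "\<bar>V (p x) - V (p z) - w (B h)\<bar> \<le> e2 * norm (B h)" using d2(2)[OF small(2)] by (simp add: x_def)
      also have "\<dots> \<le> e2 * (norm h * K)" using Bh e12 by (intro mult_left_mono) auto
      also have "\<dots> = (e / 2) * norm h" using K by (simp add: e2_def)
      finally show ?thesis .
    qed
    ultimately show "norm (V y - V (p z) - w (B (y - p z))) \<le> e * norm (y - p z)"
      unfolding h_def[symmetric] real_norm_def by linarith
  qed
qed

lemma invertible_matrix_inv:
  fixes A :: "real ^ 'n ^ 'n"
  assumes "invertible A" shows "A *v (matrix_inv A *v h) = h"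
proof -
  have "A ** matrix_inv A = mat 1"
    using assms someI_ex[of "\<lambda>A'. A ** A' = mat 1 \<and> A' ** A = mat 1"] by (simp add: matrix_inv_def invertible_def)
  then show ?thesis by (simp add: matrix_vector_mul_assoc)
qed

lemma directional_difference_limit:
  assumes "(V has_derivative (\<lambda>h. q \<bullet> h)) (at (x::'a::euclidean_space))"
  shows "(\<lambda>n. (V (x + (1 / real (Suc n)) *\<^sub>R b) - V x) / (1 / real (Suc n))) \<longlonglongrightarrow> q \<bullet> b"
proof -
  have "((\<lambda>\<tau>. x + \<tau> *\<^sub>R b) has_derivative (\<lambda>k. k *\<^sub>R b)) (at (0::real))"
    by (auto intro!: derivative_eq_intros)
  from has_derivative_compose[OF this, of V "\<lambda>h. q \<bullet> h"] assms
  have "((\<lambda>\<tau>. V (x + \<tau> *\<^sub>R b)) has_real_derivative q \<bullet> b) (at 0)"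
    by (simp add: has_field_derivative_def mult.commute mult_commute_abs)
  then have "((\<lambda>\<tau>. (V (x + \<tau> *\<^sub>R b) - V x) / \<tau>) \<longlongrightarrow> q \<bullet> b) (at 0)"
    by (simp add: has_field_derivative_iff)
  moreover have "filterlim (\<lambda>n. 1 / real (Suc n)) (at 0) sequentially"
    by (auto simp: filterlim_at intro!: LIMSEQ_Suc[OF lim_1_over_n] always_eventually simp del: of_nat_Suc)
  ultimately show ?thesis by (rule filterlim_compose)
qed

lemma integral_ball_exhaustion:
  fixes f :: "'a::euclidean_space \<Rightarrow> real"
  assumes "integrable lborel f"
  shows "(\<lambda>m. \<integral>x. f x \<partial>restrict_space lborel (ball 0 (real (Suc m)))) \<longlonglongrightarrow> (\<integral>x. f x \<partial>lborel)"
proof -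
  have [measurable]: "f \<in> borel_measurable borel" using assms by auto
  have "(\<integral>x. f x \<partial>restrict_space lborel (ball 0 (real (Suc m)))) = (\<integral>x. indicator (ball 0 (real (Suc m))) x *\<^sub>R f x \<partial>lborel)" for m
    by (rule integral_restrict_space) simp
  moreover have "(\<lambda>m. \<integral>x. indicator (ball 0 (real (Suc m))) x *\<^sub>R f x \<partial>lborel) \<longlonglongrightarrow> (\<integral>x. f x \<partial>lborel)"
  proof (rule integral_dominated_convergence[where w="\<lambda>x. norm (f x)"])
    show "AE x in lborel. (\<lambda>m. indicator (ball 0 (real (Suc m))) x *\<^sub>R f x) \<longlonglongrightarrow> f x"
    proof (intro AE_I2 tendsto_eventually)
      fix x :: 'a
      have "eventually (\<lambda>m. norm x < real m) sequentially"
        using filterlim_real_sequentially by (rule filterlim_at_top_dense[THEN iffD1, rule_format])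
      then show "eventually (\<lambda>m. indicator (ball 0 (real (Suc m))) x *\<^sub>R f x = f x) sequentially"
        by eventually_elim simp
    qed
    show "AE x in lborel. norm (indicator (ball 0 (real (Suc m))) x *\<^sub>R f x) \<le> norm (f x)" for m
      by (auto simp: indicator_def)
    show "(\<lambda>x. indicator (ball 0 (real (Suc m))) x *\<^sub>R f x) \<in> borel_measurable lborel" for m
    proof -
      have [measurable]: "ball (0::'a) (real (Suc m)) \<in> sets borel" by simp
      show ?thesis by measurable
    qed
  qed (use assms in auto)
  ultimately show ?thesis by simp
qed

text \<open>Let \<open>H\<close> be the Hessian of \<open>\<phi>\<close> at \<open>z\<close>,
  \<open>v\<close> the gradient of \<open>V(\<nabla>\<phi>)\<close> at \<open>z\<close> and
  \<open>q\<close> that of \<open>V\<close> at \<open>\<nabla>\<phi>(z)\<close>. Invertibility of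
  \<open>H\<close> yields the existence of \<open>q\<close>. The chain rule
  \<open>v \<bullet> h = q \<bullet> H h\<close> and its inverted form turn the inverse Hessian form
  at \<open>v\<close> into \<open>q \<bullet> v = q \<bullet> H q\<close>, without recourse to
  symmetry of \<open>H\<close>.\<close>

lemma exists_measurable_curvature:
  fixes \<phi> V :: "real ^ 'n \<Rightarrow> real"
  assumes "convex_on UNIV \<phi>" and \<phi>d: "\<And>z. \<phi> differentiable (at z)" and pd: "\<And>z. gradient \<phi> differentiable (at z)"
    and V: "convex_on UNIV V" "\<And>z. 0 \<le> V z"
    and inv: "AE z in lborel. invertible (Hess \<phi> z)"
    and Wd: "AE z in lborel. (\<lambda>z. V (gradient \<phi> z)) differentiable (at z)"
  obtains k where "k \<in> borel_measurable borel"
    "AE z in lborel. \<exists>q. (V has_derivative (\<lambda>h. q \<bullet> h)) (at (gradient \<phi> z)) \<and> k z = (Hess \<phi> z *v q) \<bullet> q"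
    "AE z in lborel. (matrix_inv (Hess \<phi> z) *v gradient (\<lambda>z. V (gradient \<phi> z)) z) \<bullet> gradient (\<lambda>z. V (gradient \<phi> z)) z = k z"
proof -
  let ?p = "gradient \<phi>" and ?D = "\<lambda>z h. Hess \<phi> z *v h" and ?W = "\<lambda>z. V (gradient \<phi> z)"
  have d2: "(?p has_derivative ?D z) (at z)" for z
    using pd unfolding Hess_def jacobian_works .
  interpret convex_twice_differentiable \<phi> ?p ?D
    by unfold_locales (use assms GDERIV_gradient[OF \<phi>d] d2 in auto)
  have V_cont: "continuous_on UNIV V" by (rule convex_on_continuous[OF open_UNIV V(1)])
  have [measurable]: "V \<in> borel_measurable borel" by (rule borel_measurable_continuous_onI[OF V_cont])
  \<comment> \<open>The directional derivative of \<open>V\<close> at \<open>?p z\<close>. As a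
    \<open>lim\<close> of difference quotients it is measurable on the whole space, and it has its
    meaning wherever \<open>V\<close> is differentiable at \<open>?p z\<close>.\<close>
  define g where "g b z = lim (\<lambda>n. (V (?p z + (1 / real (Suc n)) *\<^sub>R b) - V (?p z)) / (1 / real (Suc n)))" for b z
  have [measurable]: "g b \<in> borel_measurable borel" for b unfolding g_def by measurable
  define k where "k z = (\<Sum>b\<in>Basis. \<Sum>c\<in>Basis. g b z * g c z * (?D z b \<bullet> c))" for z
  have km: "k \<in> borel_measurable borel"
    unfolding k_def by (intro borel_measurable_sum borel_measurable_times measurable_D) auto
  have good: "AE z in lborel. \<exists>q. (V has_derivative (\<lambda>h. q \<bullet> h)) (at (?p z)) \<and> k z = (?D z q) \<bullet> q \<and>
      (matrix_inv (Hess \<phi> z) *v gradient ?W z) \<bullet> gradient ?W z = k z"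
    using inv Wd
  proof eventually_elim
    case (elim z)
    define v where "v = gradient ?W z"
    let ?B = "\<lambda>h. matrix_inv (Hess \<phi> z) *v h"
    have W': "(?W has_derivative (\<lambda>h. v \<bullet> h)) (at z)" unfolding v_def by (rule GDERIV_gradient[OF elim(2)])
    have HB: "?D z (?B h) = h" for h by (rule invertible_matrix_inv[OF elim(1)])
    have V': "(V has_derivative (\<lambda>h. v \<bullet> ?B h)) (at (?p z))"
      by (rule convex_derivative_from_composition[OF V d2 W' _ HB]) (rule matrix_vector_mul_bounded_linear)
    then have "V differentiable (at (?p z))" by (auto simp: differentiable_def)
    then have q: "(V has_derivative (\<lambda>h. gradient V (?p z) \<bullet> h)) (at (?p z))" (is "(V has_derivative (\<lambda>h. ?q \<bullet> h)) _")
      by (rule GDERIV_gradient)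
    have qB: "?q \<bullet> h = v \<bullet> ?B h" for h using has_derivative_unique[OF q V'] by metis
    have "(?W has_derivative (\<lambda>h. ?q \<bullet> ?D z h)) (at z)" by (rule has_derivative_compose[OF d2 q])
    from has_derivative_unique[OF this W'] have qv: "?q \<bullet> ?D z h = v \<bullet> h" for h by metis
    have gq: "g b z = ?q \<bullet> b" for b
      unfolding g_def by (rule limI[OF directional_difference_limit[OF q]])
    have "(?D z ?q) \<bullet> ?q = (?D z (\<Sum>b\<in>Basis. (?q \<bullet> b) *\<^sub>R b)) \<bullet> (\<Sum>c\<in>Basis. (?q \<bullet> c) *\<^sub>R c)"
      by (simp add: euclidean_representation)
    also have "\<dots> = (\<Sum>c\<in>Basis. \<Sum>b\<in>Basis. (?q \<bullet> c) * ((?q \<bullet> b) * (?D z b \<bullet> c)))"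
      by (simp only: linear_sum[OF linear_D] linear_scale[OF linear_D] inner_sum_left inner_sum_right inner_scaleR_left inner_scaleR_right sum_distrib_left)
    also have "\<dots> = (\<Sum>b\<in>Basis. \<Sum>c\<in>Basis. (?q \<bullet> b) * (?q \<bullet> c) * (?D z b \<bullet> c))"
      by (subst sum.swap) (simp only: mult_ac)
    also have "\<dots> = k z" unfolding k_def gq ..
    finally have kq: "k z = (?D z ?q) \<bullet> ?q" ..
    have "(?B v) \<bullet> v = ?q \<bullet> v" using qB[of v] by (simp add: inner_commute)
    also have "\<dots> = (?D z ?q) \<bullet> ?q" using qv[of ?q] by (simp add: inner_commute)
    finally show ?case using q kq unfolding v_def by auto
  qed
  show ?thesis
  proof (rule that[OF km])
    show "AE z in lborel. \<exists>q. (V has_derivative (\<lambda>h. q \<bullet> h)) (at (?p z)) \<and> k z = (Hess \<phi> z *v q) \<bullet> q"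
      using good by eventually_elim blast
    show "AE z in lborel. (matrix_inv (Hess \<phi> z) *v gradient ?W z) \<bullet> gradient ?W z = k z"
      using good by eventually_elim blast
  qed
qed

text \<open>The inequality on balls with \<open>\<beta> = - 1 / \<gamma>\<close>, in the limit of
  large radius and divided by \<open>(\<beta> * Z)\<^sup>2\<close>, where \<open>Z\<close> is the
  normalising integral. Then \<open>1 + 1 / \<beta>\<close> becomes \<open>1 - \<gamma>\<close>, and
  \<open>- 1 / (\<beta> - n)\<close> is the exponent
  \<open>\<gamma> / (1 + \<gamma> * n)\<close>.\<close>

lemma weighted_variance_inequality:
  fixes \<phi> V :: "real ^ 'n \<Rightarrow> real" and \<gamma> :: real
  assumes \<gamma>: "- 1 / real CARD('n) < \<gamma>" "\<gamma> < 0"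
    and V: "convex_on UNIV V" "\<And>z. 0 \<le> V z" and \<phi>: "convex_on UNIV \<phi>" "\<And>z. 0 < \<phi> z"
    and wd: "well_defined \<gamma> V \<phi>" and fin: "energy \<gamma> V \<phi> < \<infinity>"
  shows "(1 - \<gamma>) * (\<integral>z. (G_fun V \<phi> z)\<^sup>2 \<partial>mu \<gamma> \<phi>)
    \<le> - \<gamma> * enn2real (energy \<gamma> V \<phi>) + (1 - \<gamma> / (1 + \<gamma> * real CARD('n))) * (\<integral>z. G_fun V \<phi> z \<partial>mu \<gamma> \<phi>)\<^sup>2"
proof -
  define \<beta> where "\<beta> = - 1 / \<gamma>"
  have \<gamma>\<beta>: "1 / \<gamma> = - \<beta>" "\<gamma> = - 1 / \<beta>" using \<gamma>(2) by (simp_all add: \<beta>_def)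
  have \<beta>n: "real CARD('n) < \<beta>"
  proof -
    have "- 1 < \<gamma> * real CARD('n)" using \<gamma>(1) by (subst (asm) pos_divide_less_eq) auto
    then show ?thesis using \<gamma>(2) unfolding \<beta>_def by (subst neg_less_divide_eq) (auto simp: mult.commute)
  qed
  then have \<beta>0: "0 < \<beta>" by (meson of_nat_0_le_iff le_less_trans)
  let ?p = "gradient \<phi>" and ?W = "\<lambda>z. V (gradient \<phi> z)"
  have GW: "G_phi V \<phi> = ?W" using \<phi>(2) by (auto simp: G_phi_def G_fun_def less_imp_neq[symmetric])
  have wd': "\<And>z. \<phi> differentiable (at z)" "\<And>z. ?p differentiable (at z)" "AE z in lborel. invertible (Hess \<phi> z)"
    "AE z in lborel. ?W differentiable (at z)" "integrable lborel (\<lambda>z. \<phi> z powr - \<beta>)"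
    "integrable (mu \<gamma> \<phi>) (G_fun V \<phi>)" "integrable (mu \<gamma> \<phi>) (\<lambda>z. (G_fun V \<phi> z)\<^sup>2)"
    using wd unfolding well_defined_def GW \<gamma>\<beta>(1) by blast+
  obtain k where k: "k \<in> borel_measurable borel"
    "AE z in lborel. \<exists>q. (V has_derivative (\<lambda>h. q \<bullet> h)) (at (?p z)) \<and> k z = (Hess \<phi> z *v q) \<bullet> q"
    "AE z in lborel. (matrix_inv (Hess \<phi> z) *v gradient ?W z) \<bullet> gradient ?W z = k z"
    by (rule exists_measurable_curvature[OF \<phi>(1) wd'(1,2) V wd'(3,4)])
  have d2: "(?p has_derivative (\<lambda>h. Hess \<phi> z *v h)) (at z)" for z
    using wd'(2) unfolding Hess_def jacobian_works .
  interpret convex_pair \<phi> ?p "\<lambda>z h. Hess \<phi> z *v h" V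
    by unfold_locales (use \<phi> V GDERIV_gradient[OF wd'(1)] d2 in auto)
  have [measurable]: "V \<in> borel_measurable borel" by (rule borel_measurable_continuous_onI[OF continuous_V])
  have [measurable]: "k \<in> borel_measurable borel" by (rule k(1))
  have Wm [measurable]: "W \<in> borel_measurable borel" by (rule borel_measurable_continuous_onI[OF continuous_W])
  define Z where "Z = (\<integral>y. \<phi> y powr - \<beta> \<partial>lborel)"
  have Z: "0 < Z"
  proof -
    have "0 \<le> Z" unfolding Z_def by (rule integral_nonneg_AE) auto
    moreover have "Z \<noteq> 0"
    proof
      assume "Z = 0"
      then have "AE y in lborel. \<phi> y powr - \<beta> = 0"
        unfolding Z_def using integral_nonneg_eq_0_iff_AE[OF wd'(5)] by auto
      then have "AE y in (lborel :: (real ^ 'n) measure). False"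
        by eventually_elim (use \<phi>(2) in \<open>simp add: less_imp_neq[symmetric]\<close>)
      then have "emeasure (lborel :: (real ^ 'n) measure) (space lborel) = 0"
        by (simp add: AE_iff_measurable[OF _ refl])
      then show False by simp
    qed
    ultimately show ?thesis by simp
  qed
  have mu: "mu \<gamma> \<phi> = density lborel (\<lambda>z. ennreal (\<phi> z powr - \<beta> / Z))"
    unfolding mu_def \<gamma>\<beta>(1) Z_def ..
  have wm: "(\<lambda>z. \<phi> z powr - \<beta> / Z) \<in> borel_measurable lborel" by measurable
  have wnn: "AE z in lborel. 0 \<le> \<phi> z powr - \<beta> / Z" using Z by simp
  have G: "G_fun V \<phi> z = W z / \<phi> z" for z by (simp add: G_fun_def W_def)
  have Gm: "G_fun V \<phi> \<in> borel_measurable lborel" unfolding G[abs_def] by measurable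
  have G2m: "(\<lambda>z. (G_fun V \<phi> z)\<^sup>2) \<in> borel_measurable lborel" using Gm by measurable
  have p1: "\<phi> z powr - (\<beta> + 1) = \<phi> z powr - \<beta> / \<phi> z" "\<phi> z powr - (\<beta> + 2) = \<phi> z powr - \<beta> / (\<phi> z)\<^sup>2" for z
    using \<phi>(2)[of z] powr_add[of "\<phi> z" "- \<beta>" "-1"] powr_add[of "\<phi> z" "- \<beta>" "-2"]
    by (simp_all add: powr_minus_divide)
  have e1: "(\<phi> z powr - \<beta> / Z) *\<^sub>R G_fun V \<phi> z = (W z * \<phi> z powr - (\<beta> + 1)) / Z" for z
    unfolding G p1 by (simp add: mult_ac)
  have e2: "(\<phi> z powr - \<beta> / Z) *\<^sub>R (G_fun V \<phi> z)\<^sup>2 = ((W z)\<^sup>2 * \<phi> z powr - (\<beta> + 2)) / Z" for z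
    unfolding G p1 by (simp add: power_divide mult_ac)
  have iZ: "integrable lborel f" if "integrable lborel (\<lambda>z. f z / Z)" for f :: "real ^ 'n \<Rightarrow> real"
    using integrable_mult_left[OF that, of Z] Z by simp
  have i1: "integrable lborel (\<lambda>z. W z * \<phi> z powr - (\<beta> + 1))"
    using wd'(6) unfolding mu integrable_density[OF Gm wm wnn] e1 by (rule iZ)
  have i2: "integrable lborel (\<lambda>z. (W z)\<^sup>2 * \<phi> z powr - (\<beta> + 2))"
    using wd'(7) unfolding mu integrable_density[OF G2m wm wnn] e2 by (rule iZ)
  define m1 where "m1 = (\<integral>z. G_fun V \<phi> z \<partial>mu \<gamma> \<phi>)"
  define m2 where "m2 = (\<integral>z. (G_fun V \<phi> z)\<^sup>2 \<partial>mu \<gamma> \<phi>)"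
  have m1: "(\<integral>z. W z * \<phi> z powr - (\<beta> + 1) \<partial>lborel) = Z * m1"
    unfolding m1_def mu integral_density[OF Gm wm wnn] e1 using Z by simp
  have m2: "(\<integral>z. (W z)\<^sup>2 * \<phi> z powr - (\<beta> + 2) \<partial>lborel) = Z * m2"
    unfolding m2_def mu integral_density[OF G2m wm wnn] e2 using Z by simp
  have knn: "AE z in lborel. 0 \<le> k z * \<phi> z powr - (\<beta> + 1)"
    using k(2) by eventually_elim (use D_nonneg in \<open>auto intro!: mult_nonneg_nonneg\<close>)
  have en: "energy \<gamma> V \<phi> = (\<integral>\<^sup>+z. ennreal (k z * \<phi> z powr - (\<beta> + 1) / Z) \<partial>lborel)"
  proof -
    have "energy \<gamma> V \<phi> = (\<integral>\<^sup>+z. ennreal (k z / \<phi> z) \<partial>mu \<gamma> \<phi>)"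
      unfolding energy_def GW
    proof (rule nn_integral_cong_AE)
      have "AE z in mu \<gamma> \<phi>. (matrix_inv (Hess \<phi> z) *v gradient ?W z) \<bullet> gradient ?W z = k z"
        unfolding mu using k(3) wm by (subst AE_density) (auto elim: eventually_mono)
      then show "AE z in mu \<gamma> \<phi>. ennreal ((matrix_inv (Hess \<phi> z) *v gradient ?W z) \<bullet> gradient ?W z / \<phi> z) = ennreal (k z / \<phi> z)"
        by eventually_elim simp
    qed
    also have "\<dots> = (\<integral>\<^sup>+z. ennreal (\<phi> z powr - \<beta> / Z) * ennreal (k z / \<phi> z) \<partial>lborel)"
      unfolding mu by (rule nn_integral_density) measurable
    also have "\<dots> = (\<integral>\<^sup>+z. ennreal (k z * \<phi> z powr - (\<beta> + 1) / Z) \<partial>lborel)"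
    proof (intro nn_integral_cong)
      fix z
      have "ennreal (\<phi> z powr - \<beta> / Z) * ennreal (k z / \<phi> z) = ennreal (\<phi> z powr - \<beta> / Z * (k z / \<phi> z))"
        using Z by (intro ennreal_mult'[symmetric]) simp
      then show "ennreal (\<phi> z powr - \<beta> / Z) * ennreal (k z / \<phi> z) = ennreal (k z * \<phi> z powr - (\<beta> + 1) / Z)"
        unfolding p1 by (simp add: mult_ac)
    qed
    finally show ?thesis .
  qed
  have km: "(\<lambda>z. k z * \<phi> z powr - (\<beta> + 1) / Z) \<in> borel_measurable lborel" by measurable
  have knn': "AE z in lborel. 0 \<le> k z * \<phi> z powr - (\<beta> + 1) / Z"
    using knn by eventually_elim (use Z in simp)
  have "integrable lborel (\<lambda>z. k z * \<phi> z powr - (\<beta> + 1) / Z)"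
    using fin unfolding en by (intro integrableI_nonneg km knn')
  then have i3: "integrable lborel (\<lambda>z. k z * \<phi> z powr - (\<beta> + 1))" by (rule iZ)
  define e where "e = enn2real (energy \<gamma> V \<phi>)"
  have "e = (\<integral>z. k z * \<phi> z powr - (\<beta> + 1) / Z \<partial>lborel)"
    unfolding e_def en using km knn' by (intro integral_eq_nn_integral[symmetric]) auto
  then have m3: "(\<integral>z. k z * \<phi> z powr - (\<beta> + 1) \<partial>lborel) = Z * e" using Z by simp
  define s where "s = - 1 / (\<beta> - real CARD('n))"
  let ?M = "\<lambda>m. restrict_space lborel (ball (0 :: real ^ 'n) (real (Suc m)))"
  have "(\<beta> * (\<beta> + 1) * (\<integral>y. (W y)\<^sup>2 * \<phi> y powr - (\<beta> + 2) \<partial>?M m) - \<beta> * (\<integral>y. k y * \<phi> y powr - (\<beta> + 1) \<partial>?M m))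
       * (\<integral>y. \<phi> y powr - \<beta> \<partial>?M m) \<le> (1 - s) * (\<beta> * (\<integral>y. W y * \<phi> y powr - (\<beta> + 1) \<partial>?M m))\<^sup>2" for m
    using local_variance(2)[of "real (Suc m)" \<beta> k] k(1,2) \<beta>n by (simp add: s_def)
  moreover have "(\<lambda>m. (\<beta> * (\<beta> + 1) * (\<integral>y. (W y)\<^sup>2 * \<phi> y powr - (\<beta> + 2) \<partial>?M m) - \<beta> * (\<integral>y. k y * \<phi> y powr - (\<beta> + 1) \<partial>?M m))
       * (\<integral>y. \<phi> y powr - \<beta> \<partial>?M m)) \<longlonglongrightarrow> (\<beta> * (\<beta> + 1) * (Z * m2) - \<beta> * (Z * e)) * Z"
    by (intro tendsto_intros integral_ball_exhaustion[OF i2, unfolded m2] integral_ball_exhaustion[OF i3, unfolded m3]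
        integral_ball_exhaustion[OF wd'(5), folded Z_def])
  moreover have "(\<lambda>m. (1 - s) * (\<beta> * (\<integral>y. W y * \<phi> y powr - (\<beta> + 1) \<partial>?M m))\<^sup>2) \<longlonglongrightarrow> (1 - s) * (\<beta> * (Z * m1))\<^sup>2"
    by (intro tendsto_intros integral_ball_exhaustion[OF i1, unfolded m1])
  ultimately have "(\<beta> * (\<beta> + 1) * (Z * m2) - \<beta> * (Z * e)) * Z \<le> (1 - s) * (\<beta> * (Z * m1))\<^sup>2"
    by (intro LIMSEQ_le) auto
  moreover have "(1 - s) * (\<beta> * (Z * m1))\<^sup>2 = (\<beta> * Z)\<^sup>2 * ((1 - s) * m1\<^sup>2)"
    by (simp add: power_mult_distrib mult_ac)
  moreover have "(\<beta> * (\<beta> + 1) * (Z * m2) - \<beta> * (Z * e)) * Z = (\<beta> * Z)\<^sup>2 * ((1 + 1 / \<beta>) * m2 - (1 / \<beta>) * e)"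
  proof -
    have "\<beta>\<^sup>2 * (1 + 1 / \<beta>) = \<beta> * (\<beta> + 1)" "\<beta>\<^sup>2 * (1 / \<beta>) = \<beta>"
      using \<beta>0 by (simp_all add: power2_eq_square distrib_left)
    moreover have "(\<beta> * Z)\<^sup>2 * ((1 + 1 / \<beta>) * m2 - (1 / \<beta>) * e)
        = Z * Z * ((\<beta>\<^sup>2 * (1 + 1 / \<beta>)) * m2 - (\<beta>\<^sup>2 * (1 / \<beta>)) * e)"
      by (simp only: power_mult_distrib right_diff_distrib power2_eq_square[of Z] mult_ac)
    ultimately show ?thesis by (simp only: left_diff_distrib right_diff_distrib mult_ac)
  qed
  ultimately have "(\<beta> * Z)\<^sup>2 * ((1 + 1 / \<beta>) * m2 - (1 / \<beta>) * e) \<le> (\<beta> * Z)\<^sup>2 * ((1 - s) * m1\<^sup>2)"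
    by (simp only:)
  then have "(1 + 1 / \<beta>) * m2 - (1 / \<beta>) * e \<le> (1 - s) * m1\<^sup>2"
    using \<beta>0 Z by (simp only: mult_le_cancel_left_pos zero_less_power mult_pos_pos)
  moreover have "1 / \<beta> = - \<gamma>" using \<gamma>(2) by (simp add: \<beta>_def)
  moreover have "s = \<gamma> / (1 + \<gamma> * real CARD('n))"
  proof -
    have "\<beta> - real CARD('n) = - (1 + \<gamma> * real CARD('n)) / \<gamma>" using \<gamma>(2) by (simp add: \<beta>_def field_simps)
    moreover have "- 1 / (- d / \<gamma>) = \<gamma> / d" for d by simp
    ultimately show ?thesis unfolding s_def by (simp only:)
  qed
  ultimately show ?thesis unfolding m1_def m2_def e_def by (simp add: algebra_simps)
qed

section \<open>The extended-real inequality: endpoint exponent, infinite energy and the regular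
  case\<close>

theorem corollary5p2:
  fixes V \<phi> :: "real ^ 'n \<Rightarrow> real" and \<gamma> :: real and s :: ereal
  assumes "- 1 / real CARD('n) \<le> \<gamma>" and "\<gamma> < 0"
    and "s = s_exponent CARD('n) \<gamma>"
    and "convex_on UNIV V" and "\<And>z. 0 \<le> V z"
    and "convex_on UNIV \<phi>" and "\<And>z. 0 \<le> \<phi> z"
    and "filterlim (\<lambda>z. V z / norm z) at_top at_infinity"
    and "well_defined \<gamma> V \<phi>"
  shows "ereal (variance_wrt (mu \<gamma> \<phi>) (G_fun V \<phi>))
     \<le> ereal (- \<gamma> / (1 - \<gamma>)) * enn2ereal (energy \<gamma> V \<phi>)
        + (ereal \<gamma> - s) / ereal (1 - \<gamma>) * ereal ((\<integral>z. G_fun V \<phi> z \<partial>mu \<gamma> \<phi>)\<^sup>2)"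
proof -
  let ?mu = "mu \<gamma> \<phi>" and ?G = "G_fun V \<phi>" and ?e = "energy \<gamma> V \<phi>"
  let ?m1 = "\<integral>z. ?G z \<partial>?mu" and ?m2 = "\<integral>z. (?G z)\<^sup>2 \<partial>?mu"
  have \<gamma>1: "0 < - \<gamma> / (1 - \<gamma>)" "0 < 1 - \<gamma>" using assms(2) by (auto intro: divide_neg_pos)
  have \<phi>pos: "0 < \<phi> z" for z using assms(7)[of z] assms(9) by (auto simp: well_defined_def less_le)
  have e0: "0 \<le> ereal (- \<gamma> / (1 - \<gamma>)) * enn2ereal ?e"
    using \<gamma>1 by (intro ereal_0_le_mult) auto
  show ?thesis
  proof (cases "\<gamma> = - 1 / real CARD('n)")
    case True
    then have s: "s = - \<infinity>" using assms(3) by (simp add: s_exponent_def)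
    have inf: "(ereal \<gamma> - s) / ereal (1 - \<gamma>) = \<infinity>" using \<gamma>1 by (simp add: s)
    show ?thesis
    proof (cases "?m1 = 0")
      case True
      \<comment> \<open>In the extended reals infinity times 0 is 0, so the infinite coefficient is
        of no help here. Instead, a nonnegative function with zero mean vanishes almost everywhere,
        hence has variance 0.\<close>
      have "AE z in ?mu. ?G z = 0"
      proof (rule integral_nonneg_eq_0_iff_AE[THEN iffD1, OF _ _ True])
        show "integrable ?mu ?G" using assms(9) by (simp add: well_defined_def)
        show "AE z in ?mu. 0 \<le> ?G z"
          by (intro AE_I2) (simp add: G_fun_def assms(5) less_imp_le[OF \<phi>pos])
      qed
      then have "AE z in ?mu. (?G z)\<^sup>2 = 0" by eventually_elim simp
      then have "?m2 = 0" by (rule integral_eq_zero_AE)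
      then have "variance_wrt ?mu ?G = 0" using True by (simp add: variance_wrt_def)
      then show ?thesis using e0 True by (simp add: zero_ereal_def[symmetric])
    next
      case False
      then have "0 < ?m1\<^sup>2" by simp
      then have "(ereal \<gamma> - s) / ereal (1 - \<gamma>) * ereal (?m1\<^sup>2) = \<infinity>" unfolding inf by simp
      moreover have "x + \<infinity> = \<infinity>" if "0 \<le> x" for x :: ereal using that by (cases x) auto
      ultimately show ?thesis using e0 by (simp only: ereal_less_eq)
    qed
  next
    case False
    then have \<gamma>lt: "- 1 / real CARD('n) < \<gamma>" using assms(1) by simp
    define s0 where "s0 = \<gamma> / (1 + \<gamma> * real CARD('n))"
    have s: "s = ereal s0" using False assms(3) by (simp add: s_exponent_def s0_def)
    have c: "(ereal \<gamma> - s) / ereal (1 - \<gamma>) * ereal (?m1\<^sup>2) = ereal ((\<gamma> - s0) / (1 - \<gamma>) * ?m1\<^sup>2)"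
      using \<gamma>1 by (simp add: s)
    show ?thesis
    proof (cases "?e = \<infinity>")
      case True
      then have "enn2ereal ?e = \<infinity>" by simp
      moreover have "ereal x * \<infinity> = \<infinity>" if "0 < x" for x using that by simp
      ultimately have "ereal (- \<gamma> / (1 - \<gamma>)) * enn2ereal ?e = \<infinity>" using \<gamma>1(1) by (simp only:)
      moreover have "\<infinity> + ereal x = \<infinity>" for x by simp
      ultimately show ?thesis unfolding c by (simp only: ereal_less_eq)
    next
      case False
      then have fin: "?e < \<infinity>" by (simp add: less_top)
      define e where "e = enn2real ?e"
      have "ennreal e = ?e" using fin by (simp add: e_def)
      moreover have "enn2ereal (ennreal e) = ereal e" by (rule enn2ereal_ennreal) (simp add: e_def)
      ultimately have ee: "enn2ereal ?e = ereal e" by (simp only:)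
      have "(1 - \<gamma>) * ?m2 \<le> - \<gamma> * e + (1 - s0) * ?m1\<^sup>2"
        unfolding e_def s0_def by (rule weighted_variance_inequality[OF \<gamma>lt assms(2,4-6) \<phi>pos assms(9) fin])
      then have "?m2 \<le> (- \<gamma> * e + (1 - s0) * ?m1\<^sup>2) / (1 - \<gamma>)"
        using \<gamma>1(2) by (simp add: pos_le_divide_eq mult.commute)
      \<comment> \<open>Splitting \<open>1 - s0\<close> into \<open>\<gamma> - s0\<close> and
        \<open>1 - \<gamma>\<close> isolates the squared mean that the variance subtracts.\<close>
      also have "\<dots> = - \<gamma> / (1 - \<gamma>) * e + ((\<gamma> - s0) / (1 - \<gamma>) * ?m1\<^sup>2 + ?m1\<^sup>2)"
      proof -
        have "- \<gamma> * e + (1 - s0) * ?m1\<^sup>2 = - \<gamma> * e + ((\<gamma> - s0) * ?m1\<^sup>2 + (1 - \<gamma>) * ?m1\<^sup>2)"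
          by (simp add: algebra_simps)
        moreover have "(1 - \<gamma>) * ?m1\<^sup>2 / (1 - \<gamma>) = ?m1\<^sup>2" using \<gamma>1(2) by simp
        ultimately show ?thesis by (simp only: add_divide_distrib times_divide_eq_left)
      qed
      finally show ?thesis unfolding c ee variance_wrt_def by simp
    qed
  qed
qed

end
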